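(* In the setting described in the context, consider $\hat\beta=(\hat\beta^{(1)}_t,\hat\beta^{(2)}_t,\hat\beta^{(3)}_t,\hat\beta^{(4)}_t)_{t\in[0,T]}\in\Gamma^{\mathcal{H}}$, with $$\hat\beta^{(2)}_t=\hat\beta^{(4)}_t=0,\qquad \hat\beta^{(1)}_t=\begin{cases}\dfrac{r_t-\mu_t-\lambda^{(1)}_ta^{(3)}_t\sigma(t,Y_t)\hat\beta^{(3)}_t}{\sigma(t,Y_t)a^{(1)}_t}&\text{if }a^{(1)}_t\neq0,\\[2mm]0&\text{if }a^{(1)}_t=0,\end{cases}$$ and let $\hat\beta^{(3)}_t$ be the unique solution $x\in(-1,\infty)$ of the equation $$\lambda^{(1)}_t\sigma(t,Y_t)(a^{(3)}_t)^2x+(a^{(1)}_t)^2\sigma(t,Y_t)\Big(\frac{x}{1+x}\Big)-a^{(3)}_t(r_t-\mu_t)=0.$$ Then the $P$-E.M.M. $\hat Q$ defined by its Radon–Nikodym density $$\frac{d\hat Q}{dP}=\prod_{i=1}^2\mathcal{E}(\hat\beta^{(i)}W^{(i)})_T\,\mathcal{E}(\hat\beta^{(i+2)}M^{(i)})_T$$ is the $P$-E.M.M. minimizing $I(P,Q^\beta)=-E_P\big[\ln\frac{dQ^\beta}{dP}\big]$ over $\beta\in\Gamma^{\mathcal{H}}$.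
   Context: Setting. $T>0$ is fixed. On $(\Omega,\mathcal{F},(\mathcal{F}_t)_{t\in[0,T]},P)$, $W=(W^{(1)},W^{(2)})$ is a 2-dimensional Brownian motion and $N=(N^{(1)},N^{(2)})$ is a 2-dimensional Poisson process with independent components and deterministic intensity $(\int_0^t\lambda^{(1)}_sds,\int_0^t\lambda^{(2)}_sds)$; $(\mathcal{F}_t)$ is the natural filtration generated by $W$ and $N$. The compensated Poisson process $M=(M^{(1)},M^{(2)})$ is given by $dM^{(i)}_t=dN^{(i)}_t-\lambda^{(i)}_tdt$, and $W$ and $M$ are independent. Market. The riskless asset satisfies $dA_t=r_tA_tdt$, $A_0=1$, with $r$ deterministic. The risky asset $S$ and the process $Y$ satisfy $$\frac{dS_t}{S_t}=\mu_tdt+\sigma(t,Y_t)[a^{(1)}_tdW^{(1)}_t+a^{(3)}_tdM^{(1)}_t],\quad S_0=x>0,$$ $$dY_t=\mu^Y_tdt+\sum_{i=1}^2\sigma^{(i)}_t[a^{(i)}_tdW^{(i)}_t+a^{(i+2)}_tdM^{(i)}_t],\quad Y_0=y\in\mathbb{R},$$ where $a^{(i)}:[0,T]\to\mathbb{R}$, $1\le i\le4$, are deterministic functions, $\mu,\mu^Y,\sigma^{(1)},\sigma^{(2)}$ and $\sigma(\cdot,\cdot)$ are the given coefficients, and $\sigma(t,\cdot)\neq0$, $1+\sigma(t,\cdot)a^{(3)}_t>0$ for all $t\in[0,T]$. Definitions. $\Gamma$ is the set of $(\mathcal{F}_t)$-predictable $\mathbb{R}^4$-valued processes $\gamma$ with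 $\sum_{i=1}^2E_P[\int_0^t(\gamma^{(i)}_s)^2ds]+\sum_{i=1}^2E_P[\int_0^t(\gamma^{(i+2)}_s)^2\lambda^{(i)}_sds]<\infty$ for $t\in[0,T]$. A $P$-equivalent martingale measure ($P$-E.M.M.) is a probability $Q$ equivalent to $P$ under which the discounted price $(e^{-\int_0^tr_sds}S_t)_{t\in[0,T]}$ is a martingale; $\mathcal{H}$ is the set of all $P$-E.M.M. $\Gamma^{\mathcal{H}}$ is the set of processes $\beta\in\Gamma$ (with $\beta^{(3)},\beta^{(4)}>-1$) satisfying $$\mu_t-r_t+\beta^{(1)}_ta^{(1)}_t\sigma(t,Y_t)+\lambda^{(1)}_t\beta^{(3)}_ta^{(3)}_t\sigma(t,Y_t)=0.$$ For $\beta\in\Gamma^{\mathcal{H}}$, $Q^\beta$ denotes the measure with density $$\frac{dQ^\beta}{dP}=\prod_{i=1}^2\mathcal{E}(\beta^{(i)}W^{(i)})_T\,\mathcal{E}(\beta^{(i+2)}M^{(i)})_T;$$ it is asserted (not imposed as an extra condition on $\beta$) that for every $\beta\in\Gamma^{\mathcal{H}}$ this density defines a $P$-E.M.M. Here $\mathcal{E}(\beta^{(i)}W^{(i)})$, $\mathcal{E}(\beta^{(i+2)}M^{(i)})$ are the Doléans-Dade exponentials of $\int_0^\cdot\beta^{(i)}_sdW^{(i)}_s$ and $\int_0^\cdot\beta^{(i+2)}_sdM^{(i)}_s$. The relative entropy is $I(P,Q^\beta)=E_{Q^\beta}\big[\frac{dP}{dQ^\beta}\ln\frac{dP}{dQ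^\beta}\big]=-E_P\big[\ln\frac{dQ^\beta}{dP}\big]$.
   Formalization: That Q̂ is a P-E.M.M. is assumed (not every β in Γ^H, nor even every β̂, yields a probability measure), and uniqueness of the minimizing measure is claimed only when I(P,Q̂) is finite, since otherwise all entropies are infinite. *)

theory Defs
  imports "HOL-Probability.Probability"
begin

section \<open>Processes on a finite horizon\<close>

text \<open>A process is a function \<open>X t \<omega>\<close>; only its values at times \<open>t \<in> {0..T}\<close> are
  meaningful. Families such as \<open>W\<close>, \<open>N\<close>, \<open>a\<close>, \<open>lam\<close>, \<open>\<beta>\<close> are indexed from 1, as on paper.\<close>

definition left_lim :: "(real \<Rightarrow> real) \<Rightarrow> real \<Rightarrow> real" where
  "left_lim f t = (if t = 0 then f 0 else Lim (at_left t) f)"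

definition cadlag :: "real \<Rightarrow> (real \<Rightarrow> real) \<Rightarrow> bool" where
  "cadlag T f \<longleftrightarrow>
     (\<forall>t\<in>{0..<T}. (f \<longlongrightarrow> f t) (at_right t)) \<and>
     (\<forall>t\<in>{0<..T}. \<exists>l. (f \<longlongrightarrow> l) (at_left t))"

definition history :: "'a measure \<Rightarrow> (real \<Rightarrow> 'a \<Rightarrow> real) \<Rightarrow> real \<Rightarrow> 'a measure" where
  "history P X t =
     sigma (space P) {X s -` B \<inter> space P | s B. s \<in> {0..t} \<and> B \<in> sets borel}"

definition independent_increments :: "'a measure \<Rightarrow> real \<Rightarrow> (real \<Rightarrow> 'a \<Rightarrow> real) \<Rightarrow> bool" where
  "independent_increments P T X \<longleftrightarrow>
     (\<forall>s t. 0 \<le> s \<and> s \<le> t \<and> t \<le> T \<longrightarrow>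
        prob_space.indep_set P (sets (history P X s))
          {(\<lambda>\<omega>. X t \<omega> - X s \<omega>) -` B \<inter> space P | B. B \<in> sets borel})"

definition brownian_motion :: "'a measure \<Rightarrow> real \<Rightarrow> (real \<Rightarrow> 'a \<Rightarrow> real) \<Rightarrow> bool" where
  "brownian_motion P T W \<longleftrightarrow>
     (\<forall>t\<in>{0..T}. W t \<in> borel_measurable P) \<and>
     (\<forall>\<omega>\<in>space P. W 0 \<omega> = 0 \<and> continuous_on {0..T} (\<lambda>t. W t \<omega>)) \<and>
     independent_increments P T W \<and>
     (\<forall>s t. 0 \<le> s \<and> s < t \<and> t \<le> T \<longrightarrow>
        distributed P lborel (\<lambda>\<omega>. W t \<omega> - W s \<omega>) (normal_density 0 (sqrt (t - s))))"

text \<open>The path properties are required for every \<open>\<omega>\<close> (not merely almost every one), so that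
  pathwise sums and products over the jump times are finite and measurable.\<close>

definition poisson_process ::
    "'a measure \<Rightarrow> real \<Rightarrow> (real \<Rightarrow> real) \<Rightarrow> (real \<Rightarrow> 'a \<Rightarrow> nat) \<Rightarrow> bool" where
  "poisson_process P T lam N \<longleftrightarrow>
     (\<forall>t\<in>{0..T}. N t \<in> measurable P (count_space UNIV)) \<and>
     (\<forall>\<omega>\<in>space P. N 0 \<omega> = 0 \<and> mono_on {0..T} (\<lambda>t. N t \<omega>) \<and> cadlag T (\<lambda>t. real (N t \<omega>))) \<and>
     independent_increments P T (\<lambda>t \<omega>. real (N t \<omega>)) \<and>
     (\<forall>s t k. 0 \<le> s \<and> s \<le> t \<and> t \<le> T \<longrightarrow>
        measure P {\<omega> \<in> space P. N t \<omega> = N s \<omega> + k} =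
          exp (- (LBINT u:{s..t}. lam u)) * (LBINT u:{s..t}. lam u) ^ k / fact k)"

definition driver ::
    "(nat \<Rightarrow> real \<Rightarrow> 'a \<Rightarrow> real) \<Rightarrow> (nat \<Rightarrow> real \<Rightarrow> 'a \<Rightarrow> nat) \<Rightarrow> nat \<Rightarrow> real \<Rightarrow> 'a \<Rightarrow> real" where
  "driver W N i = (if i \<le> 2 then W i else (\<lambda>t \<omega>. real (N (i - 2) t \<omega>)))"

text \<open>The natural filtration is augmented by the null sets of \<open>P\<close>, the usual convention; it makes
  the everywhere-cadlag versions of stochastic integrals adapted.\<close>

definition natural_filtration ::
    "'a measure \<Rightarrow> real \<Rightarrow> (nat \<Rightarrow> real \<Rightarrow> 'a \<Rightarrow> real) \<Rightarrow> (nat \<Rightarrow> real \<Rightarrow> 'a \<Rightarrow> nat)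
      \<Rightarrow> real \<Rightarrow> 'a measure" where
  "natural_filtration P T W N t =
     sigma (space P)
       ({driver W N i s -` B \<inter> space P | i s B.
           i \<in> {1..4} \<and> s \<in> {0..min t T} \<and> B \<in> sets borel} \<union> null_sets P)"

definition adapted :: "(real \<Rightarrow> 'a measure) \<Rightarrow> real \<Rightarrow> (real \<Rightarrow> 'a \<Rightarrow> real) \<Rightarrow> bool" where
  "adapted F T X \<longleftrightarrow> (\<forall>t\<in>{0..T}. X t \<in> borel_measurable (F t))"

definition predictable_algebra ::
    "'a measure \<Rightarrow> (real \<Rightarrow> 'a measure) \<Rightarrow> real \<Rightarrow> (real \<times> 'a) measure" where
  "predictable_algebra P F T =
     sigma ({0..T} \<times> space P)
       ({{0} \<times> A | A. A \<in> sets (F 0)} \<union>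
        {{s<..t} \<times> A | s t A. 0 \<le> s \<and> s \<le> t \<and> t \<le> T \<and> A \<in> sets (F s)})"

definition predictable ::
    "'a measure \<Rightarrow> (real \<Rightarrow> 'a measure) \<Rightarrow> real \<Rightarrow> (real \<Rightarrow> 'a \<Rightarrow> real) \<Rightarrow> bool" where
  "predictable P F T H \<longleftrightarrow> (\<lambda>(t, \<omega>). H t \<omega>) \<in> borel_measurable (predictable_algebra P F T)"

definition martingale ::
    "'a measure \<Rightarrow> (real \<Rightarrow> 'a measure) \<Rightarrow> real \<Rightarrow> (real \<Rightarrow> 'a \<Rightarrow> real) \<Rightarrow> bool" where
  "martingale Q F T X \<longleftrightarrow>
     adapted F T X \<and>
     (\<forall>t\<in>{0..T}. integrable Q (X t)) \<and>
     (\<forall>s t. 0 \<le> s \<and> s \<le> t \<and> t \<le> T \<longrightarrow>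
        (AE \<omega> in Q. real_cond_exp Q (F s) (X t) \<omega> = X s \<omega>))"

section \<open>Stochastic integrals\<close>

text \<open>Simple predictable processes are
  \<open>\<Sum>i<n. \<xi> i * indicator {\<tau> i <.. \<tau> (i + 1)}\<close> with deterministic grid points \<open>\<tau> i\<close>.\<close>

definition simple_predictable ::
    "'a measure \<Rightarrow> (real \<Rightarrow> 'a measure) \<Rightarrow> real \<Rightarrow> nat \<Rightarrow> (nat \<Rightarrow> real) \<Rightarrow> (nat \<Rightarrow> 'a \<Rightarrow> real)
      \<Rightarrow> bool" where
  "simple_predictable P F T n \<tau> \<xi> \<longleftrightarrow>
     (\<forall>i\<le>n. \<tau> i \<in> {0..T}) \<and> (\<forall>i<n. \<tau> i \<le> \<tau> (Suc i)) \<and>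
     (\<forall>i<n. \<xi> i \<in> borel_measurable (F (\<tau> i)) \<and> (\<exists>C. \<forall>\<omega>\<in>space P. \<bar>\<xi> i \<omega>\<bar> \<le> C))"

definition simple_process ::
    "nat \<Rightarrow> (nat \<Rightarrow> real) \<Rightarrow> (nat \<Rightarrow> 'a \<Rightarrow> real) \<Rightarrow> real \<Rightarrow> 'a \<Rightarrow> real" where
  "simple_process n \<tau> \<xi> s \<omega> = (\<Sum>i<n. \<xi> i \<omega> * indicator {\<tau> i<..\<tau> (Suc i)} s)"

definition simple_integral ::
    "nat \<Rightarrow> (nat \<Rightarrow> real) \<Rightarrow> (nat \<Rightarrow> 'a \<Rightarrow> real) \<Rightarrow> (real \<Rightarrow> 'a \<Rightarrow> real) \<Rightarrow> real \<Rightarrow> 'a \<Rightarrow> real" where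
  "simple_integral n \<tau> \<xi> X t \<omega> =
     (\<Sum>i<n. \<xi> i \<omega> * (X (min (\<tau> (Suc i)) t) \<omega> - X (min (\<tau> i) t) \<omega>))"

text \<open>\<open>J t\<close> is a version of the Ito integral of \<open>H\<close> with respect to \<open>W\<close> over \<open>{0..t}\<close>: the
  \<open>L\<^sup>2\<close>-limit of the integrals of simple processes converging to \<open>H\<close> in \<open>L\<^sup>2(dt \<otimes> P)\<close>.\<close>

definition has_ito_integral_L2 ::
    "'a measure \<Rightarrow> (real \<Rightarrow> 'a measure) \<Rightarrow> real \<Rightarrow> (real \<Rightarrow> 'a \<Rightarrow> real) \<Rightarrow> (real \<Rightarrow> 'a \<Rightarrow> real)
      \<Rightarrow> (real \<Rightarrow> 'a \<Rightarrow> real) \<Rightarrow> bool" where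
  "has_ito_integral_L2 P F T W H J \<longleftrightarrow>
     predictable P F T H \<and> adapted F T J \<and>
     (\<exists>n \<tau> \<xi>. (\<forall>k::nat. simple_predictable P F T (n k) (\<tau> k) (\<xi> k)) \<and>
        (\<lambda>k. \<integral>\<^sup>+\<omega>. (\<integral>\<^sup>+s\<in>{0..T}.
            ennreal ((simple_process (n k) (\<tau> k) (\<xi> k) s \<omega> - H s \<omega>)\<^sup>2) \<partial>lborel) \<partial>P)
          \<longlonglongrightarrow> 0 \<and>
        (\<forall>t\<in>{0..T}. (\<lambda>k. \<integral>\<^sup>+\<omega>.
            ennreal ((simple_integral (n k) (\<tau> k) (\<xi> k) W t \<omega> - J t \<omega>)\<^sup>2) \<partial>P) \<longlonglongrightarrow> 0))"

text \<open>Extension by localization to integrands that are only locally square integrable.\<close>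

definition has_ito_integral ::
    "'a measure \<Rightarrow> (real \<Rightarrow> 'a measure) \<Rightarrow> real \<Rightarrow> (real \<Rightarrow> 'a \<Rightarrow> real) \<Rightarrow> (real \<Rightarrow> 'a \<Rightarrow> real)
      \<Rightarrow> (real \<Rightarrow> 'a \<Rightarrow> real) \<Rightarrow> bool" where
  "has_ito_integral P F T W H J \<longleftrightarrow>
     adapted F T J \<and>
     (\<exists>\<rho> :: nat \<Rightarrow> 'a \<Rightarrow> real.
        (\<forall>m. stopping_time F (\<rho> m)) \<and>
        (\<forall>\<omega>\<in>space P. incseq (\<lambda>m. \<rho> m \<omega>)) \<and>
        (AE \<omega> in P. \<exists>m. T \<le> \<rho> m \<omega>) \<and>
        (\<forall>m. \<exists>K. has_ito_integral_L2 P F T W (\<lambda>s \<omega>. if s \<le> \<rho> m \<omega> then H s \<omega> else 0) K \<and>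
           (\<forall>t\<in>{0..T}. AE \<omega> in P. t \<le> \<rho> m \<omega> \<longrightarrow> J t \<omega> = K t \<omega>)))"

definition jump :: "(real \<Rightarrow> 'a \<Rightarrow> nat) \<Rightarrow> real \<Rightarrow> 'a \<Rightarrow> real" where
  "jump N s \<omega> = real (N s \<omega>) - left_lim (\<lambda>u. real (N u \<omega>)) s"

definition jump_times :: "(real \<Rightarrow> 'a \<Rightarrow> nat) \<Rightarrow> real \<Rightarrow> 'a \<Rightarrow> real set" where
  "jump_times N t \<omega> = {s \<in> {0<..t}. jump N s \<omega> \<noteq> 0}"

text \<open>Since \<open>dM = dN - \<lambda> dt\<close> has finite variation, the integral against it is pathwise.\<close>

definition M_integrable ::
    "'a measure \<Rightarrow> real \<Rightarrow> (real \<Rightarrow> real) \<Rightarrow> (real \<Rightarrow> 'a \<Rightarrow> real) \<Rightarrow> bool" where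
  "M_integrable P T lam H \<longleftrightarrow>
     (AE \<omega> in P. set_integrable lborel {0..T} (\<lambda>s. H s \<omega> * lam s))"

definition M_integral ::
    "(real \<Rightarrow> real) \<Rightarrow> (real \<Rightarrow> 'a \<Rightarrow> nat) \<Rightarrow> (real \<Rightarrow> 'a \<Rightarrow> real) \<Rightarrow> real \<Rightarrow> 'a \<Rightarrow> real" where
  "M_integral lam N H t \<omega> =
     (\<Sum>s\<in>jump_times N t \<omega>. H s \<omega> * jump N s \<omega>) - (LBINT s:{0..t}. H s \<omega> * lam s)"

text \<open>The Doleans-Dade exponential of a semimartingale \<open>X\<close> with \<open>X\<^sub>0 = 0\<close> is
  \<open>exp (X\<^sub>t - [X\<^sup>c]\<^sub>t / 2) * (\<Prod>s\<le>t. (1 + \<Delta>X\<^sub>s) * exp (- \<Delta>X\<^sub>s))\<close>. It is instantiated below at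
  a version \<open>J\<close> of the Ito integral of \<open>\<beta>\<close>, with \<open>[J]\<^sub>t\<close> the integral of \<open>\<beta>\<^sup>2\<close>,
  and at \<open>M_integral lam N \<beta>\<close>, with jumps \<open>\<beta>\<^sub>s * \<Delta>N\<^sub>s\<close> and no continuous martingale part.\<close>

definition doleans_dade_W ::
    "(real \<Rightarrow> 'a \<Rightarrow> real) \<Rightarrow> (real \<Rightarrow> 'a \<Rightarrow> real) \<Rightarrow> real \<Rightarrow> 'a \<Rightarrow> real" where
  "doleans_dade_W \<beta> J t \<omega> = exp (J t \<omega> - (LBINT s:{0..t}. (\<beta> s \<omega>)\<^sup>2) / 2)"

definition doleans_dade_M ::
    "(real \<Rightarrow> real) \<Rightarrow> (real \<Rightarrow> 'a \<Rightarrow> nat) \<Rightarrow> (real \<Rightarrow> 'a \<Rightarrow> real) \<Rightarrow> real \<Rightarrow> 'a \<Rightarrow> real" where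
  "doleans_dade_M lam N \<beta> t \<omega> =
     exp (M_integral lam N \<beta> t \<omega>) *
     (\<Prod>s\<in>jump_times N t \<omega>. (1 + \<beta> s \<omega> * jump N s \<omega>) * exp (- (\<beta> s \<omega> * jump N s \<omega>)))"

section \<open>The market\<close>

text \<open>\<open>mu\<close>, \<open>muY\<close> and \<open>sigY i\<close> are allowed to be predictable processes; deterministic Borel
  functions are a special case. In the stochastic integrals \<open>S\<close> and \<open>\<sigma>(t, Y)\<close> are evaluated at the
  left limits, so that the integrands are predictable.\<close>

locale market =
  prob_space P for P :: "'a measure" +
  fixes T :: real
    and W :: "nat \<Rightarrow> real \<Rightarrow> 'a \<Rightarrow> real"
    and N :: "nat \<Rightarrow> real \<Rightarrow> 'a \<Rightarrow> nat"
    and lam :: "nat \<Rightarrow> real \<Rightarrow> real"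
    and F :: "real \<Rightarrow> 'a measure"
    and r A :: "real \<Rightarrow> real"
    and mu muY :: "real \<Rightarrow> 'a \<Rightarrow> real"
    and sigY :: "nat \<Rightarrow> real \<Rightarrow> 'a \<Rightarrow> real"
    and sig :: "real \<Rightarrow> real \<Rightarrow> real"
    and a :: "nat \<Rightarrow> real \<Rightarrow> real"
    and x y :: real
    and S Y :: "real \<Rightarrow> 'a \<Rightarrow> real"
  assumes T_pos: "0 < T"
    and lam_integrable: "\<And>i. i \<in> {1, 2} \<Longrightarrow> set_integrable lborel {0..T} (lam i)"
    and lam_nonneg: "\<And>i t. i \<in> {1, 2} \<Longrightarrow> t \<in> {0..T} \<Longrightarrow> 0 \<le> lam i t"
    and W_brownian: "\<And>i. i \<in> {1, 2} \<Longrightarrow> brownian_motion P T (W i)"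
    and N_poisson: "\<And>i. i \<in> {1, 2} \<Longrightarrow> poisson_process P T (lam i) (N i)"
    \<comment> \<open>the components of \<open>W\<close>, the components of \<open>N\<close>, and \<open>W\<close> and \<open>N\<close> are independent\<close>
    and drivers_indep: "indep_sets (\<lambda>i. sets (history P (driver W N i) T)) {1..4}"
    and F_natural: "F = natural_filtration P T W N"
    and r_integrable: "set_integrable lborel {0..T} r"
    and A_integrable: "set_integrable lborel {0..T} (\<lambda>s. r s * A s)"
    and A_eq: "\<And>t. t \<in> {0..T} \<Longrightarrow> A t = 1 + (LBINT s:{0..t}. r s * A s)"
    and a_borel: "\<And>i. i \<in> {1..4} \<Longrightarrow> set_borel_measurable lborel {0..T} (a i)"
    and mu_predictable: "predictable P F T mu"
    and muY_predictable: "predictable P F T muY"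
    and sigY_predictable: "\<And>i. i \<in> {1, 2} \<Longrightarrow> predictable P F T (sigY i)"
    and sig_borel: "(\<lambda>(t, z). sig t z) \<in> borel_measurable (restrict_space borel {0..T} \<Otimes>\<^sub>M borel)"
    and sig_nonzero: "\<And>t z. t \<in> {0..T} \<Longrightarrow> sig t z \<noteq> 0"
    and sig_jump: "\<And>t z. t \<in> {0..T} \<Longrightarrow> 1 + sig t z * a 3 t > 0"
    and x_pos: "0 < x"
    and S_adapted: "adapted F T S"
    and Y_adapted: "adapted F T Y"
    and S_cadlag: "\<And>\<omega>. \<omega> \<in> space P \<Longrightarrow> cadlag T (\<lambda>t. S t \<omega>)"
    and Y_cadlag: "\<And>\<omega>. \<omega> \<in> space P \<Longrightarrow> cadlag T (\<lambda>t. Y t \<omega>)"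
    and S_drift: "AE \<omega> in P. set_integrable lborel {0..T} (\<lambda>s. S s \<omega> * mu s \<omega>)"
    and S_M_integrable: "M_integrable P T (lam 1)
      (\<lambda>s \<omega>. left_lim (\<lambda>u. S u \<omega>) s * sig s (left_lim (\<lambda>u. Y u \<omega>) s) * a 3 s)"
    and S_eq: "\<exists>J. has_ito_integral P F T (W 1)
        (\<lambda>s \<omega>. left_lim (\<lambda>u. S u \<omega>) s * sig s (left_lim (\<lambda>u. Y u \<omega>) s) * a 1 s) J \<and>
      (\<forall>t\<in>{0..T}. AE \<omega> in P. S t \<omega> =
         x + (LBINT s:{0..t}. S s \<omega> * mu s \<omega>) + J t \<omega>
           + M_integral (lam 1) (N 1)
               (\<lambda>s \<omega>. left_lim (\<lambda>u. S u \<omega>) s * sig s (left_lim (\<lambda>u. Y u \<omega>) s) * a 3 s) t \<omega>)"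
    and Y_drift: "AE \<omega> in P. set_integrable lborel {0..T} (\<lambda>s. muY s \<omega>)"
    and Y_M_integrable:
      "\<And>i. i \<in> {1, 2} \<Longrightarrow> M_integrable P T (lam i) (\<lambda>s \<omega>. sigY i s \<omega> * a (i + 2) s)"
    and Y_eq: "\<exists>J. (\<forall>i\<in>{1, 2}. has_ito_integral P F T (W i) (\<lambda>s \<omega>. sigY i s \<omega> * a i s) (J i)) \<and>
      (\<forall>t\<in>{0..T}. AE \<omega> in P. Y t \<omega> =
         y + (LBINT s:{0..t}. muY s \<omega>)
           + (\<Sum>i\<in>{1, 2}. J i t \<omega> +
                M_integral (lam i) (N i) (\<lambda>s \<omega>. sigY i s \<omega> * a (i + 2) s) t \<omega>))"

section \<open>Martingale measures and relative entropy\<close>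

definition equivalent_measure :: "'a measure \<Rightarrow> 'a measure \<Rightarrow> bool" where
  "equivalent_measure P Q \<longleftrightarrow>
     sets Q = sets P \<and> absolutely_continuous P Q \<and> absolutely_continuous Q P"

definition EMM ::
    "'a measure \<Rightarrow> (real \<Rightarrow> 'a measure) \<Rightarrow> real \<Rightarrow> (real \<Rightarrow> real) \<Rightarrow> (real \<Rightarrow> 'a \<Rightarrow> real)
      \<Rightarrow> 'a measure set" where
  "EMM P F T r S =
     {Q. prob_space Q \<and> equivalent_measure P Q \<and>
         martingale Q F T (\<lambda>t \<omega>. exp (- (LBINT s:{0..t}. r s)) * S t \<omega>)}"

definition Gamma ::
    "'a measure \<Rightarrow> (real \<Rightarrow> 'a measure) \<Rightarrow> real \<Rightarrow> (nat \<Rightarrow> real \<Rightarrow> real)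
      \<Rightarrow> (nat \<Rightarrow> real \<Rightarrow> 'a \<Rightarrow> real) set" where
  "Gamma P F T lam =
     {\<gamma>. (\<forall>i\<in>{1..4}. predictable P F T (\<gamma> i)) \<and>
         (\<forall>t\<in>{0..T}.
            (\<Sum>i\<in>{1, 2}. \<integral>\<^sup>+\<omega>. (\<integral>\<^sup>+s\<in>{0..t}. ennreal ((\<gamma> i s \<omega>)\<^sup>2) \<partial>lborel) \<partial>P) +
            (\<Sum>i\<in>{1, 2}. \<integral>\<^sup>+\<omega>. (\<integral>\<^sup>+s\<in>{0..t}. ennreal ((\<gamma> (i + 2) s \<omega>)\<^sup>2 * lam i s) \<partial>lborel) \<partial>P)
            < \<infinity>)}"

text \<open>Identities between processes are understood \<open>dt \<otimes> P\<close>-almost everywhere. Thus it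
  does not matter that \<open>Y\<^sub>t\<close>, rather than its left limit, occurs in an equation for the predictable
  process \<open>\<beta>\<close>.\<close>

abbreviation time_space :: "'a measure \<Rightarrow> real \<Rightarrow> (real \<times> 'a) measure" where
  "time_space P T \<equiv> restrict_space lborel {0..T} \<Otimes>\<^sub>M P"

definition Gamma_H ::
    "'a measure \<Rightarrow> (real \<Rightarrow> 'a measure) \<Rightarrow> real \<Rightarrow> (nat \<Rightarrow> real \<Rightarrow> real) \<Rightarrow> (real \<Rightarrow> real)
      \<Rightarrow> (real \<Rightarrow> 'a \<Rightarrow> real) \<Rightarrow> (real \<Rightarrow> real \<Rightarrow> real) \<Rightarrow> (nat \<Rightarrow> real \<Rightarrow> real)
      \<Rightarrow> (real \<Rightarrow> 'a \<Rightarrow> real) \<Rightarrow> (nat \<Rightarrow> real \<Rightarrow> 'a \<Rightarrow> real) set" where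
  "Gamma_H P F T lam r mu sig a Y =
     {\<beta> \<in> Gamma P F T lam.
        (\<forall>t\<in>{0..T}. \<forall>\<omega>\<in>space P. \<beta> 3 t \<omega> > -1 \<and> \<beta> 4 t \<omega> > -1) \<and>
        (AE (t, \<omega>) in time_space P T.
           mu t \<omega> - r t + \<beta> 1 t \<omega> * a 1 t * sig t (Y t \<omega>)
             + lam 1 t * \<beta> 3 t \<omega> * a 3 t * sig t (Y t \<omega>) = 0)}"

text \<open>\<open>has_exponential_density P F T W N lam \<beta> Q\<close> says that \<open>Q\<close> is the measure \<open>Q\<^sup>\<beta>\<close>. It is
  a relation because the Ito integrals \<open>J i\<close> are only determined almost surely; the measure
  does not depend on the versions.\<close>

definition has_exponential_density ::
    "'a measure \<Rightarrow> (real \<Rightarrow> 'a measure) \<Rightarrow> real \<Rightarrow> (nat \<Rightarrow> real \<Rightarrow> 'a \<Rightarrow> real)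
      \<Rightarrow> (nat \<Rightarrow> real \<Rightarrow> 'a \<Rightarrow> nat) \<Rightarrow> (nat \<Rightarrow> real \<Rightarrow> real) \<Rightarrow> (nat \<Rightarrow> real \<Rightarrow> 'a \<Rightarrow> real)
      \<Rightarrow> 'a measure \<Rightarrow> bool" where
  "has_exponential_density P F T W N lam \<beta> Q \<longleftrightarrow>
     (\<exists>J. (\<forall>i\<in>{1, 2}. has_ito_integral_L2 P F T (W i) (\<beta> i) (J i)) \<and>
        Q = density P (\<lambda>\<omega>. ennreal
          (\<Prod>i\<in>{1, 2}. doleans_dade_W (\<beta> i) (J i) T \<omega> *
                       doleans_dade_M (lam i) (N i) (\<beta> (i + 2)) T \<omega>)))"

text \<open>Expectation with values in the extended reals, so that an infinite entropy is not
  silently replaced by 0. The negative part of the integrand of the relative entropy below is at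
  most \<open>1 / e\<close>, so no \<open>\<infinity> - \<infinity>\<close> arises when \<open>Q\<close> is finite.\<close>

definition ereal_expectation :: "'a measure \<Rightarrow> ('a \<Rightarrow> real) \<Rightarrow> ereal" where
  "ereal_expectation M X =
     enn2ereal (\<integral>\<^sup>+\<omega>. ennreal (X \<omega>) \<partial>M) - enn2ereal (\<integral>\<^sup>+\<omega>. ennreal (- X \<omega>) \<partial>M)"

definition relative_entropy :: "'a measure \<Rightarrow> 'a measure \<Rightarrow> ereal" where
  "relative_entropy P Q =
     ereal_expectation Q
       (\<lambda>\<omega>. enn2real (RN_deriv Q P \<omega>) * ln (enn2real (RN_deriv Q P \<omega>)))"

lemma relative_entropy_density:
  assumes "prob_space P" and Z[measurable]: "Z \<in> borel_measurable P"
    and pos: "AE \<omega> in P. 0 < Z \<omega>"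
  shows "relative_entropy P (density P (\<lambda>\<omega>. ennreal (Z \<omega>))) =
    ereal_expectation P (\<lambda>\<omega>. - ln (Z \<omega>))"
proof -
  interpret prob_space P by fact
  define Q where "Q = density P (\<lambda>\<omega>. ennreal (Z \<omega>))"
  have P_eq: "density Q (\<lambda>\<omega>. ennreal (1 / Z \<omega>)) = P"
  proof -
    have "density Q (\<lambda>\<omega>. ennreal (1 / Z \<omega>)) = density P (\<lambda>\<omega>. ennreal (Z \<omega>) * ennreal (1 / Z \<omega>))"
      unfolding Q_def by (subst density_density_eq) auto
    also have "\<dots> = density P (\<lambda>_. 1)"
      using pos by (intro density_cong) (auto simp flip: ennreal_mult'')
    finally show ?thesis by (simp add: density_1)
  qed
  interpret Q: sigma_finite_measure Q
    unfolding Q_def by (subst sigma_finite_iff_density_finite) auto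
  have RN: "AE \<omega> in Q. RN_deriv Q P \<omega> = ennreal (1 / Z \<omega>)"
  proof -
    have "(\<lambda>\<omega>. ennreal (1 / Z \<omega>)) \<in> borel_measurable Q"
      unfolding Q_def by measurable
    from Q.RN_deriv_unique[OF this P_eq] show ?thesis
      by eventually_elim simp
  qed
  have posQ: "AE \<omega> in Q. 0 < Z \<omega>"
    unfolding Q_def using pos by (subst AE_density) auto
  have part: "(\<integral>\<^sup>+\<omega>. ennreal (c * (enn2real (RN_deriv Q P \<omega>) * ln (enn2real (RN_deriv Q P \<omega>)))) \<partial>Q)
      = (\<integral>\<^sup>+\<omega>. ennreal (c * - ln (Z \<omega>)) \<partial>P)" for c :: real
  proof -
    have "(\<integral>\<^sup>+\<omega>. ennreal (c * (enn2real (RN_deriv Q P \<omega>) * ln (enn2real (RN_deriv Q P \<omega>)))) \<partial>Q)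
        = (\<integral>\<^sup>+\<omega>. ennreal (c * (1 / Z \<omega> * ln (1 / Z \<omega>))) \<partial>Q)"
      by (intro nn_integral_cong_AE, use RN posQ in eventually_elim) auto
    also have "\<dots> = (\<integral>\<^sup>+\<omega>. ennreal (Z \<omega>) * ennreal (c * (1 / Z \<omega> * ln (1 / Z \<omega>))) \<partial>P)"
      unfolding Q_def by (subst nn_integral_density) auto
    also have "\<dots> = (\<integral>\<^sup>+\<omega>. ennreal (c * - ln (Z \<omega>)) \<partial>P)"
      by (intro nn_integral_cong_AE, use pos in eventually_elim)
         (auto simp: ln_div simp flip: ennreal_mult')
    finally show ?thesis .
  qed
  show ?thesis
    using part[of 1] part[of "-1"]
    by (simp add: relative_entropy_def ereal_expectation_def Q_def)
qed

end

theory Submission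
  imports Defs
begin

text \<open>By the compensation formula the jumps of a Poisson process, integrated against a nonnegative
  predictable process, have the same mean as the intensity. Since Ito integrals and compensated
  Poisson integrals are centered, this gives, for every \<open>\<beta>\<close>,
  \<open>I(P, Q\<^sup>\<beta>) = E \<integral> (\<beta>\<^sub>1\<^sup>2 + \<beta>\<^sub>2\<^sup>2) / 2 + \<lambda>\<^sub>1 h(\<beta>\<^sub>3) + \<lambda>\<^sub>2 h(\<beta>\<^sub>4) dt\<close> with the convex function
  \<open>h(b) = b - ln (1 + b)\<close>. The drift condition is a linear constraint on \<open>(\<beta>\<^sub>1, \<beta>\<^sub>3)\<close> at each
  \<open>(t, \<omega>)\<close>, and the given \<open>\<beta>\<close> satisfies the Lagrange condition, hence minimizes the integrand
  pointwise. Strict convexity makes a minimizer unique up to values that do not affect \<open>Q\<^sup>\<beta>\<close>.\<close>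

section \<open>Jumps of counting paths\<close>

text \<open>The equation for the third component is the Lagrange condition with the multiplier
  eliminated. Put d = r - mu. Since h'(b) = b / (1 + b), the gradient of the cost is (b1, l * b3 /
  (1 + b3)); proportionality to (a1, l * a3) gives a1 * b3 / (1 + b3) = a3 * b1. Multiplying by a1 *
  sigma and inserting the drift constraint for a1 * b1 * sigma yields the equation. Two obstacles
  shape the rest. The entropy of a competitor may be infinite, so -ln (dQ/dP) is written as a
  centered variable plus a nonnegative one, and costs are integrated with values in [0, infinity].
  Moreover, the conditions on \<beta> hold only up to null sets of time-space, while the jump times
  of each path form a Lebesgue null set. This is why sums over jumps are always evaluated for
  predictable integrands and in the mean.\<close>

lemma left_lim_eqI: "t \<noteq> 0 \<Longrightarrow> (f \<longlongrightarrow> l) (at_left t) \<Longrightarrow> left_lim f t = l"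
  by (simp add: left_lim_def tendsto_Lim)

lemma left_lim_locally_const:
  assumes "0 \<le> s" "s < u" "\<And>v. s \<le> v \<Longrightarrow> v < u \<Longrightarrow> f v = c"
  shows "left_lim f u = c"
proof (rule left_lim_eqI)
  have "eventually (\<lambda>v. f v = c) (at_left u)"
    using assms by (auto simp: eventually_at_left_field intro!: exI[of _ s])
  then show "(f \<longlongrightarrow> c) (at_left u)" by (rule tendsto_eventually)
qed (use assms in auto)

text \<open>Natural numbers at distance less than 1/2 coincide, so right continuity of a counting
  path makes it constant on a short interval to the right.\<close>

lemma cadlag_nat_right_const:
  fixes f :: "real \<Rightarrow> nat"
  assumes "cadlag T (\<lambda>t. real (f t))" "0 \<le> t" "t < T"
  obtains d where "t < d" "\<And>v. t < v \<Longrightarrow> v < d \<Longrightarrow> f v = f t"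
proof -
  have "((\<lambda>t. real (f t)) \<longlongrightarrow> real (f t)) (at_right t)"
    using assms by (auto simp: cadlag_def)
  from tendstoD[OF this, of "1/2"]
  have "eventually (\<lambda>v. dist (real (f v)) (real (f t)) < 1/2) (at_right t)" by simp
  then have "eventually (\<lambda>v. f v = f t) (at_right t)"
    by eventually_elim (simp add: dist_real_def abs_if split: if_splits)
  then show ?thesis using that by (auto simp: eventually_at_right_field)
qed

text \<open>Induction on the increment \<open>N t \<omega> - N s \<omega>\<close>, a natural number.
  If it is positive, the path leaves its initial level at a first time \<open>u\<close>; this is a
  jump, and from \<open>u\<close> on the remaining increment is smaller. Finiteness of the jump set,
  the telescoping sum and integrality of the jumps come out of the same recursion.\<close>

lemma step_path:
  assumes mono: "mono_on {0..T} (\<lambda>t. N t \<omega>)" and cl: "cadlag T (\<lambda>t. real (N t \<omega>))"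
    and "0 \<le> s" "s \<le> t" "t \<le> T"
  shows "finite {u \<in> {s<..t}. jump N u \<omega> \<noteq> 0} \<and>
    (\<Sum>u\<in>{u \<in> {s<..t}. jump N u \<omega> \<noteq> 0}. jump N u \<omega>) = real (N t \<omega>) - real (N s \<omega>) \<and>
    (\<forall>u\<in>{s<..t}. jump N u \<omega> \<in> \<nat>)"
  using assms(3,4)
proof (induction "N t \<omega> - N s \<omega>" arbitrary: s rule: less_induct)
  case less
  have mono': "N u \<omega> \<le> N v \<omega>" if "0 \<le> u" "u \<le> v" "v \<le> T" for u v
    using mono that by (auto simp: mono_on_def)
  have no_jump: "jump N v \<omega> = 0" if "s < v" "\<And>w. s \<le> w \<Longrightarrow> w \<le> v \<Longrightarrow> N w \<omega> = N s \<omega>" for v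
  proof -
    have "left_lim (\<lambda>u. real (N u \<omega>)) v = real (N s \<omega>)"
    proof (rule left_lim_locally_const)
      show "real (N w \<omega>) = real (N s \<omega>)" if "s \<le> w" "w < v" for w
        using \<open>\<And>w. s \<le> w \<Longrightarrow> w \<le> v \<Longrightarrow> N w \<omega> = N s \<omega>\<close>[of w] that by simp
    qed (fact less(2), fact that(1))
    moreover have "N v \<omega> = N s \<omega>" using that(1) by (intro that(2)) auto
    ultimately show ?thesis by (simp add: jump_def)
  qed
  show ?case
  proof (cases "N t \<omega> = N s \<omega>")
    case True
    have "jump N v \<omega> = 0" if "v \<in> {s<..t}" for v
    proof (rule no_jump)
      show "N w \<omega> = N s \<omega>" if "s \<le> w" "w \<le> v" for w
        using that \<open>v \<in> _\<close> mono'[of s w] mono'[of w t] less(2,3) assms(5) True by auto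
    qed (use \<open>v \<in> _\<close> in auto)
    then have "{u \<in> {s<..t}. jump N u \<omega> \<noteq> 0} = {}" "\<forall>u\<in>{s<..t}. jump N u \<omega> \<in> \<nat>" by auto
    then show ?thesis using True by (simp only:) simp
  next
    case False
    then have lt: "N s \<omega> < N t \<omega>" using mono'[of s t] less(2,3) assms(5) by auto
    define V where "V = {v\<in>{s..t}. N s \<omega> < N v \<omega>}"
    define u where "u = Inf V"
    have tV: "t \<in> V" and bV: "bdd_below V" using lt less(3) by (auto simp: V_def)
    have su: "s \<le> u" unfolding u_def using tV by (intro cInf_greatest) (auto simp: V_def)
    have ut: "u \<le> t" unfolding u_def using tV bV by (intro cInf_lower)
    have const: "N v \<omega> = N s \<omega>" if "s \<le> v" "v < u" for v
    proof -
      have "v \<notin> V" using that bV cInf_lower[of v V] by (auto simp: u_def)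
      then show ?thesis using that ut mono'[of s v] less(2,3) assms(5) by (auto simp: V_def)
    qed
    \<comment> \<open>If the path were still at its old level at \<open>u\<close>, right continuity
      would keep it there up to some \<open>d > u\<close>; then \<open>d\<close> would be a lower
      bound of \<open>V\<close> exceeding its infimum.\<close>
    have Nu: "N s \<omega> < N u \<omega>"
    proof (rule ccontr)
      assume "\<not> ?thesis"
      then have eq: "N u \<omega> = N s \<omega>" using mono'[of s u] su ut ut less(2) assms(5) by auto
      then have "u < t" using lt ut by (cases "u = t") auto
      obtain d where d: "u < d" "\<And>v. u < v \<Longrightarrow> v < d \<Longrightarrow> N v \<omega> = N u \<omega>"
        using cadlag_nat_right_const[OF cl, of u] su \<open>u < t\<close> less(2) assms(5) by auto
      have "d \<le> v" if "v \<in> V" for v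
      proof (rule ccontr)
        assume "\<not> d \<le> v"
        have "u \<le> v" unfolding u_def using that bV by (rule cInf_lower)
        then have "N v \<omega> = N u \<omega>" using d \<open>\<not> d \<le> v\<close> by (cases "u = v") auto
        then show False using that eq by (auto simp: V_def)
      qed
      then have "d \<le> u" unfolding u_def using tV by (intro cInf_greatest) auto
      with d show False by simp
    qed
    then have su': "s < u" using su by (cases "s = u") auto
    have ju: "jump N u \<omega> = real (N u \<omega>) - real (N s \<omega>)"
    proof -
      have "left_lim (\<lambda>u. real (N u \<omega>)) u = real (N s \<omega>)"
      proof (rule left_lim_locally_const)
        show "real (N w \<omega>) = real (N s \<omega>)" if "s \<le> w" "w < u" for w
          using const[OF that] by simp
      qed (fact less(2), fact su')
      then show ?thesis by (simp add: jump_def)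
    qed
    have j0: "jump N v \<omega> = 0" if "s < v" "v < u" for v
    proof (rule no_jump[OF that(1)])
      show "N w \<omega> = N s \<omega>" if "s \<le> w" "w \<le> v" for w
        using that \<open>v < u\<close> by (intro const) simp_all
    qed
    have IH: "finite {v \<in> {u<..t}. jump N v \<omega> \<noteq> 0} \<and>
      (\<Sum>v\<in>{v \<in> {u<..t}. jump N v \<omega> \<noteq> 0}. jump N v \<omega>) = real (N t \<omega>) - real (N u \<omega>) \<and>
      (\<forall>v\<in>{u<..t}. jump N v \<omega> \<in> \<nat>)"
      using less(1)[of u] Nu lt su less(2) ut by auto
    have eq: "{v \<in> {s<..t}. jump N v \<omega> \<noteq> 0} = insert u {v \<in> {u<..t}. jump N v \<omega> \<noteq> 0}"
    proof (intro set_eqI iffI)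
      fix v assume "v \<in> {v \<in> {s<..t}. jump N v \<omega> \<noteq> 0}"
      then show "v \<in> insert u {v \<in> {u<..t}. jump N v \<omega> \<noteq> 0}"
        using j0[of v] by (cases v u rule: linorder_cases) simp_all
    next
      fix v assume "v \<in> insert u {v \<in> {u<..t}. jump N v \<omega> \<noteq> 0}"
      then show "v \<in> {v \<in> {s<..t}. jump N v \<omega> \<noteq> 0}"
        using su' ut ju Nu by (cases "v = u") simp_all
    qed
    have nat_u: "jump N u \<omega> \<in> \<nat>"
      unfolding ju using Nu by (simp flip: of_nat_diff)
    have "jump N v \<omega> \<in> \<nat>" if "v \<in> {s<..t}" for v
      using that j0[of v] nat_u IH by (cases v u rule: linorder_cases) auto
    then show ?thesis unfolding eq using IH ju by auto
  qed
qed

section \<open>Independence of the past and the increments\<close>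

text \<open>The part of \<open>market\<close> that concerns the noise: entropies and densities are
  computed from \<open>W\<close>, \<open>N\<close>, \<open>lam\<close> and \<open>F\<close> alone.
  The price model enters through the drift condition, in the final theorem.\<close>

locale wiener_poisson = prob_space P for P :: "'a measure" +
  fixes T :: real
    and W :: "nat \<Rightarrow> real \<Rightarrow> 'a \<Rightarrow> real"
    and N :: "nat \<Rightarrow> real \<Rightarrow> 'a \<Rightarrow> nat"
    and lam :: "nat \<Rightarrow> real \<Rightarrow> real"
    and F :: "real \<Rightarrow> 'a measure"
  assumes T_pos: "0 < T"
    and lam_integrable: "\<And>i. i \<in> {1, 2} \<Longrightarrow> set_integrable lborel {0..T} (lam i)"
    and lam_nonneg: "\<And>i t. i \<in> {1, 2} \<Longrightarrow> t \<in> {0..T} \<Longrightarrow> 0 \<le> lam i t"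
    and W_brownian: "\<And>i. i \<in> {1, 2} \<Longrightarrow> brownian_motion P T (W i)"
    and N_poisson: "\<And>i. i \<in> {1, 2} \<Longrightarrow> poisson_process P T (lam i) (N i)"
    and drivers_indep: "indep_sets (\<lambda>i. sets (history P (driver W N i) T)) {1..4}"
    and F_natural: "F = natural_filtration P T W N"

sublocale market \<subseteq> wiener_poisson P T W N lam F
  using T_pos lam_integrable lam_nonneg W_brownian N_poisson drivers_indep F_natural
  by unfold_locales auto

lemma sets_history:
  "sets (history P X t) =
     sigma_sets (space P) {X s -` B \<inter> space P | s B. s \<in> {0..t} \<and> B \<in> sets borel}"
  unfolding history_def by (rule sets_measure_of) auto

lemma space_history [simp]: "space (history P X t) = space P"
  unfolding history_def by (rule space_measure_of) auto

lemma measurable_history: "0 \<le> s \<Longrightarrow> s \<le> t \<Longrightarrow> X s \<in> borel_measurable (history P X t)"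
  by (rule measurableI) (auto simp: sets_history)

lemma history_mono: "s \<le> t \<Longrightarrow> sets (history P X s) \<subseteq> sets (history P X t)"
  unfolding sets_history by (rule sigma_sets_mono') fastforce

context wiener_poisson
begin

lemma driver_W: "i \<in> {1, 2} \<Longrightarrow> driver W N i = W i"
  by (auto simp: driver_def)

lemma driver_N: "i \<in> {1, 2} \<Longrightarrow> driver W N (i + 2) = (\<lambda>t \<omega>. real (N i t \<omega>))"
  by (auto simp: driver_def)

lemma N_measurable: "i \<in> {1, 2} \<Longrightarrow> t \<in> {0..T} \<Longrightarrow> N i t \<in> measurable P (count_space UNIV)"
  using N_poisson[of i] by (auto simp: poisson_process_def)

lemma driver_cases:
  assumes "i \<in> {1..4}"
  obtains j where "j \<in> {1, 2}" "driver W N i = W j" "i = j"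
  | j where "j \<in> {1, 2}" "driver W N i = (\<lambda>t \<omega>. real (N j t \<omega>))" "i = j + 2"
  proof (cases "i \<le> 2")
  case True
  then have "i \<in> {1, 2}" using assms by auto
  with driver_W show ?thesis by (intro that(1)) auto
next
  case False
  then have "i - 2 \<in> {1, 2}" "i - 2 + 2 = i" using assms by auto
  with driver_N[of "i - 2"] show ?thesis by (intro that(2)[of "i - 2"]) auto
qed

lemma driver_measurable:
  assumes "i \<in> {1..4}" "t \<in> {0..T}"
  shows "driver W N i t \<in> borel_measurable P"
  using assms(1)
proof (cases rule: driver_cases)
  case (1 j)
  then show ?thesis using W_brownian[of j] assms(2) by (auto simp: brownian_motion_def)
next
  case (2 j)
  then show ?thesis using N_measurable[of j] assms(2) by auto
qed

lemma driver_independent_increments: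
  assumes "i \<in> {1..4}"
  shows "independent_increments P T (driver W N i)"
  using assms
proof (cases rule: driver_cases)
  case (1 j)
  then show ?thesis using W_brownian[of j] by (auto simp: brownian_motion_def)
next
  case (2 j)
  then show ?thesis using N_poisson[of j] by (auto simp: poisson_process_def)
qed

abbreviation filtration_generators :: "real \<Rightarrow> 'a set set" where
  "filtration_generators t \<equiv> {driver W N i s -` B \<inter> space P | i s B.
           i \<in> {1..4} \<and> s \<in> {0..min t T} \<and> B \<in> sets borel}"

lemma generators_sets: "filtration_generators t \<subseteq> sets P"
  using driver_measurable by (force intro: measurable_sets)

lemma sets_F: "sets (F t) = sigma_sets (space P) (filtration_generators t \<union> null_sets P)"
  unfolding F_natural natural_filtration_def
  using generators_sets sets.sets_into_space null_setsD2 by (intro sets_measure_of) blast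

lemma space_F [simp]: "space (F t) = space P"
  unfolding F_natural natural_filtration_def
  using generators_sets sets.sets_into_space null_setsD2 by (intro space_measure_of) blast

lemma sets_F_subset: "sets (F t) \<subseteq> sets P"
  unfolding sets_F using generators_sets by (intro sets.sigma_sets_subset) auto

lemma sets_F_mono: "s \<le> t \<Longrightarrow> sets (F s) \<subseteq> sets (F t)"
  unfolding sets_F by (intro sigma_sets_mono') fastforce

lemma measurable_F: "X \<in> borel_measurable (F t) \<Longrightarrow> X \<in> borel_measurable P"
  using measurable_mono[OF order_refl refl sets_F_subset[of t], of borel] by auto

lemma measurable_F_mono: "X \<in> borel_measurable (F s) \<Longrightarrow> s \<le> t \<Longrightarrow> X \<in> borel_measurable (F t)"
  using measurable_mono[OF order_refl refl sets_F_mono[of s t], of borel] by auto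

lemma driver_F_measurable:
  assumes "i \<in> {1..4}" "0 \<le> s" "s \<le> t" "s \<le> T"
  shows "driver W N i s \<in> borel_measurable (F t)"
proof (rule measurableI)
  fix B :: "real set" assume "B \<in> sets borel"
  then show "driver W N i s -` B \<inter> space (F t) \<in> sets (F t)"
    unfolding sets_F using assms by (auto intro!: sigma_sets.Basic)
qed auto

text \<open>Two sources of independence are combined: an increment of driver \<open>i\<close> is
  independent of the past of the same driver by \<open>independent_increments\<close>, and of the
  other three drivers by \<open>drivers_indep\<close>. The class \<open>E\<close> of boxes, with one
  event from each of the four histories, is stable under intersection and generates
  \<open>F s\<close>. Null sets are adjoined to \<open>E\<close> because the filtration is
  augmented; they are independent of everything.\<close>

lemma indep_F_increment:
  assumes i: "i \<in> {1..4}" and st: "0 \<le> s" "s \<le> t" "t \<le> T"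
  shows "indep_set (sets (F s))
    {(\<lambda>\<omega>. driver W N i t \<omega> - driver W N i s \<omega>) -` B \<inter> space P | B. B \<in> sets borel}"
    (is "indep_set _ ?D")
proof -
  let ?H = "\<lambda>j. sets (history P (driver W N j) s)"
  define E where "E = {\<Inter>j\<in>{1..4}. A j | A. \<forall>j\<in>{1..4::nat}. A j \<in> ?H j} \<union> null_sets P"
  have HT: "?H j \<subseteq> sets (history P (driver W N j) T)" for j
    using st by (intro history_mono) auto
  have H_events: "?H j \<subseteq> events" if "j \<in> {1..4}" for j
    using drivers_indep order_trans[OF HT[of j]] that unfolding indep_sets_def by simp
  have D_T: "?D \<subseteq> sets (history P (driver W N i) T)"
  proof -
    have [measurable]: "driver W N i t \<in> borel_measurable (history P (driver W N i) T)"
      "driver W N i s \<in> borel_measurable (history P (driver W N i) T)"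
      using st by (auto intro!: measurable_history)
    have "(\<lambda>\<omega>. driver W N i t \<omega> - driver W N i s \<omega>) -` B \<inter> space (history P (driver W N i) T)
        \<in> sets (history P (driver W N i) T)" if "B \<in> sets borel" for B
      using that by (intro measurable_sets[where A=borel]) auto
    then show ?thesis by auto
  qed
  have D_events: "?D \<subseteq> events"
    using drivers_indep D_T i order_trans[OF D_T] unfolding indep_sets_def by simp
  have E_events: "E \<subseteq> events"
    using H_events unfolding E_def by (fastforce intro!: sets.finite_INT)
  have HD: "prob (a \<inter> b) = prob a * prob b" if "a \<in> ?H i" "b \<in> ?D" for a b
    using driver_independent_increments[OF i] st that
    unfolding independent_increments_def by (blast intro: indep_setD)
  have prod: "prob (\<Inter>j\<in>{1..4}. A j) = (\<Prod>j\<in>{1..4}. prob (A j))"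
    if "\<And>j. j \<in> {1..4} \<Longrightarrow> A j \<in> sets (history P (driver W N j) T)" for A
    using that by (intro indep_setsD[OF drivers_indep]) auto
  have "indep_set E ?D"
    unfolding indep_sets2_eq
  proof (intro conjI ballI)
    fix e b assume "e \<in> E" "b \<in> ?D"
    then consider A where "e = (\<Inter>j\<in>{1..4}. A j)" "\<And>j. j \<in> {1..4::nat} \<Longrightarrow> A j \<in> ?H j"
      | "e \<in> null_sets P" unfolding E_def by blast
    then show "prob (e \<inter> b) = prob e * prob b"
    proof cases
      case 1
      \<comment> \<open>The increment event \<open>b\<close> is merged into coordinate
        \<open>i\<close>. Since \<open>b\<close> belongs to the full history of driver
        \<open>i\<close>, the product formula across drivers applies to \<open>A'\<close>;
        afterwards \<open>HD\<close> splits \<open>A i \<inter> b\<close> inside that one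
        driver.\<close>
      define A' where "A' = A(i := A i \<inter> b)"
      have eb: "e \<inter> b = (\<Inter>j\<in>{1..4}. A' j)"
        using i 1 by (auto simp: A'_def split: if_splits)
      have bT: "b \<in> sets (history P (driver W N i) T)" using D_T \<open>b \<in> ?D\<close> by (rule subsetD)
      have "A' j \<in> sets (history P (driver W N j) T)" if "j \<in> {1..4}" for j
        using subsetD[OF HT 1(2)[OF that]] bT by (auto simp: A'_def)
      then have "prob (e \<inter> b) = (\<Prod>j\<in>{1..4}. prob (A' j))"
        unfolding eb by (rule prod)
      also have "\<dots> = prob (A' i) * (\<Prod>j\<in>{1..4}-{i}. prob (A' j))"
        using i by (intro prod.remove) auto
      also have "prob (A' i) = prob (A i) * prob b"
        using HD[OF 1(2)[OF i] \<open>b \<in> ?D\<close>] by (simp add: A'_def)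
      also have "(\<Prod>j\<in>{1..4}-{i}. prob (A' j)) = (\<Prod>j\<in>{1..4}-{i}. prob (A j))"
        by (intro prod.cong) (auto simp: A'_def)
      also have "prob (A i) * prob b * \<dots> = (prob (A i) * \<dots>) * prob b" by simp
      also have "prob (A i) * (\<Prod>j\<in>{1..4}-{i}. prob (A j)) = (\<Prod>j\<in>{1..4}. prob (A j))"
        using i by (intro prod.remove[symmetric]) auto
      also have "\<dots> = prob e" unfolding 1(1) using 1(2) HT by (intro prod[symmetric]) blast
      finally show ?thesis .
    next
      case 2
      moreover have "e \<inter> b \<in> null_sets P" using 2 D_events \<open>b \<in> ?D\<close> by (intro null_set_Int2) auto
      ultimately show ?thesis by (auto simp: null_sets_def measure_def)
    qed
  qed (use E_events D_events in auto)
  moreover have "Int_stable E"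
  proof (rule Int_stableI)
    fix e e' assume ee: "e \<in> E" "e' \<in> E"
    show "e \<inter> e' \<in> E"
    proof (cases "e \<in> null_sets P \<or> e' \<in> null_sets P")
      case True
      then have "e \<inter> e' \<in> null_sets P"
        using subsetD[OF E_events ee(1)] subsetD[OF E_events ee(2)]
          null_set_Int1[of e P e'] null_set_Int2[of e' P e] by (auto simp: Int_commute)
      then show ?thesis unfolding E_def by (rule UnI2)
    next
      case False
      then obtain A A' where "e = (\<Inter>j\<in>{1..4}. A j)" "\<forall>j\<in>{1..4::nat}. A j \<in> ?H j"
        "e' = (\<Inter>j\<in>{1..4}. A' j)" "\<forall>j\<in>{1..4::nat}. A' j \<in> ?H j"
        using ee unfolding E_def by auto
      then show ?thesis unfolding E_def
        by (intro UnI1 CollectI exI[of _ "\<lambda>j. A j \<inter> A' j"]) auto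
    qed
  qed
  moreover have "Int_stable ?D"
  proof (rule Int_stableI)
    fix a b assume "a \<in> ?D" "b \<in> ?D"
    then obtain A B where "A \<in> sets borel" "B \<in> sets borel"
      "a = (\<lambda>\<omega>. driver W N i t \<omega> - driver W N i s \<omega>) -` A \<inter> space P"
      "b = (\<lambda>\<omega>. driver W N i t \<omega> - driver W N i s \<omega>) -` B \<inter> space P" by blast
    then show "a \<inter> b \<in> ?D" by (intro CollectI exI[of _ "A \<inter> B"]) auto
  qed
  ultimately have ind: "indep_set (sigma_sets (space P) E) (sigma_sets (space P) ?D)"
    by (rule indep_set_sigma_sets)
  have "filtration_generators s \<union> null_sets P \<subseteq> E"
  proof
    fix g assume g: "g \<in> filtration_generators s \<union> null_sets P"
    show "g \<in> E"
    proof (cases "g \<in> null_sets P")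
      case False
      then obtain j u B where "j \<in> {1..4}" "u \<in> {0..s}" "B \<in> sets borel"
        "g = driver W N j u -` B \<inter> space P" using g by auto
      then show ?thesis unfolding E_def
        by (intro UnI1 CollectI exI[of _ "\<lambda>k. if k = j then g else space P"])
           (auto simp: sets_history intro!: sigma_sets_top)
    qed (simp add: E_def)
  qed
  then have "sets (F s) \<subseteq> sigma_sets (space P) E"
    unfolding sets_F by (rule sigma_sets_mono')
  moreover have "?D \<subseteq> sigma_sets (space P) ?D" by (rule sigma_sets_superset_generator)
  ultimately show ?thesis using ind unfolding indep_sets2_eq by blast
qed

lemma indep_var_F_increment:
  assumes "i \<in> {1..4}" "0 \<le> s" "s \<le> t" "t \<le> T" and X: "X \<in> borel_measurable (F s)"
  shows "indep_var borel X borel (\<lambda>\<omega>. driver W N i t \<omega> - driver W N i s \<omega>)"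
proof -
  let ?I = "\<lambda>\<omega>. driver W N i t \<omega> - driver W N i s \<omega>"
  have Im: "?I \<in> borel_measurable P"
    using assms driver_measurable[of i] by (intro borel_measurable_diff) auto
  have 1: "sigma_sets (space P) {X -` B \<inter> space P | B. B \<in> sets borel} \<subseteq> sets (F s)"
    using measurable_sets[OF X] sets.sigma_sets_subset[of "{X -` B \<inter> space P | B. B \<in> sets borel}" "F s"]
    by fastforce
  have 2: "sigma_sets (space P) {?I -` B \<inter> space P | B. B \<in> sets borel} =
      {?I -` B \<inter> space P | B. B \<in> sets borel}"
    using sigma_sets_vimage_commute[of ?I "space P" UNIV "sets borel"]
      sets.sigma_sets_eq[of "borel :: real measure"] by simp
  have "indep_set (sigma_sets (space P) {X -` B \<inter> space P | B. B \<in> sets borel})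
      (sigma_sets (space P) {?I -` B \<inter> space P | B. B \<in> sets borel})"
    using indep_F_increment[OF assms(1-4)] unfolding indep_set_def 2
    by (rule indep_sets_mono_sets) (use 1 in \<open>simp split: bool.split\<close>)
  then show ?thesis using measurable_F[OF X] Im unfolding indep_var_eq by simp
qed

end

section \<open>The Ito integral\<close>

text \<open>A substitute for the triangle inequality of L2, from (a + b + c)^2 <= 3 (a^2 + b^2 +
  c^2). With nonnegative integrals it also makes sense for infinite norms.\<close>

lemma nn_integral_power2_sum_le:
  fixes f g h :: "'b \<Rightarrow> real"
  assumes [measurable]: "f \<in> borel_measurable M" "g \<in> borel_measurable M" "h \<in> borel_measurable M"
    and le: "AE x in M. \<bar>e x\<bar> \<le> \<bar>f x\<bar> + \<bar>g x\<bar> + \<bar>h x\<bar>"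
  shows "(\<integral>\<^sup>+x. ennreal ((e x)\<^sup>2) \<partial>M) \<le> 3 * ((\<integral>\<^sup>+x. ennreal ((f x)\<^sup>2) \<partial>M) +
    (\<integral>\<^sup>+x. ennreal ((g x)\<^sup>2) \<partial>M) + (\<integral>\<^sup>+x. ennreal ((h x)\<^sup>2) \<partial>M))"
proof -
  have "(\<integral>\<^sup>+x. ennreal ((e x)\<^sup>2) \<partial>M) \<le> (\<integral>\<^sup>+x. 3 * (ennreal ((f x)\<^sup>2) + ennreal ((g x)\<^sup>2) + ennreal ((h x)\<^sup>2)) \<partial>M)"
  proof (rule nn_integral_mono_AE, use le in eventually_elim)
    case (elim x)
    let ?a = "\<bar>f x\<bar>" and ?b = "\<bar>g x\<bar>" and ?c = "\<bar>h x\<bar>"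
    have "(e x)\<^sup>2 \<le> (?a + ?b + ?c)\<^sup>2" using elim by (intro power2_le_iff_abs_le[THEN iffD2]) auto
    also have "\<dots> \<le> 3 * (?a\<^sup>2 + ?b\<^sup>2 + ?c\<^sup>2)"
      using sum_squares_ge_zero[of "?a - ?b" "?b - ?c"] zero_le_power2[of "?a - ?c"]
      by (simp add: power2_eq_square algebra_simps)
    finally have "(e x)\<^sup>2 \<le> 3 * ((f x)\<^sup>2 + (g x)\<^sup>2 + (h x)\<^sup>2)" by simp
    then have "ennreal ((e x)\<^sup>2) \<le> ennreal (3 * ((f x)\<^sup>2 + (g x)\<^sup>2 + (h x)\<^sup>2))"
      by (rule ennreal_leI)
    also have "\<dots> = 3 * (ennreal ((f x)\<^sup>2) + ennreal ((g x)\<^sup>2) + ennreal ((h x)\<^sup>2))"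
      using ennreal_mult'[of 3 "(f x)\<^sup>2 + (g x)\<^sup>2 + (h x)\<^sup>2"] by simp
    finally show ?case .
  qed
  also have "\<dots> = 3 * ((\<integral>\<^sup>+x. ennreal ((f x)\<^sup>2) \<partial>M) +
    (\<integral>\<^sup>+x. ennreal ((g x)\<^sup>2) \<partial>M) + (\<integral>\<^sup>+x. ennreal ((h x)\<^sup>2) \<partial>M))"
    by (simp add: nn_integral_cmult nn_integral_add)
  finally show ?thesis .
qed

lemma (in prob_space) power2_expectation_le:
  fixes X :: "'a \<Rightarrow> real"
  assumes "X \<in> borel_measurable M" "integrable M (\<lambda>x. (X x)\<^sup>2)"
  shows "(expectation X)\<^sup>2 \<le> expectation (\<lambda>x. (X x)\<^sup>2)"
  using variance_eq[OF square_integrable_imp_integrable[OF assms] assms(2)]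
    variance_positive[of X] by simp

context wiener_poisson
begin

section \<open>Time-space measure and predictable sets\<close>

abbreviation horizon :: "real measure" where
  "horizon \<equiv> restrict_space lborel {0..T}"

lemma space_horizon: "space horizon = {0..T}"
  by (simp add: space_restrict_space)

lemma emeasure_horizon: "emeasure horizon (space horizon) = ennreal T"
  using T_pos by (simp add: emeasure_restrict_space space_horizon)

sublocale horizon: finite_measure horizon
  by standard (simp only: emeasure_horizon, simp)

sublocale TP: pair_sigma_finite horizon P ..

abbreviation predictable_rectangles :: "(real \<times> 'a) set set" where
  "predictable_rectangles \<equiv> {{0} \<times> A | A. A \<in> sets (F 0)} \<union>
     {{s<..t} \<times> A | s t A. 0 \<le> s \<and> s \<le> t \<and> t \<le> T \<and> A \<in> sets (F s)}"

lemma F_into_space: "A \<in> sets (F s) \<Longrightarrow> A \<subseteq> space P"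
  using sets.sets_into_space[of A "F s"] by simp

lemma predictable_rectangles_into_space: "predictable_rectangles \<subseteq> Pow ({0..T} \<times> space P)"
  using T_pos by (auto dest: F_into_space)

lemma space_predictable_algebra: "space (predictable_algebra P F T) = {0..T} \<times> space P"
  unfolding predictable_algebra_def by (rule space_measure_of[OF predictable_rectangles_into_space])

lemma sets_predictable_algebra:
  "sets (predictable_algebra P F T) = sigma_sets ({0..T} \<times> space P) predictable_rectangles"
  unfolding predictable_algebra_def by (rule sets_measure_of[OF predictable_rectangles_into_space])

lemma space_time_space: "space (time_space P T) = {0..T} \<times> space P"
  by (simp add: space_pair_measure space_horizon)

lemma sets_predictable_subset: "sets (predictable_algebra P F T) \<subseteq> sets (time_space P T)"
proof -
  have "{0::real} \<in> sets horizon" "{s<..t} \<in> sets horizon" if "0 \<le> s" "t \<le> T" for s t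
    using that T_pos by (auto simp: sets_restrict_space_iff)
  moreover have "0 \<le> T" using T_pos by simp
  ultimately have "predictable_rectangles \<subseteq> sets (time_space P T)"
    using subsetD[OF sets_F_subset] by (auto intro!: pair_measureI)
  then show ?thesis
    unfolding sets_predictable_algebra space_time_space[symmetric] by (rule sets.sigma_sets_subset)
qed

lemma predictable_measurable:
  "predictable P F T H \<Longrightarrow> (\<lambda>(t, \<omega>). H t \<omega>) \<in> borel_measurable (time_space P T)"
  unfolding predictable_def
  by (rule measurable_mono[OF order_refl refl sets_predictable_subset, THEN subsetD])
     (auto simp: space_time_space space_predictable_algebra)

lemma set_nn_integral_horizon: "(\<integral>\<^sup>+s\<in>{0..T}. f s \<partial>lborel) = (\<integral>\<^sup>+s. f s \<partial>horizon)"
  by (simp add: nn_integral_restrict_space)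

lemma nn_integral_time_space:
  assumes "(\<lambda>(t, \<omega>). f t \<omega>) \<in> borel_measurable (time_space P T)"
  shows "(\<integral>\<^sup>+\<omega>. (\<integral>\<^sup>+s. f s \<omega> \<partial>horizon) \<partial>P) = (\<integral>\<^sup>+(t, \<omega>). f t \<omega> \<partial>time_space P T)"
  using TP.nn_integral_snd[OF assms] by (simp add: case_prod_beta)

section \<open>Moments of Brownian increments\<close>

lemma W_F_measurable:
  "i \<in> {1, 2} \<Longrightarrow> 0 \<le> s \<Longrightarrow> s \<le> t \<Longrightarrow> s \<le> T \<Longrightarrow> W i s \<in> borel_measurable (F t)"
  using driver_F_measurable[of i s t] driver_W[of i] by auto

lemma W_moments:
  assumes i: "i \<in> {1, 2}" and st: "0 \<le> s" "s \<le> t" "t \<le> T"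
  shows "has_bochner_integral P (\<lambda>\<omega>. W i t \<omega> - W i s \<omega>) 0"
    and "has_bochner_integral P (\<lambda>\<omega>. (W i t \<omega> - W i s \<omega>)\<^sup>2) (t - s)"
proof -
  let ?I = "\<lambda>\<omega>. W i t \<omega> - W i s \<omega>"
  have "has_bochner_integral P ?I 0 \<and> has_bochner_integral P (\<lambda>\<omega>. (?I \<omega>)\<^sup>2) (t - s)"
  \<comment> \<open>\<open>brownian_motion\<close> prescribes the normal law only for s < t, where
    the standard deviation is positive; the empty increment is treated separately.\<close>
  proof (cases "s = t")
    case True
    then show ?thesis by (simp add: has_bochner_integral_zero)
  next
    case False
    then have pos: "0 < sqrt (t - s)" using st by simp
    have D: "distributed P lborel ?I (normal_density 0 (sqrt (t - s)))"
      using W_brownian[OF i] st False by (auto simp: brownian_motion_def)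
    have "integrable P (\<lambda>\<omega>. ?I \<omega> ^ k)" for k
      using distributed_integrable[OF D, of "\<lambda>x. x ^ k"] integrable_normal_moment[OF pos, of 0 k] by simp
    from this[of 1] this[of 2] have "integrable P ?I" "integrable P (\<lambda>\<omega>. (?I \<omega>)\<^sup>2)" by simp_all
    moreover have "expectation ?I = 0" by (rule normal_distributed_expectation[OF pos D])
    moreover have "expectation (\<lambda>\<omega>. (?I \<omega>)\<^sup>2) = t - s"
      using normal_distributed_variance[OF pos D] calculation(3) st by simp
    ultimately show ?thesis by (simp add: has_bochner_integral_iff)
  qed
  then show "has_bochner_integral P ?I 0" "has_bochner_integral P (\<lambda>\<omega>. (?I \<omega>)\<^sup>2) (t - s)" by auto
qed

lemma W_increment_mean:
  assumes i: "i \<in> {1, 2}" and st: "0 \<le> s" "s \<le> t" "t \<le> T"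
    and X: "X \<in> borel_measurable (F s)" "integrable P X"
  shows "has_bochner_integral P (\<lambda>\<omega>. X \<omega> * (W i t \<omega> - W i s \<omega>)) 0"
proof -
  have ind: "indep_var borel X borel (\<lambda>\<omega>. W i t \<omega> - W i s \<omega>)"
    using indep_var_F_increment[OF _ st X(1), of i] driver_W[OF i] i by auto
  show ?thesis
    using indep_var_lebesgue_integral[OF ind X(2)] indep_var_integrable[OF ind X(2)]
      W_moments(1)[OF i st] by (simp add: has_bochner_integral_iff)
qed

lemma W_increment_square:
  assumes i: "i \<in> {1, 2}" and st: "0 \<le> s" "s \<le> t" "t \<le> T"
    and X: "X \<in> borel_measurable (F s)" "integrable P X"
  shows "has_bochner_integral P (\<lambda>\<omega>. X \<omega> * (W i t \<omega> - W i s \<omega>)\<^sup>2) (expectation X * (t - s))"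
proof -
  have "indep_var borel X borel (\<lambda>\<omega>. W i t \<omega> - W i s \<omega>)"
    using indep_var_F_increment[OF _ st X(1), of i] driver_W[OF i] i by auto
  then have ind: "indep_var borel X borel (\<lambda>\<omega>. (W i t \<omega> - W i s \<omega>)\<^sup>2)"
    using indep_var_compose[of borel X borel _ "\<lambda>x. x" borel "\<lambda>x::real. x\<^sup>2" borel] by (simp add: comp_def)
  show ?thesis
    using indep_var_lebesgue_integral[OF ind X(2)] indep_var_integrable[OF ind X(2)]
      W_moments(2)[OF i st] by (simp add: has_bochner_integral_iff)
qed

text \<open>This is what \<open>simple_predictable\<close> demands of each coefficient. It is
  isolated so that products of coefficients known at different times can be handled: they are
  bounded and known at the later time.\<close>

definition bounded_F :: "real \<Rightarrow> ('a \<Rightarrow> real) \<Rightarrow> bool" where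
  "bounded_F s X \<longleftrightarrow> X \<in> borel_measurable (F s) \<and> (\<exists>C. \<forall>\<omega>\<in>space P. \<bar>X \<omega>\<bar> \<le> C)"

lemma bounded_F_integrable:
  assumes "bounded_F s X"
  shows "integrable P X"
proof -
  obtain C where "\<And>\<omega>. \<omega> \<in> space P \<Longrightarrow> \<bar>X \<omega>\<bar> \<le> C" using assms by (auto simp: bounded_F_def)
  then show ?thesis using assms measurable_F
    by (intro integrable_const_bound[of _ C] AE_I2) (auto simp: bounded_F_def)
qed

lemma bounded_F_mult:
  assumes "bounded_F s X" "bounded_F u Y" "s \<le> u"
  shows "bounded_F u (\<lambda>\<omega>. X \<omega> * Y \<omega>)"
proof -
  obtain C D where "\<And>\<omega>. \<omega> \<in> space P \<Longrightarrow> \<bar>X \<omega>\<bar> \<le> C" "\<And>\<omega>. \<omega> \<in> space P \<Longrightarrow> \<bar>Y \<omega>\<bar> \<le> D"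
    using assms by (auto simp: bounded_F_def)
  then have "\<bar>X \<omega> * Y \<omega>\<bar> \<le> C * D" if "\<omega> \<in> space P" for \<omega>
    unfolding abs_mult using that by (intro mult_mono') auto
  moreover have "X \<in> borel_measurable (F u)" "Y \<in> borel_measurable (F u)"
    using assms(1,2) measurable_F_mono[OF _ assms(3)] unfolding bounded_F_def by blast+
  ultimately show ?thesis
    unfolding bounded_F_def by (intro conjI borel_measurable_times exI[of _ "C * D"]) simp_all
qed

lemma bounded_F_mult_integrable:
  assumes Y: "bounded_F u Y" and G: "integrable P G"
  shows "integrable P (\<lambda>\<omega>. Y \<omega> * G \<omega> :: real)"
proof -
  obtain D where D: "\<And>\<omega>. \<omega> \<in> space P \<Longrightarrow> \<bar>Y \<omega>\<bar> \<le> D" using Y by (auto simp: bounded_F_def)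
  have Ym: "Y \<in> borel_measurable P" using Y measurable_F unfolding bounded_F_def by blast
  have "integrable P (\<lambda>\<omega>. D * G \<omega>)" using G by simp
  then show ?thesis
  proof (rule Bochner_Integration.integrable_bound)
    show "(\<lambda>\<omega>. Y \<omega> * G \<omega>) \<in> borel_measurable P"
      using Ym G by (intro borel_measurable_times) auto
    show "AE \<omega> in P. norm (Y \<omega> * G \<omega>) \<le> norm (D * G \<omega>)"
    proof (rule AE_I2)
      fix \<omega> assume "\<omega> \<in> space P"
      then have "\<bar>Y \<omega>\<bar> \<le> \<bar>D\<bar>" using D[of \<omega>] by linarith
      then show "norm (Y \<omega> * G \<omega>) \<le> norm (D * G \<omega>)" by (simp add: abs_mult mult_right_mono)
    qed
  qed
qed

text \<open>The longer increment is split at \<open>m\<close>: its part after \<open>m\<close> has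
  mean zero given the past up to \<open>m\<close>, which contains the shorter increment, so only the
  expected square over {u<..m} survives.\<close>

lemma W_product_aux:
  assumes i: "i \<in> {1, 2}" and b: "0 \<le> u" "u \<le> m" "m \<le> v" "v \<le> T" and Z: "bounded_F u Z"
  shows "has_bochner_integral P (\<lambda>\<omega>. Z \<omega> * ((W i m \<omega> - W i u \<omega>) * (W i v \<omega> - W i u \<omega>)))
    (expectation Z * (m - u))"
proof -
  have Zu: "Z \<in> borel_measurable (F u)" using Z by (simp add: bounded_F_def)
  note Zi = bounded_F_integrable[OF Z]
  have "(\<lambda>\<omega>. Z \<omega> * (W i m \<omega> - W i u \<omega>)) \<in> borel_measurable (F m)"
    using measurable_F_mono[OF Zu b(2)] W_F_measurable[OF i, of m m] W_F_measurable[OF i, of u m] b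
    by (intro borel_measurable_times borel_measurable_diff) auto
  moreover have "integrable P (\<lambda>\<omega>. Z \<omega> * (W i m \<omega> - W i u \<omega>))"
    using W_increment_mean[OF i _ _ _ Zu Zi, of m] b by (simp add: has_bochner_integral_iff)
  ultimately have "has_bochner_integral P (\<lambda>\<omega>. (Z \<omega> * (W i m \<omega> - W i u \<omega>)) * (W i v \<omega> - W i m \<omega>)) 0"
    using b by (intro W_increment_mean[OF i]) auto
  with W_increment_square[OF i _ _ _ Zu Zi, of m] b
  have "has_bochner_integral P (\<lambda>\<omega>. Z \<omega> * (W i m \<omega> - W i u \<omega>)\<^sup>2 +
      (Z \<omega> * (W i m \<omega> - W i u \<omega>)) * (W i v \<omega> - W i m \<omega>)) (expectation Z * (m - u) + 0)"
    by (intro has_bochner_integral_add) auto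
  moreover have "(\<lambda>\<omega>. Z \<omega> * (W i m \<omega> - W i u \<omega>)\<^sup>2 +
      (Z \<omega> * (W i m \<omega> - W i u \<omega>)) * (W i v \<omega> - W i m \<omega>)) =
      (\<lambda>\<omega>. Z \<omega> * ((W i m \<omega> - W i u \<omega>) * (W i v \<omega> - W i u \<omega>)))"
    by (auto simp: power2_eq_square algebra_simps)
  ultimately show ?thesis by simp
qed

text \<open>Brownian increments over disjoint intervals are orthogonal, even with coefficients known
  at the left endpoints. What \<open>W\<close> gains on {s<..t} before \<open>u\<close> is known at
  time \<open>u\<close> and is annihilated by the later increment; the overlap contributes its
  length.\<close>

lemma W_product_ordered:
  assumes i: "i \<in> {1, 2}" and b: "0 \<le> s" "s \<le> t" "t \<le> T" "0 \<le> u" "u \<le> v" "v \<le> T" "s \<le> u"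
    and X: "bounded_F s X" and Y: "bounded_F u Y"
  shows "has_bochner_integral P
    (\<lambda>\<omega>. (X \<omega> * (W i t \<omega> - W i s \<omega>)) * (Y \<omega> * (W i v \<omega> - W i u \<omega>)))
    (expectation (\<lambda>\<omega>. X \<omega> * Y \<omega>) * measure lborel ({s<..t} \<inter> {u<..v}))"
proof -
  let ?Z = "\<lambda>\<omega>. X \<omega> * Y \<omega>"
  have Z: "bounded_F u ?Z" using bounded_F_mult[OF X Y b(7)] .
  have Xu: "bounded_F s X" "bounded_F u X" using X measurable_F_mono[OF _ b(7)] by (auto simp: bounded_F_def)
  \<comment> \<open>Needed for two values of \<open>q\<close>: \<open>q = t\<close> when the first
    interval ends before the second begins, \<open>q = u\<close> when they overlap.\<close>
  have past: "has_bochner_integral P (\<lambda>\<omega>. (?Z \<omega> * (W i q \<omega> - W i s \<omega>)) * (W i v \<omega> - W i u \<omega>)) 0"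
    if q: "s \<le> q" "q \<le> u" for q
  proof (rule W_increment_mean[OF i b(4-6)])
    show "(\<lambda>\<omega>. ?Z \<omega> * (W i q \<omega> - W i s \<omega>)) \<in> borel_measurable (F u)"
    proof (rule borel_measurable_times)
      show "?Z \<in> borel_measurable (F u)" using Z by (simp add: bounded_F_def)
      show "(\<lambda>\<omega>. W i q \<omega> - W i s \<omega>) \<in> borel_measurable (F u)"
        using W_F_measurable[OF i, of q u] W_F_measurable[OF i, of s u] b q
        by (intro borel_measurable_diff) auto
    qed
    have "integrable P (\<lambda>\<omega>. X \<omega> * (W i q \<omega> - W i s \<omega>))"
      using W_increment_mean[OF i b(1) q(1) _ _ bounded_F_integrable[OF X]] X b q
      unfolding has_bochner_integral_iff bounded_F_def by simp
    from bounded_F_mult_integrable[OF Y this]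
 show "integrable P (\<lambda>\<omega>. ?Z \<omega> * (W i q \<omega> - W i s \<omega>))" by (simp add: mult_ac)
  qed
  show ?thesis
  proof (cases "t \<le> u")
    case True
    then have "{s<..t} \<inter> {u<..v} = {}" by auto
    then show ?thesis using past[OF b(2) True] by (simp only: measure_empty) (simp add: mult_ac)
  next
    case False
    let ?m = "min t v"
    have eq: "{s<..t} \<inter> {u<..v} = {u<..?m}" using b False by auto
    have "has_bochner_integral P (\<lambda>\<omega>. ?Z \<omega> * ((W i t \<omega> - W i u \<omega>) * (W i v \<omega> - W i u \<omega>)))
      (expectation ?Z * (?m - u))"
    proof (cases "t \<le> v")
      case True
      then show ?thesis using W_product_aux[OF i b(4) _ True b(6) Z] False by simp
    next
      case False
      \<comment> \<open>Here \<open>v\<close> comes first, so the roles of the two increments in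
        \<open>W_product_aux\<close> are exchanged.\<close>
      then show ?thesis using W_product_aux[OF i b(4,5) _ b(3) Z] by (simp add: mult_ac)
    qed
    from has_bochner_integral_add[OF past[of u] this] b
    have "has_bochner_integral P (\<lambda>\<omega>. (?Z \<omega> * (W i u \<omega> - W i s \<omega>)) * (W i v \<omega> - W i u \<omega>) +
        ?Z \<omega> * ((W i t \<omega> - W i u \<omega>) * (W i v \<omega> - W i u \<omega>))) (expectation ?Z * (?m - u))" by simp
    moreover have "measure lborel {u<..?m} = ?m - u" using b False by simp
    moreover have "(\<lambda>\<omega>. (?Z \<omega> * (W i u \<omega> - W i s \<omega>)) * (W i v \<omega> - W i u \<omega>) +
        ?Z \<omega> * ((W i t \<omega> - W i u \<omega>) * (W i v \<omega> - W i u \<omega>))) =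
      (\<lambda>\<omega>. (X \<omega> * (W i t \<omega> - W i s \<omega>)) * (Y \<omega> * (W i v \<omega> - W i u \<omega>)))"
      by (auto simp: algebra_simps)
    ultimately show ?thesis unfolding eq by simp
  qed
qed

lemma W_product:
  assumes i: "i \<in> {1, 2}" and b: "0 \<le> s" "s \<le> t" "t \<le> T" "0 \<le> u" "u \<le> v" "v \<le> T"
    and X: "bounded_F s X" and Y: "bounded_F u Y"
  shows "has_bochner_integral P
    (\<lambda>\<omega>. (X \<omega> * (W i t \<omega> - W i s \<omega>)) * (Y \<omega> * (W i v \<omega> - W i u \<omega>)))
    (expectation (\<lambda>\<omega>. X \<omega> * Y \<omega>) * measure lborel ({s<..t} \<inter> {u<..v}))"
proof (cases "s \<le> u")
  case True
  then show ?thesis using W_product_ordered[OF i b True X Y] by simp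
next
  case False
  then show ?thesis using W_product_ordered[OF i b(4-6) b(1-3) _ Y X]
    by (simp add: mult.commute Int_commute)
qed

text \<open>Ito's isometry for a finite family of intervals that may overlap. Allowing overlaps
  makes the difference of two simple integrals on unrelated grids an instance, without a common
  refinement. After the squares are expanded, both sides equal the double sum of E[c_k c_l] times
  the length of the overlap of the intervals \<open>k\<close> and \<open>l\<close>.\<close>

lemma elementary_isometry:
  fixes c :: "'k \<Rightarrow> 'a \<Rightarrow> real"
  assumes i: "i \<in> {1, 2}" and K: "finite K"
    and uv: "\<And>k. k \<in> K \<Longrightarrow> 0 \<le> u k \<and> u k \<le> v k \<and> v k \<le> T"
    and c: "\<And>k. k \<in> K \<Longrightarrow> bounded_F (u k) (c k)"
  shows "(\<integral>\<^sup>+\<omega>. ennreal ((\<Sum>k\<in>K. c k \<omega> * (W i (v k) \<omega> - W i (u k) \<omega>))\<^sup>2) \<partial>P) =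
    (\<integral>\<^sup>+\<omega>. (\<integral>\<^sup>+s\<in>{0..T}. ennreal ((\<Sum>k\<in>K. c k \<omega> * indicator {u k<..v k} s)\<^sup>2) \<partial>lborel) \<partial>P)"
proof -
  let ?I = "\<lambda>k l. measure lborel ({u k<..v k} \<inter> {u l<..v l})"
  let ?E = "\<Sum>k\<in>K. \<Sum>l\<in>K. expectation (\<lambda>\<omega>. c k \<omega> * c l \<omega>) * ?I k l"
  have "has_bochner_integral P (\<lambda>\<omega>. \<Sum>k\<in>K. \<Sum>l\<in>K.
     (c k \<omega> * (W i (v k) \<omega> - W i (u k) \<omega>)) * (c l \<omega> * (W i (v l) \<omega> - W i (u l) \<omega>))) ?E"
    using uv c by (intro has_bochner_integral_sum W_product[OF i]) auto
  moreover have "(\<Sum>k\<in>K. \<Sum>l\<in>K. f k * f l) = (\<Sum>k\<in>K. f k)\<^sup>2" for f :: "'k \<Rightarrow> real"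
    by (simp add: power2_eq_square sum_product)
  ultimately have 1: "has_bochner_integral P (\<lambda>\<omega>. (\<Sum>k\<in>K. c k \<omega> * (W i (v k) \<omega> - W i (u k) \<omega>))\<^sup>2) ?E"
    by simp
  have 2: "has_bochner_integral lborel (\<lambda>s. (\<Sum>k\<in>K. c k \<omega> * indicator {u k<..v k} s)\<^sup>2)
     (\<Sum>k\<in>K. \<Sum>l\<in>K. (c k \<omega> * c l \<omega>) * ?I k l)" (is "has_bochner_integral _ ?f _") for \<omega>
  proof -
    have "has_bochner_integral lborel (indicator ({u k<..v k} \<inter> {u l<..v l}) :: real \<Rightarrow> real) (?I k l)" for k l
    proof (rule has_bochner_integral_real_indicator)
      show "emeasure lborel ({u k<..v k} \<inter> {u l<..v l}) < \<infinity>"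
        unfolding Int_greaterThanAtMost
        by (cases "max (u k) (u l) \<le> min (v k) (v l)")
           (simp only: emeasure_lborel_Ioc, simp, simp only: greaterThanAtMost_empty not_le less_imp_le, simp)
    qed simp
    then have "has_bochner_integral lborel (\<lambda>s. \<Sum>k\<in>K. \<Sum>l\<in>K. (c k \<omega> * c l \<omega>) * indicator ({u k<..v k} \<inter> {u l<..v l}) s)
     (\<Sum>k\<in>K. \<Sum>l\<in>K. (c k \<omega> * c l \<omega>) * ?I k l)"
      by (intro has_bochner_integral_sum has_bochner_integral_mult_right)
    moreover have "(\<lambda>s. \<Sum>k\<in>K. \<Sum>l\<in>K. (c k \<omega> * c l \<omega>) * indicator ({u k<..v k} \<inter> {u l<..v l}) s) = ?f"
      by (intro ext) (simp add: power2_eq_square sum_product indicator_inter_arith mult_ac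
        del: Int_greaterThanAtMost)
    ultimately show ?thesis by simp
  qed
  have supp: "(\<integral>\<^sup>+s\<in>{0..T}. ennreal ((\<Sum>k\<in>K. c k \<omega> * indicator {u k<..v k} s)\<^sup>2) \<partial>lborel) =
      ennreal (\<Sum>k\<in>K. \<Sum>l\<in>K. (c k \<omega> * c l \<omega>) * ?I k l)" for \<omega>
  proof -
    have "(\<Sum>k\<in>K. c k \<omega> * indicator {u k<..v k} s) = 0" if "s \<notin> {0..T}" for s
      using that uv by (intro sum.neutral) (fastforce simp: indicator_def)
    then have "(\<integral>\<^sup>+s\<in>{0..T}. ennreal ((\<Sum>k\<in>K. c k \<omega> * indicator {u k<..v k} s)\<^sup>2) \<partial>lborel) =
      (\<integral>\<^sup>+s. ennreal ((\<Sum>k\<in>K. c k \<omega> * indicator {u k<..v k} s)\<^sup>2) \<partial>lborel)"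
      by (intro nn_integral_cong) (auto simp: indicator_def)
    also have "\<dots> = ennreal (\<Sum>k\<in>K. \<Sum>l\<in>K. (c k \<omega> * c l \<omega>) * ?I k l)"
      using 2[of \<omega>] by (subst nn_integral_eq_integral) (auto simp: has_bochner_integral_iff)
    finally show ?thesis .
  qed
  \<comment> \<open>This cannot be seen term by term: the double sum is nonnegative because it is
    the integral of a square.\<close>
  have nonneg: "0 \<le> (\<Sum>k\<in>K. \<Sum>l\<in>K. (c k \<omega> * c l \<omega>) * ?I k l)" for \<omega>
    unfolding has_bochner_integral_integral_eq[OF 2, symmetric] by simp
  have cc: "integrable P (\<lambda>\<omega>. c k \<omega> * c l \<omega>)" if "k \<in> K" "l \<in> K" for k l
  proof (cases "u k \<le> u l")
    case True
    then show ?thesis using bounded_F_mult[OF c c True] that bounded_F_integrable by blast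
  next
    case False
    then have "u l \<le> u k" by simp
    then have "integrable P (\<lambda>\<omega>. c l \<omega> * c k \<omega>)"
      using bounded_F_mult[OF c c] that bounded_F_integrable by blast
    then show ?thesis by (simp add: mult.commute)
  qed
  have "has_bochner_integral P (\<lambda>\<omega>. \<Sum>k\<in>K. \<Sum>l\<in>K. (c k \<omega> * c l \<omega>) * ?I k l) ?E"
    using cc by (intro has_bochner_integral_sum has_bochner_integral_mult_left) (auto simp: has_bochner_integral_iff)
  then have "(\<integral>\<^sup>+\<omega>. ennreal (\<Sum>k\<in>K. \<Sum>l\<in>K. (c k \<omega> * c l \<omega>) * ?I k l) \<partial>P) = ennreal ?E"
    using nonneg by (subst nn_integral_eq_integral) (auto simp: has_bochner_integral_iff)
  moreover have "(\<integral>\<^sup>+\<omega>. ennreal ((\<Sum>k\<in>K. c k \<omega> * (W i (v k) \<omega> - W i (u k) \<omega>))\<^sup>2) \<partial>P) = ennreal ?E"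
    using 1 by (subst nn_integral_eq_integral) (auto simp: has_bochner_integral_iff)
  ultimately show ?thesis by (simp add: supp)
qed

lemma simple_predictable_bounded:
  assumes "simple_predictable P F T n \<tau> \<xi>" "j < n"
  shows "bounded_F (\<tau> j) (\<xi> j)" "0 \<le> \<tau> j" "\<tau> j \<le> \<tau> (Suc j)" "\<tau> (Suc j) \<le> T"
  using assms by (auto simp: simple_predictable_def bounded_F_def Suc_le_eq)

lemma simple_integral_horizon:
  assumes "simple_predictable P F T n \<tau> \<xi>"
  shows "simple_integral n \<tau> \<xi> X T \<omega> = (\<Sum>j<n. \<xi> j \<omega> * (X (\<tau> (Suc j)) \<omega> - X (\<tau> j) \<omega>))"
  unfolding simple_integral_def
proof (rule sum.cong)
  fix j assume "j \<in> {..<n}"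
  then have "\<tau> j \<le> T" "\<tau> (Suc j) \<le> T" using simple_predictable_bounded[OF assms, of j] by auto
  then show "\<xi> j \<omega> * (X (min (\<tau> (Suc j)) T) \<omega> - X (min (\<tau> j) T) \<omega>) =
    \<xi> j \<omega> * (X (\<tau> (Suc j)) \<omega> - X (\<tau> j) \<omega>)" by (simp add: min_absorb1)
qed simp

lemma simple_integral_mean:
  assumes i: "i \<in> {1, 2}" and S: "simple_predictable P F T n \<tau> \<xi>"
  shows "has_bochner_integral P (simple_integral n \<tau> \<xi> (W i) T) 0"
proof -
  have "has_bochner_integral P (\<lambda>\<omega>. \<xi> j \<omega> * (W i (\<tau> (Suc j)) \<omega> - W i (\<tau> j) \<omega>)) 0" if "j < n" for j
    using simple_predictable_bounded[OF S that] bounded_F_integrable[OF simple_predictable_bounded(1)[OF S that]]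
    by (intro W_increment_mean[OF i]) (simp_all add: bounded_F_def)
  then have "has_bochner_integral P (\<lambda>\<omega>. \<Sum>j<n. \<xi> j \<omega> * (W i (\<tau> (Suc j)) \<omega> - W i (\<tau> j) \<omega>)) (\<Sum>j<n. 0)"
    by (intro has_bochner_integral_sum) auto
  then show ?thesis by (simp add: simple_integral_horizon[OF S, abs_def])
qed

lemma simple_process_measurable:
  assumes "simple_predictable P F T n \<tau> \<xi>"
  shows "(\<lambda>(t, \<omega>). simple_process n \<tau> \<xi> t \<omega>) \<in> borel_measurable (time_space P T)"
proof -
  have \<xi>: "\<xi> j \<in> borel_measurable P" if "j < n" for j
    using simple_predictable_bounded(1)[OF assms that] measurable_F by (auto simp: bounded_F_def)
  have I: "indicator {\<tau> j<..\<tau> (Suc j)} \<in> borel_measurable horizon" for j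
    by (intro measurable_restrict_space1) simp
  have "(\<lambda>z. \<Sum>j<n. \<xi> j (snd z) * (indicator {\<tau> j<..\<tau> (Suc j)} (fst z) :: real))
      \<in> borel_measurable (time_space P T)"
    by (intro borel_measurable_sum borel_measurable_times measurable_compose[OF measurable_snd \<xi>]
          measurable_compose[OF measurable_fst I]) auto
  then show ?thesis by (simp add: simple_process_def case_prod_beta')
qed

text \<open>The two step processes are joined over the disjoint sum of their index sets, the second
  with opposite sign.\<close>

lemma simple_isometry:
  assumes i: "i \<in> {1, 2}" and S: "simple_predictable P F T n \<tau> \<xi>" "simple_predictable P F T n' \<tau>' \<xi>'"
  shows "(\<integral>\<^sup>+\<omega>. ennreal ((simple_integral n \<tau> \<xi> (W i) T \<omega> - simple_integral n' \<tau>' \<xi>' (W i) T \<omega>)\<^sup>2) \<partial>P) =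
    (\<integral>\<^sup>+\<omega>. (\<integral>\<^sup>+s\<in>{0..T}. ennreal ((simple_process n \<tau> \<xi> s \<omega> - simple_process n' \<tau>' \<xi>' s \<omega>)\<^sup>2) \<partial>lborel) \<partial>P)"
proof -
  let ?K = "{..<n} <+> {..<n'}"
  let ?u = "case_sum \<tau> \<tau>'" and ?v = "case_sum (\<lambda>j. \<tau> (Suc j)) (\<lambda>j. \<tau>' (Suc j))"
  let ?c = "case_sum \<xi> (\<lambda>j \<omega>. - \<xi>' j \<omega>)"
  have neg: "bounded_F s (\<lambda>\<omega>. - X \<omega>)" if "bounded_F s X" for s X
    using that by (auto simp: bounded_F_def)
  have "(\<integral>\<^sup>+\<omega>. ennreal ((\<Sum>k\<in>?K. ?c k \<omega> * (W i (?v k) \<omega> - W i (?u k) \<omega>))\<^sup>2) \<partial>P) =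
    (\<integral>\<^sup>+\<omega>. (\<integral>\<^sup>+s\<in>{0..T}. ennreal ((\<Sum>k\<in>?K. ?c k \<omega> * indicator {?u k<..?v k} s)\<^sup>2) \<partial>lborel) \<partial>P)"
  proof (rule elementary_isometry[OF i])
    show "0 \<le> ?u k \<and> ?u k \<le> ?v k \<and> ?v k \<le> T" if "k \<in> ?K" for k
      using that simple_predictable_bounded[OF S(1)] simple_predictable_bounded[OF S(2)] by auto
    show "bounded_F (?u k) (?c k)" if "k \<in> ?K" for k
      using that simple_predictable_bounded[OF S(1)] simple_predictable_bounded[OF S(2)] neg by auto
  qed simp
  moreover have "(\<Sum>k\<in>?K. ?c k \<omega> * (W i (?v k) \<omega> - W i (?u k) \<omega>)) =
      simple_integral n \<tau> \<xi> (W i) T \<omega> - simple_integral n' \<tau>' \<xi>' (W i) T \<omega>" for \<omega>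
    by (simp add: sum.Plus comp_def simple_integral_horizon[OF S(1)] simple_integral_horizon[OF S(2)] sum_negf)
  moreover have "(\<Sum>k\<in>?K. ?c k \<omega> * indicator {?u k<..?v k} s) =
      simple_process n \<tau> \<xi> s \<omega> - simple_process n' \<tau>' \<xi>' s \<omega>" for s \<omega>
    by (subst sum.Plus) (simp_all add: comp_def simple_process_def sum_negf)
  ultimately show ?thesis by simp
qed

lemma ito_integral_measurable: "has_ito_integral_L2 P F T X H J \<Longrightarrow> J T \<in> borel_measurable P"
  using T_pos by (auto simp: has_ito_integral_L2_def adapted_def intro!: measurable_F)

lemma ito_integral_L2E:
  assumes "has_ito_integral_L2 P F T X H J"
  obtains n \<tau> \<xi> where "\<And>k::nat. simple_predictable P F T (n k) (\<tau> k) (\<xi> k)"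
    "(\<lambda>k. \<integral>\<^sup>+\<omega>. (\<integral>\<^sup>+s\<in>{0..T}.
            ennreal ((simple_process (n k) (\<tau> k) (\<xi> k) s \<omega> - H s \<omega>)\<^sup>2) \<partial>lborel) \<partial>P)
          \<longlonglongrightarrow> 0"
    "(\<lambda>k. \<integral>\<^sup>+\<omega>. ennreal ((simple_integral (n k) (\<tau> k) (\<xi> k) X T \<omega> - J T \<omega>)\<^sup>2) \<partial>P) \<longlonglongrightarrow> 0"
proof -
  have "T \<in> {0..T}" using T_pos by simp
  then show ?thesis using assms that unfolding has_ito_integral_L2_def by blast
qed

text \<open>Since the approximating integrals \<open>I k\<close> are centered, the square of the
  mean of \<open>J T\<close> equals that of \<open>I k - J T\<close> and is at most the mean square
  of this difference, which is arbitrarily small. Finiteness of the same mean square gives the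
  integrability of \<open>J T\<close>.\<close>

lemma ito_integral_mean:
  assumes i: "i \<in> {1, 2}" and J: "has_ito_integral_L2 P F T (W i) H J"
  shows "has_bochner_integral P (J T) 0"
proof -
  obtain n \<tau> \<xi> where S: "\<And>k::nat. simple_predictable P F T (n k) (\<tau> k) (\<xi> k)"
    and lim: "(\<lambda>k. \<integral>\<^sup>+\<omega>. ennreal ((simple_integral (n k) (\<tau> k) (\<xi> k) (W i) T \<omega> - J T \<omega>)\<^sup>2) \<partial>P) \<longlonglongrightarrow> 0"
    by (rule ito_integral_L2E[OF J], rule that)
  define I where "I k = simple_integral (n k) (\<tau> k) (\<xi> k) (W i) T" for k
  have I: "has_bochner_integral P (I k) 0" for k
    unfolding I_def by (rule simple_integral_mean[OF i S])
  have Im: "I k \<in> borel_measurable P" for k using I[of k] by (auto simp: has_bochner_integral_iff)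
  note Jm = ito_integral_measurable[OF J]
  have small: "integrable P (J T) \<and> (expectation (J T))\<^sup>2 \<le> e" if "0 < e" for e
  proof -
    have "eventually (\<lambda>k. (\<integral>\<^sup>+\<omega>. ennreal ((I k \<omega> - J T \<omega>)\<^sup>2) \<partial>P) < ennreal e) sequentially"
      using lim that unfolding I_def by (intro order_tendstoD(2)) auto
    then obtain k where k: "(\<integral>\<^sup>+\<omega>. ennreal ((I k \<omega> - J T \<omega>)\<^sup>2) \<partial>P) < ennreal e"
      by (auto simp: eventually_sequentially)
    let ?D = "\<lambda>\<omega>. I k \<omega> - J T \<omega>"
    have Dm: "?D \<in> borel_measurable P" using Im Jm by (rule borel_measurable_diff)
    have D2: "integrable P (\<lambda>\<omega>. (?D \<omega>)\<^sup>2)"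
      using Dm k by (intro integrableI_bounded) (auto intro: less_trans simp: ennreal_less_top)
    have D: "integrable P ?D" using square_integrable_imp_integrable[OF Dm D2] .
    have "integrable P (\<lambda>\<omega>. I k \<omega> - ?D \<omega>)"
      by (rule Bochner_Integration.integrable_diff[OF integrable.intros[OF I] D])
    moreover have "(\<lambda>\<omega>. I k \<omega> - ?D \<omega>) = J T" by (intro ext) simp
    ultimately have Ji: "integrable P (J T)" by simp
    have "expectation ?D = - expectation (J T)"
      using I[of k] Ji by (simp add: has_bochner_integral_iff)
    then have "(expectation (J T))\<^sup>2 \<le> expectation (\<lambda>\<omega>. (?D \<omega>)\<^sup>2)"
      using power2_expectation_le[OF Dm D2] by simp
    also have "\<dots> \<le> e"
    proof -
      have "ennreal (expectation (\<lambda>\<omega>. (?D \<omega>)\<^sup>2)) < ennreal e"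
        using k D2 by (simp add: nn_integral_eq_integral)
      then show ?thesis using that by (simp add: ennreal_less_iff)
    qed
    finally show ?thesis using Ji by simp
  qed
  have "(expectation (J T))\<^sup>2 \<le> 0"
    by (rule field_le_epsilon) (use small in simp)
  moreover have "integrable P (J T)" using small[of 1] by simp
  ultimately show ?thesis by (simp add: has_bochner_integral_iff)
qed

text \<open>The approximating sequences of the two integrals may be unrelated. The isometry
  transfers the distance between their \<open>k\<close>-th integrals to the distance between their
  \<open>k\<close>-th step processes, which tends to 0 since both approach the same integrand up to
  a null set.\<close>

lemma ito_integral_unique:
  assumes i: "i \<in> {1, 2}"
    and J: "has_ito_integral_L2 P F T (W i) H J" "has_ito_integral_L2 P F T (W i) H' J'"
    and eq: "AE (t, \<omega>) in time_space P T. H t \<omega> = H' t \<omega>"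
  shows "AE \<omega> in P. J T \<omega> = J' T \<omega>"
proof -
  let ?E = "\<lambda>f. \<integral>\<^sup>+\<omega>. ennreal ((f \<omega>)\<^sup>2) \<partial>P"
  let ?EE = "\<lambda>f. \<integral>\<^sup>+z. ennreal ((f (fst z) (snd z))\<^sup>2) \<partial>time_space P T"
  have EE: "(\<integral>\<^sup>+\<omega>. (\<integral>\<^sup>+s\<in>{0..T}. ennreal ((f s \<omega>)\<^sup>2) \<partial>lborel) \<partial>P) = ?EE f"
    if "(\<lambda>(t, \<omega>). f t \<omega>) \<in> borel_measurable (time_space P T)" for f
    unfolding set_nn_integral_horizon using that
    by (subst nn_integral_time_space) (auto simp: case_prod_beta' intro!: measurable_compose[OF _ measurable_ennreal])
  obtain n \<tau> \<xi> where S: "\<And>k::nat. simple_predictable P F T (n k) (\<tau> k) (\<xi> k)"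
    and limH: "(\<lambda>k. \<integral>\<^sup>+\<omega>. (\<integral>\<^sup>+s\<in>{0..T}.
            ennreal ((simple_process (n k) (\<tau> k) (\<xi> k) s \<omega> - H s \<omega>)\<^sup>2) \<partial>lborel) \<partial>P)
          \<longlonglongrightarrow> 0"
    and lim: "(\<lambda>k. ?E (\<lambda>\<omega>. simple_integral (n k) (\<tau> k) (\<xi> k) (W i) T \<omega> - J T \<omega>)) \<longlonglongrightarrow> 0"
    by (rule ito_integral_L2E[OF J(1)], rule that)
  obtain n' \<tau>' \<xi>' where S': "\<And>k::nat. simple_predictable P F T (n' k) (\<tau>' k) (\<xi>' k)"
    and limH': "(\<lambda>k. \<integral>\<^sup>+\<omega>. (\<integral>\<^sup>+s\<in>{0..T}.
            ennreal ((simple_process (n' k) (\<tau>' k) (\<xi>' k) s \<omega> - H' s \<omega>)\<^sup>2) \<partial>lborel) \<partial>P)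
          \<longlonglongrightarrow> 0"
    and lim': "(\<lambda>k. ?E (\<lambda>\<omega>. simple_integral (n' k) (\<tau>' k) (\<xi>' k) (W i) T \<omega> - J' T \<omega>)) \<longlonglongrightarrow> 0"
    by (rule ito_integral_L2E[OF J(2)], rule that)
  define p where "p k = simple_process (n k) (\<tau> k) (\<xi> k)" for k
  define p' where "p' k = simple_process (n' k) (\<tau>' k) (\<xi>' k)" for k
  define I where "I k = simple_integral (n k) (\<tau> k) (\<xi> k) (W i) T" for k
  define I' where "I' k = simple_integral (n' k) (\<tau>' k) (\<xi>' k) (W i) T" for k
  have Hm: "(\<lambda>(t, \<omega>). H t \<omega>) \<in> borel_measurable (time_space P T)"
    "(\<lambda>(t, \<omega>). H' t \<omega>) \<in> borel_measurable (time_space P T)"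
    using J by (auto simp: has_ito_integral_L2_def intro: predictable_measurable)
  have pm: "(\<lambda>(t, \<omega>). p k t \<omega>) \<in> borel_measurable (time_space P T)"
    "(\<lambda>(t, \<omega>). p' k t \<omega>) \<in> borel_measurable (time_space P T)" for k
    unfolding p_def p'_def by (intro simple_process_measurable S S')+
  note meas = Hm[unfolded case_prod_beta'] pm[unfolded case_prod_beta']
  have Im: "I k \<in> borel_measurable P" "I' k \<in> borel_measurable P" for k
    unfolding I_def I'_def using simple_integral_mean[OF i S, of k] simple_integral_mean[OF i S', of k]
    by (auto simp: has_bochner_integral_iff)
  have Jm: "J T \<in> borel_measurable P" "J' T \<in> borel_measurable P"
    using J by (auto intro: ito_integral_measurable)
  \<comment> \<open>Two triangle inequalities are nested, hence the two factors 3: from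
    \<open>J\<close> to \<open>J'\<close> through \<open>I k\<close> and \<open>I' k\<close>, and,
    after the isometry, from \<open>p k\<close> to \<open>p' k\<close> through \<open>H\<close> and
    \<open>H'\<close>. The distance from \<open>H\<close> to \<open>H'\<close> vanishes by
    \<open>eq\<close>.\<close>
  have bound: "?E (\<lambda>\<omega>. J T \<omega> - J' T \<omega>) \<le> 3 * (?E (\<lambda>\<omega>. I k \<omega> - J T \<omega>) + ?E (\<lambda>\<omega>. I' k \<omega> - J' T \<omega>) +
      3 * (?EE (\<lambda>s \<omega>. p k s \<omega> - H s \<omega>) + ?EE (\<lambda>s \<omega>. p' k s \<omega> - H' s \<omega>)))" for k
  proof -
    have "?E (\<lambda>\<omega>. J T \<omega> - J' T \<omega>) \<le> 3 * (?E (\<lambda>\<omega>. I k \<omega> - J T \<omega>) + ?E (\<lambda>\<omega>. I' k \<omega> - J' T \<omega>) +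
        ?E (\<lambda>\<omega>. I k \<omega> - I' k \<omega>))"
      using Im Jm by (intro nn_integral_power2_sum_le borel_measurable_diff AE_I2) auto
    also have "?E (\<lambda>\<omega>. I k \<omega> - I' k \<omega>) = ?EE (\<lambda>s \<omega>. p k s \<omega> - p' k s \<omega>)"
      unfolding I_def I'_def simple_isometry[OF i S S'] p_def[symmetric] p'_def[symmetric]
      using meas by (intro EE) (simp add: case_prod_beta')
    also have "\<dots> \<le> 3 * (?EE (\<lambda>s \<omega>. p k s \<omega> - H s \<omega>) + ?EE (\<lambda>s \<omega>. p' k s \<omega> - H' s \<omega>) +
        ?EE (\<lambda>s \<omega>. H s \<omega> - H' s \<omega>))"
      using meas by (intro nn_integral_power2_sum_le borel_measurable_diff AE_I2) auto
    also have "?EE (\<lambda>s \<omega>. H s \<omega> - H' s \<omega>) = (\<integral>\<^sup>+z. 0 \<partial>time_space P T)"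
      by (rule nn_integral_cong_AE) (use eq in \<open>auto simp: case_prod_beta'\<close>)
    finally show ?thesis by (simp add: mult_left_mono add_left_mono)
  qed
  have "(\<lambda>k. 3 * (?E (\<lambda>\<omega>. I k \<omega> - J T \<omega>) + ?E (\<lambda>\<omega>. I' k \<omega> - J' T \<omega>) +
      3 * (?EE (\<lambda>s \<omega>. p k s \<omega> - H s \<omega>) + ?EE (\<lambda>s \<omega>. p' k s \<omega> - H' s \<omega>)))) \<longlonglongrightarrow> 3 * (0 + 0 + 3 * (0 + 0))"
  proof (intro tendsto_intros)
    show "(\<lambda>k. ?EE (\<lambda>s \<omega>. p k s \<omega> - H s \<omega>)) \<longlonglongrightarrow> 0"
      using limH meas unfolding p_def[symmetric] by (subst (asm) EE) (simp_all add: case_prod_beta')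
    show "(\<lambda>k. ?EE (\<lambda>s \<omega>. p' k s \<omega> - H' s \<omega>)) \<longlonglongrightarrow> 0"
      using limH' meas unfolding p'_def[symmetric] by (subst (asm) EE) (simp_all add: case_prod_beta')
    show "(\<lambda>k. ?E (\<lambda>\<omega>. I k \<omega> - J T \<omega>)) \<longlonglongrightarrow> 0" using lim unfolding I_def .
    show "(\<lambda>k. ?E (\<lambda>\<omega>. I' k \<omega> - J' T \<omega>)) \<longlonglongrightarrow> 0" using lim' unfolding I'_def .
  qed auto
  then have "?E (\<lambda>\<omega>. J T \<omega> - J' T \<omega>) \<le> 0"
    using bound by (intro LIMSEQ_le_const[of _ _ "?E (\<lambda>\<omega>. J T \<omega> - J' T \<omega>)"]) auto
  then have "AE \<omega> in P. ennreal ((J T \<omega> - J' T \<omega>)\<^sup>2) = 0"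
    using Jm by (subst (asm) le_zero_eq, subst (asm) nn_integral_0_iff_AE) auto
  then show ?thesis by eventually_elim (simp add: ennreal_eq_0_iff)
qed

end

section \<open>The compensation formula\<close>

lemma poisson_mean_sums:
  "(\<lambda>k. real k * (exp (- L) * L ^ k / fact k)) sums (L::real)"
proof -
  have "(\<lambda>k. L * exp (- L) * (L ^ k /\<^sub>R fact k)) sums (L * exp (- L) * exp L)"
    by (intro sums_mult exp_converges)
  moreover have "real (Suc k) * (exp (- L) * L ^ Suc k / fact (Suc k)) = L * exp (- L) * (L ^ k /\<^sub>R fact k)" for k
    by (simp add: field_simps del: of_nat_Suc)
  moreover have "L * exp (- L) * exp L = L" by (simp add: exp_minus)
  ultimately show ?thesis
    using sums_Suc[of "\<lambda>k. real k * (exp (- L) * L ^ k / fact k)" L] by simp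
qed

context wiener_poisson
begin

text \<open>The mean number of jumps up to time \<open>t\<close>. As a gauge integral it comes with
  additivity in the interval and continuity in the endpoint; \<open>lam_increment\<close> translates
  back to the Lebesgue integral in \<open>poisson_process\<close>.\<close>

definition intensity :: "nat \<Rightarrow> real \<Rightarrow> real" where
  "intensity i t = integral {0..t} (lam i)"

lemma lam_horizon_measurable: "i \<in> {1, 2} \<Longrightarrow> lam i \<in> borel_measurable horizon"
  using lam_integrable[of i] unfolding set_integrable_def
  by (subst borel_measurable_restrict_space_iff) auto

lemma lam_integrable_sub:
  assumes "i \<in> {1, 2}" "0 \<le> s" "t \<le> T"
  shows "set_integrable lborel {s..t} (lam i)"
  using assms by (intro set_integrable_subset[OF lam_integrable]) auto

lemma lam_increment:
  assumes i: "i \<in> {1, 2}" and st: "0 \<le> s" "s \<le> t" "t \<le> T"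
  shows "(LBINT u:{s..t}. lam i u) = intensity i t - intensity i s"
proof -
  have "lam i integrable_on {0..t}"
    using st by (intro set_borel_integral_eq_integral(1) lam_integrable_sub[OF i]) auto
  then have "integral {0..s} (lam i) + integral {s..t} (lam i) = integral {0..t} (lam i)"
    using st by (intro Henstock_Kurzweil_Integration.integral_combine) auto
  moreover have "(LBINT u:{s..t}. lam i u) = integral {s..t} (lam i)"
    using st by (intro set_borel_integral_eq_integral(2) lam_integrable_sub[OF i]) auto
  ultimately show ?thesis by (simp add: intensity_def)
qed

lemma intensity_mono:
  assumes i: "i \<in> {1, 2}" and st: "0 \<le> s" "s \<le> t" "t \<le> T"
  shows "intensity i s \<le> intensity i t"
proof -
  have "0 \<le> (LBINT u:{s..t}. lam i u)"
    using lam_nonneg[OF i] st unfolding set_lebesgue_integral_def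
    by (intro integral_nonneg_AE AE_I2) (auto simp: indicator_def)
  then show ?thesis using lam_increment[OF i st] by simp
qed

lemma intensity_continuous:
  assumes "i \<in> {1, 2}"
  shows "continuous_on {0..T} (intensity i)"
  unfolding intensity_def[abs_def]
  by (intro indefinite_integral_continuous_1 set_borel_integral_eq_integral(1) lam_integrable assms)

lemma nn_integral_lam:
  assumes i: "i \<in> {1, 2}" and st: "0 \<le> s" "s \<le> t" "t \<le> T"
  shows "(\<integral>\<^sup>+u. indicator {s<..t} u * ennreal (lam i u) \<partial>horizon) = ennreal (intensity i t - intensity i s)"
proof -
  have "(\<integral>\<^sup>+u. indicator {s<..t} u * ennreal (lam i u) \<partial>horizon) =
      (\<integral>\<^sup>+u. (indicator {s<..t} u * ennreal (lam i u)) * indicator {0..T} u \<partial>lborel)"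
    by (rule nn_integral_restrict_space) simp
  \<comment> \<open>Predictable rectangles are half-open in time, whereas the Poisson law integrates
    over {s..t}; the difference is the single point \<open>s\<close>, a null set.\<close>
  also have "\<dots> = (\<integral>\<^sup>+u. ennreal (indicator {s..t} u *\<^sub>R lam i u) \<partial>lborel)"
    by (intro nn_integral_cong_AE eventually_mono[OF AE_lborel_singleton[of s]])
       (use st in \<open>auto simp: indicator_def\<close>)
  also have "\<dots> = ennreal (LBINT u:{s..t}. lam i u)"
    unfolding set_lebesgue_integral_def
    using lam_integrable_sub[OF i st(1,3)] lam_nonneg[OF i] st
    by (intro nn_integral_eq_integral AE_I2) (auto simp: set_integrable_def indicator_def)
  finally show ?thesis by (simp add: lam_increment[OF i st])
qed

section \<open>Paths and increments of the counting processes\<close>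

lemma N_path:
  assumes "i \<in> {1, 2}" "\<omega> \<in> space P"
  shows "N i 0 \<omega> = 0" "mono_on {0..T} (\<lambda>t. N i t \<omega>)" "cadlag T (\<lambda>t. real (N i t \<omega>))"
  using N_poisson[OF assms(1)] assms(2) by (auto simp: poisson_process_def)

lemma N_mono:
  assumes "i \<in> {1, 2}" "\<omega> \<in> space P" "0 \<le> s" "s \<le> t" "t \<le> T"
  shows "N i s \<omega> \<le> N i t \<omega>"
  using N_path(2)[OF assms(1,2)] assms(3-5) by (auto simp: mono_on_def)

lemma jumps:
  assumes "i \<in> {1, 2}" "\<omega> \<in> space P" "0 \<le> s" "s \<le> t" "t \<le> T"
  shows "finite {u \<in> {s<..t}. jump (N i) u \<omega> \<noteq> 0}"
    and "(\<Sum>u\<in>{u \<in> {s<..t}. jump (N i) u \<omega> \<noteq> 0}. jump (N i) u \<omega>) = real (N i t \<omega>) - real (N i s \<omega>)"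
  using step_path[of T "N i" \<omega> s t] N_path[OF assms(1,2)] assms(3-5) by auto

lemma jump_Nats:
  assumes "i \<in> {1, 2}" "\<omega> \<in> space P" "0 < u" "u \<le> T"
  shows "jump (N i) u \<omega> \<in> \<nat>"
  using step_path[of T "N i" \<omega> 0 T] N_path[OF assms(1,2)] assms(3-4) T_pos by auto

lemma jump_nonneg:
  assumes "i \<in> {1, 2}" "\<omega> \<in> space P" "0 < u" "u \<le> T"
  shows "0 \<le> jump (N i) u \<omega>"
  using jump_Nats[OF assms] by (auto elim: Nats_cases)

lemma finite_jump_times: "i \<in> {1, 2} \<Longrightarrow> \<omega> \<in> space P \<Longrightarrow> finite (jump_times (N i) T \<omega>)"
  unfolding jump_times_def using T_pos by (intro jumps) auto

lemma jump_le_increment: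
  assumes "i \<in> {1, 2}" "\<omega> \<in> space P" "0 \<le> s" "s < u" "u \<le> t" "t \<le> T"
  shows "jump (N i) u \<omega> \<le> real (N i t \<omega>) - real (N i s \<omega>)"
proof (cases "jump (N i) u \<omega> = 0")
  case True
  then show ?thesis using N_mono[OF assms(1,2), of s t] assms by simp
next
  case False
  then have "jump (N i) u \<omega> \<le> (\<Sum>u\<in>{u \<in> {s<..t}. jump (N i) u \<omega> \<noteq> 0}. jump (N i) u \<omega>)"
    using assms jumps(1)[OF assms(1,2), of s t] jump_nonneg[OF assms(1,2)]
    by (intro member_le_sum) auto
  then show ?thesis using jumps(2)[OF assms(1,2), of s t] assms by simp
qed

lemma N_increment_measurable:
  assumes i: "i \<in> {1, 2}" and st: "0 \<le> s" "s \<le> t" "t \<le> T"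
  shows "(\<lambda>\<omega>. N i t \<omega> - N i s \<omega>) \<in> measurable P (count_space UNIV)"
proof (rule measurable_compose_countable[where f="\<lambda>k \<omega>. N i t \<omega> - k"])
  show "(\<lambda>\<omega>. N i t \<omega> - k) \<in> measurable P (count_space UNIV)" for k
    using st by (intro measurable_compose[OF N_measurable[OF i]]) auto
  show "N i s \<in> measurable P (count_space UNIV)" using st by (intro N_measurable[OF i]) auto
qed

lemma prob_N_increment:
  assumes i: "i \<in> {1, 2}" and st: "0 \<le> s" "s \<le> t" "t \<le> T"
  shows "prob {\<omega> \<in> space P. N i t \<omega> - N i s \<omega> = k} =
    exp (- (intensity i t - intensity i s)) * (intensity i t - intensity i s) ^ k / fact k"
proof -
  have "{\<omega> \<in> space P. N i t \<omega> - N i s \<omega> = k} = {\<omega> \<in> space P. N i t \<omega> = N i s \<omega> + k}"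
    using N_mono[OF i _ st] by force
  then show ?thesis
    using N_poisson[OF i] st lam_increment[OF i st] by (simp add: poisson_process_def)
qed

lemma N_increment_mean:
  assumes i: "i \<in> {1, 2}" and st: "0 \<le> s" "s \<le> t" "t \<le> T"
  shows "has_bochner_integral P (\<lambda>\<omega>. real (N i t \<omega>) - real (N i s \<omega>)) (intensity i t - intensity i s)"
proof -
  let ?L = "intensity i t - intensity i s" and ?D = "\<lambda>\<omega>. N i t \<omega> - N i s \<omega>"
  have L: "0 \<le> ?L" using intensity_mono[OF i st] by simp
  note Dm = N_increment_measurable[OF i st]
  have set: "{\<omega> \<in> space P. ?D \<omega> = k} \<in> sets P" for k
    using measurable_sets[OF Dm, of "{k}"] by (simp add: vimage_def Int_def conj_commute)
  have "(\<integral>\<^sup>+\<omega>. ennreal (real (?D \<omega>)) \<partial>P) =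
      (\<integral>\<^sup>+\<omega>. (\<Sum>k. ennreal (real k) * indicator {\<omega> \<in> space P. ?D \<omega> = k} \<omega>) \<partial>P)"
  proof (rule nn_integral_cong)
    fix \<omega> assume "\<omega> \<in> space P"
    then show "ennreal (real (?D \<omega>)) = (\<Sum>k. ennreal (real k) * indicator {\<omega> \<in> space P. ?D \<omega> = k} \<omega>)"
      by (intro suminf_cmult_indicator[symmetric]) (auto simp: disjoint_family_on_def)
  qed
  also have "\<dots> = (\<Sum>k. \<integral>\<^sup>+\<omega>. ennreal (real k) * indicator {\<omega> \<in> space P. ?D \<omega> = k} \<omega> \<partial>P)"
    using set by (intro nn_integral_suminf) auto
  also have "\<dots> = (\<Sum>k. ennreal (real k * (exp (- ?L) * ?L ^ k / fact k)))"
    using set L by (intro arg_cong[where f=suminf] ext)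
      (simp only: nn_integral_cmult_indicator emeasure_eq_measure prob_N_increment[OF i st] ennreal_mult'[symmetric] of_nat_0_le_iff)
  also have "\<dots> = ennreal ?L"
    using L by (intro suminf_ennreal_eq poisson_mean_sums) auto
  finally have *: "(\<integral>\<^sup>+\<omega>. ennreal (real (?D \<omega>)) \<partial>P) = ennreal ?L" .
  have eq: "real (?D \<omega>) = real (N i t \<omega>) - real (N i s \<omega>)" if "\<omega> \<in> space P" for \<omega>
    using N_mono[OF i that st] by simp
  have "has_bochner_integral P (\<lambda>\<omega>. real (?D \<omega>)) ?L"
    using measurable_compose[OF Dm, of real] * L by (intro has_bochner_integral_nn_integral) auto
  then show ?thesis by (rule has_bochner_integral_cong[THEN iffD1, rotated -1]) (auto simp: eq)
qed

text \<open>A jump of size two or more inside a cell of a grid forces an increment of at least 2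
  over that cell. For a Poisson variable of mean L this has probability at most L^2, so the sum over
  the cells is at most the largest cell intensity times the total one, and it tends to 0 by uniform
  continuity of \<open>intensity i\<close>. Knowing the jump sizes turns the factors 1 + \<beta>
  \<Delta>N of the exponential into 1 + \<beta>.\<close>

lemma AE_jumps_eq_1:
  assumes i: "i \<in> {1, 2}"
  shows "AE \<omega> in P. \<forall>u\<in>jump_times (N i) T \<omega>. jump (N i) u \<omega> = 1"
proof -
  define big where "big n = (\<Union>k<n. {\<omega> \<in> space P.
    2 \<le> N i (T * (real (Suc k) / real n)) \<omega> - N i (T * (real k / real n)) \<omega>})" for n :: nat
  let ?t = "\<lambda>n k. T * (real k / real n)"
  have t: "0 \<le> ?t n k" "?t n k \<le> ?t n (Suc k)" "?t n (Suc k) \<le> T" if "k < n" for n k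
    using that T_pos mult_left_mono[of "real (Suc k) / real n" 1 T]
    by (auto intro!: mult_left_mono divide_right_mono)
  have set: "{\<omega> \<in> space P. 2 \<le> N i (?t n (Suc k)) \<omega> - N i (?t n k) \<omega>} \<in> sets P" if "k < n" for n k
    using measurable_sets[OF N_increment_measurable[OF i t[OF that]], of "{2..}"]
    by (simp add: vimage_def Int_def conj_commute)
  then have big_sets: "big n \<in> sets P" for n unfolding big_def by auto
  have two: "prob {\<omega> \<in> space P. 2 \<le> N i (?t n (Suc k)) \<omega> - N i (?t n k) \<omega>} \<le>
      (intensity i (?t n (Suc k)) - intensity i (?t n k))\<^sup>2" (is "prob ?A \<le> ?L\<^sup>2") if "k < n" for n k
  proof -
    let ?D = "\<lambda>\<omega>. N i (?t n (Suc k)) \<omega> - N i (?t n k) \<omega>"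
    have sets: "{\<omega> \<in> space P. ?D \<omega> = m} \<in> sets P" for m
      using measurable_sets[OF N_increment_measurable[OF i t[OF that]], of "{m}"]
      by (simp add: vimage_def Int_def conj_commute)
    have split: "?A = space P - ({\<omega> \<in> space P. ?D \<omega> = 0} \<union> {\<omega> \<in> space P. ?D \<omega> = 1})"
      by auto
    have "prob ?A = 1 - prob ({\<omega> \<in> space P. ?D \<omega> = 0} \<union> {\<omega> \<in> space P. ?D \<omega> = 1})"
      unfolding split by (rule prob_compl) (intro sets.Un sets)
    also have "prob ({\<omega> \<in> space P. ?D \<omega> = 0} \<union> {\<omega> \<in> space P. ?D \<omega> = 1}) =
        prob {\<omega> \<in> space P. ?D \<omega> = 0} + prob {\<omega> \<in> space P. ?D \<omega> = 1}"
      by (rule finite_measure_Union[OF sets sets]) auto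
    also have "\<dots> = exp (- ?L) * (1 + ?L)"
      unfolding prob_N_increment[OF i t[OF that]] by (simp add: algebra_simps)
    finally have "prob ?A = 1 - exp (- ?L) * (1 + ?L)" .
    \<comment> \<open>The bound exp (-L) >= 1 - L shows that 1 - exp (-L) (1 + L) is at most
      L^2.\<close>
    moreover have "(1 - ?L) * (1 + ?L) \<le> exp (- ?L) * (1 + ?L)"
      using exp_ge_add_one_self[of "- ?L"] intensity_mono[OF i t[OF that]]
      by (intro mult_right_mono) linarith+
    moreover have "(1 - ?L) * (1 + ?L) = 1 - ?L\<^sup>2" by (simp add: power2_eq_square algebra_simps)
    ultimately show ?thesis by linarith
  qed
  have small: "\<exists>n>0. prob (big n) \<le> e * intensity i T" if e: "0 < e" for e
  proof -
    have "uniformly_continuous_on {0..T} (intensity i)"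
      by (intro compact_uniformly_continuous intensity_continuous i) auto
    then obtain d where d: "0 < d" "\<And>x y. x \<in> {0..T} \<Longrightarrow> y \<in> {0..T} \<Longrightarrow> dist y x < d \<Longrightarrow>
        dist (intensity i y) (intensity i x) < e"
      using e unfolding uniformly_continuous_on_def by metis
    obtain n :: nat where n: "T / d < real n" using reals_Archimedean2 by blast
    then have n0: "0 < n" using T_pos d(1) by (cases n) (auto simp: field_simps)
    have "T / real n < d" using n n0 d(1) by (simp add: field_simps)
    then have step: "intensity i (?t n (Suc k)) - intensity i (?t n k) \<le> e" if "k < n" for k
    proof -
      have "?t n (Suc k) - ?t n k = T / real n" using n0 by (simp add: field_simps)
      then have "dist (?t n (Suc k)) (?t n k) < d"
        using \<open>T / real n < d\<close> T_pos by (simp add: dist_real_def)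
      then have "dist (intensity i (?t n (Suc k))) (intensity i (?t n k)) < e"
        using t[OF that] by (intro d(2)) auto
      then show ?thesis by (simp add: dist_real_def)
    qed
    have "prob (big n) \<le> (\<Sum>k<n. prob {\<omega> \<in> space P. 2 \<le> N i (?t n (Suc k)) \<omega> - N i (?t n k) \<omega>})"
      unfolding big_def using set by (intro finite_measure_subadditive_finite) auto
    also have "\<dots> \<le> (\<Sum>k<n. e * (intensity i (?t n (Suc k)) - intensity i (?t n k)))"
    proof (rule sum_mono)
      fix k assume "k \<in> {..<n}"
      then have k: "k < n" by simp
      show "prob {\<omega> \<in> space P. 2 \<le> N i (?t n (Suc k)) \<omega> - N i (?t n k) \<omega>} \<le>
          e * (intensity i (?t n (Suc k)) - intensity i (?t n k))"
        using two[OF k] mult_right_mono[OF step[OF k], of "intensity i (?t n (Suc k)) - intensity i (?t n k)"]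
          intensity_mono[OF i t[OF k]] unfolding power2_eq_square by linarith
    qed
    also have "\<dots> = e * (intensity i (?t n n) - intensity i (?t n 0))"
      unfolding sum_distrib_left[symmetric] by (subst sum_lessThan_telescope) simp
    also have "\<dots> = e * intensity i T" using n0 by (simp add: intensity_def)
    finally show ?thesis using n0 by auto
  qed
  have bad: "\<omega> \<in> big n" if asm: "0 < n" "\<omega> \<in> space P" "u \<in> jump_times (N i) T \<omega>" "jump (N i) u \<omega> \<noteq> 1" for n \<omega> u
  proof -
    have u: "0 < u" "u \<le> T" "jump (N i) u \<omega> \<noteq> 0" using asm by (auto simp: jump_times_def)
    then obtain m where m: "jump (N i) u \<omega> = real m" using jump_Nats[OF i asm(2)] by (auto elim: Nats_cases)
    have "2 \<le> m" using m u asm(4) by (cases m rule: nat.exhaust; cases "m = 1") auto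
    \<comment> \<open>The cell containing \<open>u\<close>, open on the left and closed on the
      right: \<open>k\<close> is the integer with k < u n / T <= k + 1, so that the jump at
      \<open>u\<close> is counted in the increment over the cell.\<close>
    define k where "k = nat \<lceil>u * real n / T\<rceil> - 1"
    have pos: "0 < u * real n / T" using u asm(1) T_pos by simp
    then have c: "0 < \<lceil>u * real n / T\<rceil>" by simp
    then have k1: "real (Suc k) = real_of_int \<lceil>u * real n / T\<rceil>" by (simp add: k_def)
    have "u * real n / T \<le> real (Suc k)" "real k < u * real n / T"
      using k1 ceiling_correct[of "u * real n / T"] by auto
    then have ku: "?t n k < u" "u \<le> ?t n (Suc k)"
      using T_pos asm(1) by (auto simp: field_simps)
    have "\<lceil>u * real n / T\<rceil> \<le> int n"
      using u T_pos asm(1) by (simp add: ceiling_le_iff field_simps mult_right_mono)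
    then have kn: "k < n" using c unfolding k_def by linarith
    have "real m \<le> real (N i (?t n (Suc k)) \<omega>) - real (N i (?t n k) \<omega>)"
      using jump_le_increment[OF i asm(2) t(1)[OF kn] ku t(3)[OF kn]] m by simp
    then have "2 \<le> N i (?t n (Suc k)) \<omega> - N i (?t n k) \<omega>" using \<open>2 \<le> m\<close> by linarith
    then show ?thesis using kn asm(2) unfolding big_def by blast
  qed
  let ?B = "\<Inter>n\<in>{0<..}. big n"
  have B: "?B \<in> sets P" using big_sets by (intro sets.countable_INT) auto
  have "prob ?B \<le> e * intensity i T" if e: "0 < e" for e
  proof -
    obtain n where "0 < n" "prob (big n) \<le> e * intensity i T" using small[OF e] by blast
    moreover have "prob ?B \<le> prob (big n)" using big_sets \<open>0 < n\<close> by (intro finite_measure_mono) auto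
    ultimately show ?thesis by simp
  qed
  note B_le = this
  have L: "0 \<le> intensity i T"
    using intensity_mono[OF i order_refl _ order_refl] T_pos by (simp add: intensity_def)
  have "prob ?B \<le> 0 + e" if "0 < e" for e
  proof -
    \<comment> \<open>The summand 1 keeps the denominator positive when the total intensity is
      0.\<close>
    have "prob ?B \<le> e / (intensity i T + 1) * intensity i T" using L that by (intro B_le) simp
    also have "\<dots> \<le> e" using L that by (simp add: field_simps)
    finally show ?thesis by simp
  qed
  then have "prob ?B \<le> 0" by (rule field_le_epsilon)
  then have "prob ?B = 0" by (rule antisym[OF _ measure_nonneg])
  then have "?B \<in> null_sets P" using B by (simp add: null_sets_def emeasure_eq_measure)
  then show ?thesis
  proof (rule AE_I')
    show "{\<omega> \<in> space P. \<not> (\<forall>u\<in>jump_times (N i) T \<omega>. jump (N i) u \<omega> = 1)} \<subseteq> ?B"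
      using bad by auto
  qed
qed

text \<open>The pathwise integral of \<open>H\<close> against dN, with values in [0, infinity]. As
  an integral over counting measure it inherits additivity and monotone convergence; the weight
  \<open>jump\<close> makes it equal to an increment of \<open>N\<close> on intervals, whatever the
  jump sizes.\<close>

definition jump_sum :: "nat \<Rightarrow> (real \<times> 'a \<Rightarrow> ennreal) \<Rightarrow> 'a \<Rightarrow> ennreal" where
  "jump_sum i H \<omega> = (\<integral>\<^sup>+s. H (s, \<omega>) * ennreal (jump (N i) s \<omega>) \<partial>count_space (jump_times (N i) T \<omega>))"

definition compensator :: "nat \<Rightarrow> (real \<times> 'a \<Rightarrow> ennreal) \<Rightarrow> ennreal" where
  "compensator i H = (\<integral>\<^sup>+z. H z * ennreal (lam i (fst z)) \<partial>time_space P T)"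

lemma jump_sum_finite:
  assumes "i \<in> {1, 2}" "\<omega> \<in> space P"
  shows "jump_sum i H \<omega> = (\<Sum>s\<in>jump_times (N i) T \<omega>. H (s, \<omega>) * ennreal (jump (N i) s \<omega>))"
  unfolding jump_sum_def by (rule nn_integral_count_space_finite[OF finite_jump_times[OF assms]])

lemma jump_sum_add: "jump_sum i (\<lambda>z. G z + H z) \<omega> = jump_sum i G \<omega> + jump_sum i H \<omega>"
  unfolding jump_sum_def by (subst nn_integral_add[symmetric]) (auto simp: distrib_right)

lemma jump_sum_cmult: "jump_sum i (\<lambda>z. c * H z) \<omega> = c * jump_sum i H \<omega>"
  unfolding jump_sum_def by (subst nn_integral_cmult[symmetric]) (auto simp: mult.assoc)

lemma measurable_predictable_algebra:
  "H \<in> borel_measurable (predictable_algebra P F T) \<Longrightarrow> H \<in> borel_measurable (time_space P T)"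
  by (rule measurable_mono[OF order_refl refl sets_predictable_subset, THEN subsetD])
     (auto simp: space_time_space space_predictable_algebra)

text \<open>Measurability of a sum over random jump times is not evident from its form, so it is
  carried through the induction together with the identity.\<close>

definition compensates :: "nat \<Rightarrow> (real \<times> 'a \<Rightarrow> ennreal) \<Rightarrow> bool" where
  "compensates i H \<longleftrightarrow> jump_sum i H \<in> borel_measurable P \<and> (\<integral>\<^sup>+\<omega>. jump_sum i H \<omega> \<partial>P) = compensator i H"

lemma compensator_add:
  assumes "i \<in> {1, 2}" "G \<in> borel_measurable (predictable_algebra P F T)" "H \<in> borel_measurable (predictable_algebra P F T)"
  shows "compensator i (\<lambda>z. G z + H z) = compensator i G + compensator i H"
proof -
  have [measurable]: "lam i \<in> borel_measurable horizon" "G \<in> borel_measurable (time_space P T)"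
    "H \<in> borel_measurable (time_space P T)"
    using assms lam_horizon_measurable measurable_predictable_algebra by auto
  show ?thesis unfolding compensator_def
    by (subst nn_integral_add[symmetric]) (auto simp: distrib_right)
qed

lemma compensator_rectangle:
  assumes i: "i \<in> {1, 2}" and "I \<in> sets horizon" "A \<in> sets P"
  shows "compensator i (indicator (I \<times> A)) = emeasure P A * (\<integral>\<^sup>+s. indicator I s * ennreal (lam i s) \<partial>horizon)"
proof -
  have [measurable]: "lam i \<in> borel_measurable horizon" "I \<in> sets horizon" "A \<in> sets P"
    using assms lam_horizon_measurable by auto
  have "compensator i (indicator (I \<times> A)) =
      (\<integral>\<^sup>+z. (indicator I (fst z) * ennreal (lam i (fst z))) * indicator A (snd z) \<partial>time_space P T)"
    unfolding compensator_def by (intro nn_integral_cong) (auto simp: indicator_def)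
  also have "\<dots> = (\<integral>\<^sup>+\<omega>. (\<integral>\<^sup>+s. (indicator I s * ennreal (lam i s)) * indicator A \<omega> \<partial>horizon) \<partial>P)"
    by (subst TP.nn_integral_snd[symmetric]) auto
  also have "\<dots> = (\<integral>\<^sup>+\<omega>. (\<integral>\<^sup>+s. indicator I s * ennreal (lam i s) \<partial>horizon) * indicator A \<omega> \<partial>P)"
    by (intro nn_integral_cong nn_integral_multc) auto
  also have "\<dots> = (\<integral>\<^sup>+s. indicator I s * ennreal (lam i s) \<partial>horizon) * emeasure P A"
    by (intro nn_integral_cmult_indicator) auto
  finally show ?thesis by (simp add: mult.commute)
qed

lemma compensator_zero:
  assumes i: "i \<in> {1, 2}" and A: "A \<in> sets P"
  shows "compensator i (indicator ({0} \<times> A)) = 0"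
proof -
  have "AE s in horizon. s \<noteq> 0"
    using AE_lborel_singleton[of "0::real"] by (subst AE_restrict_space_iff) auto
  then have "(\<integral>\<^sup>+s. indicator {0} s * ennreal (lam i s) \<partial>horizon) = (\<integral>\<^sup>+s. 0 \<partial>horizon)"
    by (intro nn_integral_cong_AE) (auto elim!: eventually_mono)
  moreover have "{0::real} \<in> sets horizon" using T_pos by (auto simp: sets_restrict_space_iff)
  ultimately show ?thesis using compensator_rectangle[OF i _ A] by simp
qed

lemma jump_sum_zero: "jump_sum i (indicator ({0} \<times> A)) \<omega> = 0"
  unfolding jump_sum_def
  by (subst nn_integral_cong[of _ _ "\<lambda>_. 0"]) (auto simp: jump_times_def indicator_def)

lemma compensates_zero:
  assumes "i \<in> {1, 2}" "A \<in> sets P"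
  shows "compensates i (indicator ({0} \<times> A))"
  using compensator_zero[OF assms] by (simp add: compensates_def jump_sum_zero cong: measurable_cong)

lemma jump_sum_interval:
  assumes i: "i \<in> {1, 2}" and st: "0 \<le> s" "s \<le> t" "t \<le> T" and \<omega>: "\<omega> \<in> space P"
  shows "jump_sum i (indicator ({s<..t} \<times> A)) \<omega> = ennreal (indicator A \<omega> * (real (N i t \<omega>) - real (N i s \<omega>)))"
proof -
  have "jump_sum i (indicator ({s<..t} \<times> A)) \<omega> =
      (\<Sum>u\<in>jump_times (N i) T \<omega>. indicator A \<omega> * (indicator {s<..t} u * ennreal (jump (N i) u \<omega>)))"
    unfolding jump_sum_finite[OF i \<omega>] by (intro sum.cong) (auto simp: indicator_def)
  also have "\<dots> = indicator A \<omega> * (\<Sum>u\<in>jump_times (N i) T \<omega>. indicator {s<..t} u * ennreal (jump (N i) u \<omega>))"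
    by (rule sum_distrib_left[symmetric])
  also have "(\<Sum>u\<in>jump_times (N i) T \<omega>. indicator {s<..t} u * ennreal (jump (N i) u \<omega>)) =
      (\<Sum>u\<in>{u \<in> {s<..t}. jump (N i) u \<omega> \<noteq> 0}. ennreal (jump (N i) u \<omega>))"
    using st finite_jump_times[OF i \<omega>]
    by (intro sum.mono_neutral_cong_right) (auto simp: jump_times_def indicator_def)
  also have "\<dots> = ennreal (\<Sum>u\<in>{u \<in> {s<..t}. jump (N i) u \<omega> \<noteq> 0}. jump (N i) u \<omega>)"
    using st jump_nonneg[OF i \<omega>] by (intro sum_ennreal) auto
  also have "\<dots> = ennreal (real (N i t \<omega>) - real (N i s \<omega>))"
    using jumps(2)[OF i \<omega> st] by simp
  finally show ?thesis by (cases "\<omega> \<in> A") simp_all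
qed

lemma compensator_interval:
  assumes i: "i \<in> {1, 2}" and st: "0 \<le> s" "s \<le> t" "t \<le> T" and A: "A \<in> sets P"
  shows "compensator i (indicator ({s<..t} \<times> A)) = ennreal (prob A * (intensity i t - intensity i s))"
proof -
  have "{s<..t} \<in> sets horizon" using st by (auto simp: sets_restrict_space_iff)
  then show ?thesis
    using compensator_rectangle[OF i _ A] nn_integral_lam[OF i st]
    by (simp add: emeasure_eq_measure ennreal_mult')
qed

text \<open>The case from which the others are generated: on {s<..t} x A the jump sum is the
  increment of \<open>N\<close> on the event \<open>A\<close>, and \<open>A\<close>, known at time
  \<open>s\<close>, is independent of that increment, whose mean is the increment of the
  intensity.\<close>

lemma compensates_interval:
  assumes i: "i \<in> {1, 2}" and st: "0 \<le> s" "s \<le> t" "t \<le> T" and A: "A \<in> sets (F s)"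
  shows "compensates i (indicator ({s<..t} \<times> A))"
proof -
  have AP: "A \<in> sets P" using A sets_F_subset by blast
  let ?D = "\<lambda>\<omega>. real (N i t \<omega>) - real (N i s \<omega>)"
  have ind: "indep_var borel (indicator A :: 'a \<Rightarrow> real) borel ?D"
    using indep_var_F_increment[of "i + 2" s t "indicator A :: 'a \<Rightarrow> real"] driver_N[OF i] i st A by auto
  have Ai: "integrable P (indicator A :: 'a \<Rightarrow> real)" using AP by (simp add: integrable_indicator_iff less_top[symmetric])
  have I: "integrable P (\<lambda>\<omega>. indicator A \<omega> * ?D \<omega>)"
    "expectation (\<lambda>\<omega>. indicator A \<omega> * ?D \<omega>) = prob A * (intensity i t - intensity i s)"
    using indep_var_lebesgue_integral[OF ind Ai] indep_var_integrable[OF ind Ai]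
      N_increment_mean[OF i st] AP by (simp_all add: has_bochner_integral_iff)
  have "(\<lambda>\<omega>. ennreal (indicator A \<omega> * ?D \<omega>)) \<in> borel_measurable P"
    using borel_measurable_integrable[OF I(1)] by (rule measurable_compose[OF _ measurable_ennreal])
  then have "jump_sum i (indicator ({s<..t} \<times> A)) \<in> borel_measurable P"
    by (rule measurable_cong[THEN iffD1, rotated]) (simp add: jump_sum_interval[OF i st])
  moreover have "(\<integral>\<^sup>+\<omega>. jump_sum i (indicator ({s<..t} \<times> A)) \<omega> \<partial>P) =
      (\<integral>\<^sup>+\<omega>. ennreal (indicator A \<omega> * ?D \<omega>) \<partial>P)"
    by (intro nn_integral_cong) (rule jump_sum_interval[OF i st])
  moreover have "\<dots> = ennreal (prob A * (intensity i t - intensity i s))"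
    unfolding I(2)[symmetric]
    by (intro nn_integral_eq_integral I(1) AE_I2) (simp add: N_mono[OF i _ st])
  ultimately show ?thesis by (simp add: compensates_def compensator_interval[OF i st AP])
qed

text \<open>Two overlapping half-open intervals meet in one that starts at \<open>max s s'\<close>,
  a time at which both base events are known. An empty intersection is the rectangle {0} x
  {}.\<close>

lemma Int_stable_predictable_rectangles: "Int_stable predictable_rectangles"
proof (rule Int_stableI)
  fix a b assume ab: "a \<in> predictable_rectangles" "b \<in> predictable_rectangles"
  have F0: "A \<inter> B \<in> sets (F u)" if "A \<in> sets (F s)" "B \<in> sets (F t)" "s \<le> u" "t \<le> u" for A B s t u
    using that sets_F_mono by blast
  have empty: "{} \<in> predictable_rectangles" by (intro UnI1 CollectI exI[of _ "{}"]) auto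
  have mixed: "({0} \<times> A) \<inter> ({s<..t} \<times> B) = {}" "({s<..t} \<times> B) \<inter> ({0} \<times> A) = {}"
    if "0 \<le> s" for s t :: real and A B :: "'a set" using that by auto
  from ab(1) show "a \<inter> b \<in> predictable_rectangles"
  proof
    assume "a \<in> {{0} \<times> A | A. A \<in> sets (F 0)}"
    then obtain A where a: "a = {0} \<times> A" "A \<in> sets (F 0)" by blast
    from ab(2) show ?thesis
    proof
      assume "b \<in> {{0} \<times> A | A. A \<in> sets (F 0)}"
      then obtain B where "b = {0} \<times> B" "B \<in> sets (F 0)" by blast
      then show ?thesis using a by (intro UnI1 CollectI exI[of _ "A \<inter> B"]) auto
    next
      assume "b \<in> {{s<..t} \<times> A | s t A. 0 \<le> s \<and> s \<le> t \<and> t \<le> T \<and> A \<in> sets (F s)}"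
      then obtain s t B where "b = {s<..t} \<times> B" "0 \<le> s" by blast
      then show ?thesis using a mixed empty by simp
    qed
  next
    assume "a \<in> {{s<..t} \<times> A | s t A. 0 \<le> s \<and> s \<le> t \<and> t \<le> T \<and> A \<in> sets (F s)}"
    then obtain s t A where a: "a = {s<..t} \<times> A" "0 \<le> s" "s \<le> t" "t \<le> T" "A \<in> sets (F s)" by blast
    from ab(2) show ?thesis
    proof
      assume "b \<in> {{0} \<times> A | A. A \<in> sets (F 0)}"
      then obtain B where "b = {0} \<times> B" by blast
      then show ?thesis using a mixed empty by simp
    next
      assume "b \<in> {{s<..t} \<times> A | s t A. 0 \<le> s \<and> s \<le> t \<and> t \<le> T \<and> A \<in> sets (F s)}"
      then obtain s' t' B where b: "b = {s'<..t'} \<times> B" "0 \<le> s'" "s' \<le> t'" "t' \<le> T" "B \<in> sets (F s')"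
        by blast
      show ?thesis
      proof (cases "max s s' \<le> min t t'")
        case True
        then show ?thesis unfolding a(1) b(1) Times_Int_Times Int_greaterThanAtMost
          using a(2,4) F0[OF a(5) b(5), of "max s s'"]
          by (intro UnI2 CollectI exI[of _ "max s s'"] exI[of _ "min t t'"] exI[of _ "A \<inter> B"]) auto
      next
        case False
        then have "a \<inter> b = {}" unfolding a(1) b(1) by auto
        then show ?thesis using empty by simp
      qed
    qed
  qed
qed

text \<open>The whole space is singled out because complements are treated by subtraction from it,
  which is legitimate in [0, infinity] only below a finite total.\<close>

lemma compensates_space:
  assumes i: "i \<in> {1, 2}"
  shows "compensates i (indicator ({0..T} \<times> space P))"
    and "compensator i (indicator ({0..T} \<times> space P)) < \<infinity>"
    and "\<And>\<omega>. \<omega> \<in> space P \<Longrightarrow> jump_sum i (indicator ({0..T} \<times> space P)) \<omega> < \<infinity>"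
proof -
  let ?a = "indicator ({0} \<times> space P) :: real \<times> 'a \<Rightarrow> ennreal"
  let ?b = "indicator ({0<..T} \<times> space P) :: real \<times> 'a \<Rightarrow> ennreal"
  have T0: "0 \<le> T" using T_pos by simp
  have top: "space P \<in> sets (F 0)" using sets.top[of "F 0"] by simp
  have "{0} \<times> space P \<in> predictable_rectangles" "{0<..T} \<times> space P \<in> predictable_rectangles"
    using top T0 by blast+
  then have m: "?a \<in> borel_measurable (predictable_algebra P F T)" "?b \<in> borel_measurable (predictable_algebra P F T)"
    by (auto simp: sets_predictable_algebra intro!: borel_measurable_indicator sigma_sets.Basic)
  have eq: "(indicator ({0..T} \<times> space P) :: real \<times> 'a \<Rightarrow> ennreal) = (\<lambda>z. ?a z + ?b z)"
    using T_pos by (auto simp: indicator_def)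
  have a: "compensates i ?a" by (rule compensates_zero[OF i sets.top])
  have b: "compensates i ?b" by (rule compensates_interval[OF i order_refl T0 order_refl top])
  show "compensates i (indicator ({0..T} \<times> space P))"
    using a b unfolding compensates_def eq compensator_add[OF i m] jump_sum_add[abs_def]
    by (auto simp: nn_integral_add)
  show fin: "jump_sum i (indicator ({0..T} \<times> space P)) \<omega> < \<infinity>" if "\<omega> \<in> space P" for \<omega>
    unfolding eq jump_sum_add jump_sum_zero jump_sum_interval[OF i order_refl T0 order_refl that] by simp
  show "compensator i (indicator ({0..T} \<times> space P)) < \<infinity>"
    unfolding eq compensator_add[OF i m] compensator_zero[OF i sets.top]
      compensator_interval[OF i order_refl T0 order_refl sets.top] by simp
qed

text \<open>Dynkin's argument from the predictable rectangles to all predictable sets. For a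
  complement, measurability comes from pathwise subtraction, and the identity from cancelling the
  finite compensator of the set.\<close>

lemma compensates_indicator:
  assumes i: "i \<in> {1, 2}" and B: "B \<in> sets (predictable_algebra P F T)"
  shows "compensates i (indicator B)"
  using Int_stable_predictable_rectangles predictable_rectangles_into_space B[unfolded sets_predictable_algebra]
proof (induction rule: sigma_sets_induct_disjoint)
  case (basic A)
  then show ?case
  proof
    assume "A \<in> {{0} \<times> A | A. A \<in> sets (F 0)}"
    then show ?thesis using compensates_zero[OF i] sets_F_subset by blast
  next
    assume "A \<in> {{s<..t} \<times> A | s t A. 0 \<le> s \<and> s \<le> t \<and> t \<le> T \<and> A \<in> sets (F s)}"
    then show ?thesis using compensates_interval[OF i] by blast
  qed
next
  case empty
  then show ?case by (simp add: compensates_def jump_sum_def[abs_def] compensator_def)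
next
  case (compl A)
  let ?\<Omega> = "{0..T} \<times> space P"
  have A: "A \<in> sets (predictable_algebra P F T)" using compl by (simp add: sets_predictable_algebra)
  have Ac: "?\<Omega> - A \<in> sets (predictable_algebra P F T)"
    using A sets.compl_sets[of A "predictable_algebra P F T"] by (simp add: space_predictable_algebra)
  have "A \<subseteq> ?\<Omega>" using sets.sets_into_space[OF A] by (simp add: space_predictable_algebra)
  then have eq: "(indicator ?\<Omega> :: real \<times> 'a \<Rightarrow> ennreal) = (\<lambda>z. indicator A z + indicator (?\<Omega> - A) z)"
    by (auto simp: indicator_def fun_eq_iff)
  have K: "jump_sum i (indicator ?\<Omega>) \<omega> = jump_sum i (indicator A) \<omega> + jump_sum i (indicator (?\<Omega> - A)) \<omega>" for \<omega>
    unfolding eq by (rule jump_sum_add)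
  have C: "compensator i (indicator ?\<Omega>) = compensator i (indicator A) + compensator i (indicator (?\<Omega> - A))"
    unfolding eq using A Ac by (intro compensator_add[OF i]) auto
  have meas: "jump_sum i (indicator A) \<in> borel_measurable P" "jump_sum i (indicator ?\<Omega>) \<in> borel_measurable P"
    using compl(2) compensates_space(1)[OF i] by (auto simp: compensates_def)
  have "jump_sum i (indicator (?\<Omega> - A)) \<omega> = jump_sum i (indicator ?\<Omega>) \<omega> - jump_sum i (indicator A) \<omega>"
    if "\<omega> \<in> space P" for \<omega>
    using compensates_space(3)[OF i that] unfolding K by (subst ennreal_add_diff_cancel_left) auto
  then have mc: "jump_sum i (indicator (?\<Omega> - A)) \<in> borel_measurable P"
    using borel_measurable_minus_ennreal[OF meas(2,1)] by (subst measurable_cong) auto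
  have "compensator i (indicator A) + (\<integral>\<^sup>+\<omega>. jump_sum i (indicator (?\<Omega> - A)) \<omega> \<partial>P) =
      (\<integral>\<^sup>+\<omega>. jump_sum i (indicator ?\<Omega>) \<omega> \<partial>P)"
    unfolding K using compl(2) meas(1) mc by (subst nn_integral_add) (auto simp: compensates_def)
  also have "\<dots> = compensator i (indicator A) + compensator i (indicator (?\<Omega> - A))"
    using compensates_space(1)[OF i] C by (simp add: compensates_def)
  finally have "(\<integral>\<^sup>+\<omega>. jump_sum i (indicator (?\<Omega> - A)) \<omega> \<partial>P) = compensator i (indicator (?\<Omega> - A))"
    using compensates_space(2)[OF i] C by (auto simp: ennreal_add_left_cancel)
  then show ?case using mc by (simp add: compensates_def)
next
  case (union A)
  have A: "A n \<in> sets (predictable_algebra P F T)" for n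
    using union(2) by (auto simp: sets_predictable_algebra)
  have eq: "(indicator (\<Union>n. A n) :: real \<times> 'a \<Rightarrow> ennreal) = (\<lambda>z. \<Sum>n. indicator (A n) z)"
    using suminf_indicator[OF union(1)] by auto
  have K: "jump_sum i (indicator (\<Union>n. A n)) = (\<lambda>\<omega>. \<Sum>n. jump_sum i (indicator (A n)) \<omega>)"
    unfolding eq jump_sum_def by (subst nn_integral_suminf[symmetric]) (auto simp: ennreal_suminf_multc)
  have [measurable]: "lam i \<in> borel_measurable horizon" "A n \<in> sets (time_space P T)" for n
    using lam_horizon_measurable[OF i] A sets_predictable_subset by auto
  have C: "compensator i (indicator (\<Union>n. A n)) = (\<Sum>n. compensator i (indicator (A n)))"
    unfolding eq compensator_def by (subst nn_integral_suminf[symmetric]) (auto simp: ennreal_suminf_multc)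
  have [measurable]: "jump_sum i (indicator (A n)) \<in> borel_measurable P" for n
    using union(3) by (simp add: compensates_def)
  show ?case
    using union(3) unfolding compensates_def K C by (simp add: nn_integral_suminf)
qed

text \<open>Both sides take values in [0, infinity]. This generality matters for the jump costs:
  they are unbounded near b = -1 and are not controlled by the square integrability in
  \<open>Gamma\<close>.\<close>

lemma compensation_formula:
  assumes i: "i \<in> {1, 2}" and H: "H \<in> borel_measurable (predictable_algebra P F T)"
  shows "compensates i H"
  using H
proof (induction rule: borel_measurable_induct)
  case (cong f g)
  have "jump_sum i f \<omega> = jump_sum i g \<omega>" if "\<omega> \<in> space P" for \<omega>
    unfolding jump_sum_def using cong(3) that
    by (intro nn_integral_cong) (auto simp: space_predictable_algebra jump_times_def)
  moreover have "compensator i f = compensator i g"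
    unfolding compensator_def using cong(3)
    by (intro nn_integral_cong) (auto simp: space_predictable_algebra space_time_space)
  ultimately show ?case
    using cong(4) unfolding compensates_def
    by (simp cong: measurable_cong nn_integral_cong)
next
  case (set A)
  then show ?case by (rule compensates_indicator[OF i])
next
  case (mult u c)
  have [measurable]: "lam i \<in> borel_measurable horizon" "u \<in> borel_measurable (time_space P T)"
    using lam_horizon_measurable[OF i] measurable_predictable_algebra[OF mult(2)] by auto
  have "compensator i (\<lambda>z. c * u z) = c * compensator i u"
    unfolding compensator_def by (subst nn_integral_cmult[symmetric]) (auto simp: mult.assoc)
  then show ?case
    using mult(4) unfolding compensates_def jump_sum_cmult[abs_def]
    by (auto simp: nn_integral_cmult)
next
  case (add u v)
  then show ?case
    unfolding compensates_def jump_sum_add[abs_def] compensator_add[OF i add(3) add(1)]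
    by (auto simp: nn_integral_add)
next
  case (seq U)
  have [measurable]: "lam i \<in> borel_measurable horizon" "U n \<in> borel_measurable (time_space P T)" for n
    using lam_horizon_measurable[OF i] measurable_predictable_algebra[OF seq(1)] by auto
  have le: "U m z \<le> U n z" if "m \<le> n" for m n z
    by (rule le_funD[OF incseqD[OF seq(3) that]])
  have inc': "incseq (\<lambda>n s. U n (s, \<omega>) * ennreal (jump (N i) s \<omega>))" for \<omega>
    unfolding incseq_def le_fun_def by (intro allI impI mult_right_mono le) simp_all
  have inc'': "incseq (\<lambda>n z. U n z * ennreal (lam i (fst z)))"
    unfolding incseq_def le_fun_def by (intro allI impI mult_right_mono le) simp_all
  have K: "jump_sum i (SUP n. U n) = (\<lambda>\<omega>. SUP n. jump_sum i (U n) \<omega>)"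
    unfolding jump_sum_def
    by (subst nn_integral_monotone_convergence_SUP[symmetric, OF inc']) (auto simp: SUP_mult_right_ennreal image_comp)
  have C: "compensator i (SUP n. U n) = (SUP n. compensator i (U n))"
    unfolding compensator_def
    by (subst nn_integral_monotone_convergence_SUP[symmetric, OF inc'']) (auto simp: SUP_mult_right_ennreal image_comp)
  have incK: "incseq (\<lambda>n. jump_sum i (U n))"
    unfolding incseq_def le_fun_def jump_sum_def by (intro allI impI nn_integral_mono mult_right_mono le) simp_all
  have [measurable]: "jump_sum i (U n) \<in> borel_measurable P" for n
    using seq(5) by (simp add: compensates_def)
  show ?case
    using seq(5) incK unfolding compensates_def K C
    by (simp add: nn_integral_monotone_convergence_SUP image_comp)
qed

lemma predictable_ennreal:
  assumes "predictable P F T H" "f \<in> borel_measurable borel"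
  shows "(\<lambda>z. ennreal (f (H (fst z) (snd z)))) \<in> borel_measurable (predictable_algebra P F T)"
  using measurable_compose[OF measurable_compose[OF assms[unfolded predictable_def]] measurable_ennreal]
  by (simp add: case_prod_beta')

lemma jump_sum_real:
  assumes i: "i \<in> {1, 2}" and \<omega>: "\<omega> \<in> space P" and h: "\<And>z. 0 \<le> h z"
  shows "jump_sum i (\<lambda>z. ennreal (h z)) \<omega> = ennreal (\<Sum>s\<in>jump_times (N i) T \<omega>. h (s, \<omega>) * jump (N i) s \<omega>)"
proof -
  have "jump_sum i (\<lambda>z. ennreal (h z)) \<omega> = (\<Sum>s\<in>jump_times (N i) T \<omega>. ennreal (h (s, \<omega>) * jump (N i) s \<omega>))"
    unfolding jump_sum_finite[OF i \<omega>] using h by (intro sum.cong) (auto simp: ennreal_mult')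
  also have "\<dots> = ennreal (\<Sum>s\<in>jump_times (N i) T \<omega>. h (s, \<omega>) * jump (N i) s \<omega>)"
    using h jump_nonneg[OF i \<omega>] by (intro sum_ennreal mult_nonneg_nonneg) (auto simp: jump_times_def)
  finally show ?thesis .
qed

text \<open>A real-valued form of the formula. The outer function \<open>f\<close> is a parameter
  because it will be the positive part, the negative part, the absolute value and the cost of a
  jump.\<close>

lemma jump_sum_nonneg_process:
  assumes i: "i \<in> {1, 2}" and H: "predictable P F T H" "f \<in> borel_measurable borel" and f: "\<And>x. 0 \<le> f x"
  shows "(\<lambda>\<omega>. \<Sum>s\<in>jump_times (N i) T \<omega>. f (H s \<omega>) * jump (N i) s \<omega>) \<in> borel_measurable P" (is "?S \<in> _")
    and "(\<integral>\<^sup>+\<omega>. ennreal (\<Sum>s\<in>jump_times (N i) T \<omega>. f (H s \<omega>) * jump (N i) s \<omega>) \<partial>P) =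
      (\<integral>\<^sup>+z. ennreal (f (H (fst z) (snd z))) * ennreal (lam i (fst z)) \<partial>time_space P T)"
proof -
  let ?H = "\<lambda>z. ennreal (f (H (fst z) (snd z)))"
  have c: "jump_sum i ?H \<in> borel_measurable P" "(\<integral>\<^sup>+\<omega>. jump_sum i ?H \<omega> \<partial>P) = compensator i ?H"
    using compensation_formula[OF i predictable_ennreal[OF H]] by (auto simp: compensates_def)
  have eq: "jump_sum i ?H \<omega> = ennreal (?S \<omega>)" if "\<omega> \<in> space P" for \<omega>
    using jump_sum_real[OF i that, of "\<lambda>z. f (H (fst z) (snd z))"] f by simp
  have nn: "0 \<le> ?S \<omega>" if "\<omega> \<in> space P" for \<omega>
    using f jump_nonneg[OF i that] by (intro sum_nonneg mult_nonneg_nonneg) (auto simp: jump_times_def)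
  have "(\<lambda>\<omega>. enn2real (jump_sum i ?H \<omega>)) \<in> borel_measurable P"
    using c(1) by (rule borel_measurable_enn2real)
  then show "?S \<in> borel_measurable P"
    by (rule measurable_cong[THEN iffD1, rotated]) (simp add: eq nn)
  show "(\<integral>\<^sup>+\<omega>. ennreal (?S \<omega>) \<partial>P) =
      (\<integral>\<^sup>+z. ennreal (f (H (fst z) (snd z))) * ennreal (lam i (fst z)) \<partial>time_space P T)"
    using c(2) unfolding compensator_def by (simp add: eq cong: nn_integral_cong)
qed

text \<open>The sum over the jumps and the drift have the same mean. The compensation formula is
  applied separately to the positive and the negative part of \<open>H\<close>, both finite by the
  assumption on |H|, and Fubini's theorem evaluates the mean of the drift.\<close>

lemma M_integral_mean:
  assumes i: "i \<in> {1, 2}" and H: "predictable P F T H"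
    and fin: "(\<integral>\<^sup>+z. ennreal \<bar>H (fst z) (snd z)\<bar> * ennreal (lam i (fst z)) \<partial>time_space P T) < \<infinity>"
  shows "has_bochner_integral P (M_integral (lam i) (N i) H T) 0"
proof -
  let ?H = "\<lambda>z. H (fst z) (snd z)" and ?l = "\<lambda>z. lam i (fst z)"
  let ?S = "\<lambda>f \<omega>. \<Sum>s\<in>jump_times (N i) T \<omega>. f (H s \<omega>) * jump (N i) s \<omega>"
  have [measurable]: "?H \<in> borel_measurable (time_space P T)"
    using predictable_measurable[OF H] by (simp add: case_prod_beta')
  have [measurable]: "lam i \<in> borel_measurable horizon" by (rule lam_horizon_measurable[OF i])
  have l: "0 \<le> ?l z" if "z \<in> space (time_space P T)" for z
    using that lam_nonneg[OF i] by (auto simp: space_time_space)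
  have part: "has_bochner_integral P (?S f) (\<integral>z. f (?H z) * ?l z \<partial>time_space P T)"
    and parti: "integrable (time_space P T) (\<lambda>z. f (?H z) * ?l z)"
    if f: "f \<in> borel_measurable borel" "\<And>x. 0 \<le> f x" "\<And>x. f x \<le> \<bar>x\<bar>" for f :: "real \<Rightarrow> real"
  proof -
    note [measurable] = f(1)
    have eq: "(\<integral>\<^sup>+z. ennreal (f (?H z)) * ennreal (?l z) \<partial>time_space P T) =
        (\<integral>\<^sup>+z. ennreal (f (?H z) * ?l z) \<partial>time_space P T)"
      using f(2) l by (intro nn_integral_cong) (simp add: ennreal_mult)
    have "(\<integral>\<^sup>+z. ennreal (f (?H z)) * ennreal (?l z) \<partial>time_space P T) \<le>
        (\<integral>\<^sup>+z. ennreal \<bar>?H z\<bar> * ennreal (?l z) \<partial>time_space P T)"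
      using f(3) by (intro nn_integral_mono mult_right_mono ennreal_leI) auto
    then have fin': "(\<integral>\<^sup>+z. ennreal (f (?H z) * ?l z) \<partial>time_space P T) < \<infinity>"
      using fin unfolding eq by (rule le_less_trans)
    have nn: "AE z in time_space P T. 0 \<le> f (?H z) * ?l z"
      using f(2) l by (intro AE_I2) auto
    show int: "integrable (time_space P T) (\<lambda>z. f (?H z) * ?l z)"
      using fin' nn by (intro integrableI_nonneg) auto
    have "(\<integral>\<^sup>+\<omega>. ennreal (?S f \<omega>) \<partial>P) = ennreal (\<integral>z. f (?H z) * ?l z \<partial>time_space P T)"
      unfolding jump_sum_nonneg_process(2)[OF i H f(1,2)] eq by (rule nn_integral_eq_integral[OF int nn])
    moreover have "0 \<le> ?S f \<omega>" if "\<omega> \<in> space P" for \<omega>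
      using f(2) jump_nonneg[OF i that] by (intro sum_nonneg mult_nonneg_nonneg) (auto simp: jump_times_def)
    moreover have "0 \<le> (\<integral>z. f (?H z) * ?l z \<partial>time_space P T)" by (rule integral_nonneg_AE[OF nn])
    ultimately show "has_bochner_integral P (?S f) (\<integral>z. f (?H z) * ?l z \<partial>time_space P T)"
      by (intro has_bochner_integral_nn_integral jump_sum_nonneg_process(1)[OF i H f(1,2)] AE_I2) auto
  qed
  let ?p = "\<lambda>x::real. max 0 x" and ?n = "\<lambda>x::real. max 0 (- x)"
  note p = part[of ?p] parti[of ?p] and n = part[of ?n] parti[of ?n]
  have split: "?H z * ?l z = ?p (?H z) * ?l z - ?n (?H z) * ?l z" for z
    by (simp add: left_diff_distrib[symmetric] max_def)
  have Hl: "integrable (time_space P T) (\<lambda>z. ?H z * ?l z)"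
    unfolding split using p(2) n(2) by (intro Bochner_Integration.integrable_diff) auto
  have "has_bochner_integral P (\<lambda>\<omega>. ?S ?p \<omega> - ?S ?n \<omega>)
      ((\<integral>z. ?p (?H z) * ?l z \<partial>time_space P T) - (\<integral>z. ?n (?H z) * ?l z \<partial>time_space P T))"
    using p(1) n(1) by (intro has_bochner_integral_diff) auto
  moreover have "(\<lambda>\<omega>. ?S ?p \<omega> - ?S ?n \<omega>) = (\<lambda>\<omega>. \<Sum>s\<in>jump_times (N i) T \<omega>. H s \<omega> * jump (N i) s \<omega>)"
    unfolding sum_subtractf[symmetric] by (intro ext sum.cong) (auto simp: max_def)
  moreover have "(\<integral>z. ?p (?H z) * ?l z \<partial>time_space P T) - (\<integral>z. ?n (?H z) * ?l z \<partial>time_space P T) =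
      (\<integral>z. ?H z * ?l z \<partial>time_space P T)"
    unfolding split using p(2) n(2) by (intro Bochner_Integration.integral_diff[symmetric]) auto
  ultimately have 1: "has_bochner_integral P (\<lambda>\<omega>. \<Sum>s\<in>jump_times (N i) T \<omega>. H s \<omega> * jump (N i) s \<omega>)
      (\<integral>z. ?H z * ?l z \<partial>time_space P T)" by simp
  have Hl': "integrable (time_space P T) (\<lambda>(s, \<omega>). H s \<omega> * lam i s)"
    using Hl by (simp add: case_prod_beta')
  have 2: "has_bochner_integral P (\<lambda>\<omega>. \<integral>s. H s \<omega> * lam i s \<partial>horizon) (\<integral>z. ?H z * ?l z \<partial>time_space P T)"
    using TP.integrable_snd[OF Hl'] TP.integral_snd[OF Hl']
    by (simp add: has_bochner_integral_iff case_prod_beta')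
  have "(LBINT s:{0..T}. H s \<omega> * lam i s) = (\<integral>s. H s \<omega> * lam i s \<partial>horizon)" for \<omega>
    unfolding set_lebesgue_integral_def by (rule integral_restrict_space[symmetric]) simp
  then show ?thesis
    using has_bochner_integral_diff[OF 1 2] unfolding M_integral_def[abs_def] by simp
qed

end

section \<open>Relative entropy\<close>

text \<open>On (-1, infinity) the maximum is attained by its second argument. The truncation at 0
  extends nonnegativity to all reals, so that the compensation formula applies without restricting
  the argument.\<close>

definition jump_cost :: "real \<Rightarrow> real" where
  "jump_cost b = max 0 (b - ln (1 + b))"

lemma jump_cost_eq: "-1 < b \<Longrightarrow> jump_cost b = b - ln (1 + b)"
  using ln_add_one_self_le_self2[of b] by (simp add: jump_cost_def)

lemma jump_cost_nonneg: "0 \<le> jump_cost b"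
  by (simp add: jump_cost_def)

lemma jump_cost_measurable [measurable]: "jump_cost \<in> borel_measurable borel"
  unfolding jump_cost_def[abs_def] by measurable

lemma jump_cost_eq_0_iff: "-1 < b \<Longrightarrow> jump_cost b = 0 \<longleftrightarrow> b = 0"
  using ln_eq_minus_one[of "1 + b"] by (auto simp: jump_cost_eq)

text \<open>The remainder of the tangent at \<open>c\<close>, whose slope is h'(c) = c / (1 + c), is
  again a jump cost, taken at the relative deviation of 1 + b from 1 + c, because ln (1 + b) - ln (1
  + c) = ln (1 + (b - c) / (1 + c)). Strict convexity thus reduces to the sign of
  \<open>jump_cost\<close> and its only zero.\<close>

lemma jump_cost_tangent:
  assumes "-1 < b" "-1 < c"
  shows "jump_cost b = jump_cost c + c / (1 + c) * (b - c) + jump_cost ((b - c) / (1 + c))"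
    and "-1 < (b - c) / (1 + c)"
proof -
  show u: "-1 < (b - c) / (1 + c)" using assms by (simp add: field_simps)
  have "1 + (b - c) / (1 + c) = (1 + b) / (1 + c)" using assms by (simp add: field_simps)
  moreover have "(b - c) / (1 + c) + c / (1 + c) * (b - c) = b - c"
    using assms by (simp add: divide_simps) (simp add: algebra_simps)
  ultimately show "jump_cost b = jump_cost c + c / (1 + c) * (b - c) + jump_cost ((b - c) / (1 + c))"
    using assms u by (simp add: jump_cost_eq ln_div)
qed

text \<open>The first order condition: the gradient of the cost at the minimizer \<open>(c1, c3)\<close> is a multiple
  of the gradient \<open>(a1, l * a3)\<close> of the drift constraint, hence orthogonal to admissible variations.
  If \<open>a1 = 0\<close>, uniqueness of the solution \<open>c3\<close> excludes the degenerate case \<open>l * a3 = 0\<close>.\<close>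

lemma cost_stationary:
  fixes l s a1 a3 d b1 b3 c1 c3 :: real
  assumes s: "s \<noteq> 0" and b: "- d + b1 * a1 * s + l * b3 * a3 * s = 0"
    and c: "- d + c1 * a1 * s + l * c3 * a3 * s = 0"
    and c1: "c1 = (if a1 \<noteq> 0 then (d - l * a3 * s * c3) / (s * a1) else 0)"
    and c3: "\<And>z. z > -1 \<and> l * s * a3\<^sup>2 * z + a1\<^sup>2 * s * (z / (1 + z)) - a3 * d = 0 \<longleftrightarrow> z = c3"
  shows "c1 * (b1 - c1) + l * (c3 / (1 + c3) * (b3 - c3)) = 0"
proof -
  have "s * ((b1 - c1) * a1 + l * a3 * (b3 - c3)) = 0" using b c by (simp add: algebra_simps)
  then have diff: "(b1 - c1) * a1 + l * a3 * (b3 - c3) = 0" using s by simp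
  show ?thesis
  proof (cases "a1 = 0")
    case False
    define w where "w = c3 / (1 + c3)"
    have e: "l * s * a3\<^sup>2 * c3 + a1\<^sup>2 * s * w - a3 * d = 0" using c3[of c3] by (simp add: w_def)
    have d: "d = c1 * s * a1 + l * a3 * s * c3" using c1 False s by simp
    \<comment> \<open>After \<open>d\<close> is eliminated, the terms in \<open>l\<close> cancel and
      the equation for \<open>c3\<close> becomes the proportionality a1 * w = a3 * c1, where
      \<open>w\<close> is the derivative of the jump cost at \<open>c3\<close>.\<close>
    have "a1 * s * (a1 * w) = a1 * s * (a3 * c1)"
      using e unfolding d by (simp add: algebra_simps power2_eq_square)
    then have w: "a1 * w = a3 * c1" using False s by simp
    have "a1 * (c1 * (b1 - c1) + l * (w * (b3 - c3))) = c1 * ((b1 - c1) * a1) + l * (b3 - c3) * (a1 * w)"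
      by (simp add: algebra_simps)
    also have "\<dots> = c1 * ((b1 - c1) * a1 + l * a3 * (b3 - c3))" unfolding w by (simp add: algebra_simps)
    finally show ?thesis using diff False by (simp add: w_def)
  next
    case True
    \<comment> \<open>The witness against degeneracy is \<open>c3 + 1\<close>: with
      \<open>a1 = 0\<close> and \<open>l * a3 = 0\<close> the equation no longer contains the
      unknown, so every point of (-1, infinity) would be a solution along with
      \<open>c3\<close>.\<close>
    have "c3 + 1 > -1" using c3[of c3] by simp
    moreover have "-1 < c3" using c3[of c3] by blast
    ultimately have "l * a3 \<noteq> 0" if "a3 * d = 0"
      using c3[of "c3 + 1"] that True by (auto simp: power2_eq_square)
    moreover have "a3 * d = 0" if "l * a3 = 0"
      using c3[of c3] that True by (auto simp: power2_eq_square)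
    ultimately have "l * a3 \<noteq> 0" by blast
    then have "b3 = c3" using diff True by simp
    then show ?thesis using c1 True by simp
  qed
qed

text \<open>The excess over the minimum is computed exactly, as squares plus weighted jump costs,
  the first-order terms cancelling by \<open>cost_stationary\<close>. Equality makes each summand
  vanish. The jump components are compared after multiplication by the intensity: where it is 0,
  their values change neither the cost nor the measure.\<close>

lemma cost_minimal:
  fixes l l2 s a1 a3 d b1 b2 b3 b4 c1 c3 :: real
  assumes s: "s \<noteq> 0" and b: "- d + b1 * a1 * s + l * b3 * a3 * s = 0"
    and c: "- d + c1 * a1 * s + l * c3 * a3 * s = 0"
    and c1: "c1 = (if a1 \<noteq> 0 then (d - l * a3 * s * c3) / (s * a1) else 0)"
    and c3: "\<And>z. z > -1 \<and> l * s * a3\<^sup>2 * z + a1\<^sup>2 * s * (z / (1 + z)) - a3 * d = 0 \<longleftrightarrow> z = c3"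
    and l: "0 \<le> l" "0 \<le> l2" and b34: "-1 < b3" "-1 < b4"
  defines "B \<equiv> b1\<^sup>2 / 2 + b2\<^sup>2 / 2 + l * jump_cost b3 + l2 * jump_cost b4"
    and "C \<equiv> c1\<^sup>2 / 2 + l * jump_cost c3"
  shows "C \<le> B" and "B = C \<Longrightarrow> b1 = c1 \<and> b2 = 0 \<and> l * b3 = l * c3 \<and> l2 * b4 = 0"
proof -
  have c3': "-1 < c3" using c3[of c3] by blast
  let ?u = "(b3 - c3) / (1 + c3)"
  note tangent = jump_cost_tangent[OF b34(1) c3']
  have eq: "B = C + ((b1 - c1)\<^sup>2 / 2 + b2\<^sup>2 / 2 + l * jump_cost ?u + l2 * jump_cost b4)"
  proof -
    have "b1\<^sup>2 / 2 = c1\<^sup>2 / 2 + (b1 - c1)\<^sup>2 / 2 + c1 * (b1 - c1)"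
      by (simp add: power2_eq_square field_simps)
    moreover have "l * jump_cost b3 = l * jump_cost c3 + l * (c3 / (1 + c3) * (b3 - c3)) + l * jump_cost ?u"
      unfolding tangent(1) distrib_left ..
    ultimately show ?thesis using cost_stationary[OF s b c c1 c3] unfolding B_def C_def by linarith
  qed
  have nn: "0 \<le> (b1 - c1)\<^sup>2 / 2" "0 \<le> b2\<^sup>2 / 2" "0 \<le> l * jump_cost ?u" "0 \<le> l2 * jump_cost b4"
    using l jump_cost_nonneg by auto
  show "C \<le> B" using nn unfolding eq by linarith
  assume "B = C"
  then have "(b1 - c1)\<^sup>2 / 2 = 0" "b2\<^sup>2 / 2 = 0" "l * jump_cost ?u = 0" "l2 * jump_cost b4 = 0"
    using nn unfolding eq by linarith+
  then show "b1 = c1 \<and> b2 = 0 \<and> l * b3 = l * c3 \<and> l2 * b4 = 0"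
    using tangent(2) b34 c3' jump_cost_eq_0_iff[of ?u] jump_cost_eq_0_iff[of b4] by auto
qed

lemma ereal_expectation_add_centered:
  assumes X: "has_bochner_integral M X 0" and V[measurable]: "V \<in> borel_measurable M"
    and nn: "\<And>x. x \<in> space M \<Longrightarrow> 0 \<le> V x"
  shows "ereal_expectation M (\<lambda>x. X x + V x) = enn2ereal (\<integral>\<^sup>+x. ennreal (V x) \<partial>M)"
proof -
  have Xi: "integrable M X" and X0: "integral\<^sup>L M X = 0" using X by (auto simp: has_bochner_integral_iff)
  have [measurable]: "X \<in> borel_measurable M" using Xi by auto
  have Xfin: "(\<integral>\<^sup>+x. ennreal \<bar>X x\<bar> \<partial>M) < \<infinity>" using Xi by (simp add: integrable_iff_bounded)
  show ?thesis
  proof (cases "(\<integral>\<^sup>+x. ennreal (V x) \<partial>M) < \<infinity>")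
    case True
    then have Vi: "integrable M V" using nn by (intro integrableI_nonneg AE_I2) auto
    have i: "integrable M (\<lambda>x. X x + V x)" using Xi Vi by simp
    have fin: "(\<integral>\<^sup>+x. ennreal (X x + V x) \<partial>M) \<noteq> \<infinity>" "(\<integral>\<^sup>+x. ennreal (- (X x + V x)) \<partial>M) \<noteq> \<infinity>"
      using i unfolding real_integrable_def by auto
    have "integral\<^sup>L M V = integral\<^sup>L M (\<lambda>x. X x + V x)" using Xi Vi X0 by simp
    also have "\<dots> = enn2real (\<integral>\<^sup>+x. ennreal (X x + V x) \<partial>M) - enn2real (\<integral>\<^sup>+x. ennreal (- (X x + V x)) \<partial>M)"
      by (rule real_lebesgue_integral_def[OF i])
    finally have "ereal_expectation M (\<lambda>x. X x + V x) = ereal (integral\<^sup>L M V)"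
      using fin unfolding ereal_expectation_def
      by (cases "\<integral>\<^sup>+x. ennreal (X x + V x) \<partial>M"; cases "\<integral>\<^sup>+x. ennreal (- (X x + V x)) \<partial>M") auto
    moreover have "(\<integral>\<^sup>+x. ennreal (V x) \<partial>M) = ennreal (integral\<^sup>L M V)"
      using nn by (intro nn_integral_eq_integral Vi AE_I2)
    moreover have "0 \<le> integral\<^sup>L M V" using nn by (intro integral_nonneg_AE AE_I2)
    ultimately show ?thesis by simp
  next
    case False
    then have Vinf: "(\<integral>\<^sup>+x. ennreal (V x) \<partial>M) = \<infinity>" by (simp add: less_top[symmetric])
    have "(\<integral>\<^sup>+x. ennreal (V x) \<partial>M) \<le> (\<integral>\<^sup>+x. ennreal (X x + V x) + ennreal \<bar>X x\<bar> \<partial>M)"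
    proof (rule nn_integral_mono)
      fix x assume "x \<in> space M"
      have "ennreal (V x) \<le> ennreal (max 0 (X x + V x) + \<bar>X x\<bar>)" by (intro ennreal_leI) auto
      also have "\<dots> = ennreal (X x + V x) + ennreal \<bar>X x\<bar>"
        by (subst ennreal_plus) (auto simp: max_def ennreal_neg)
      finally show "ennreal (V x) \<le> ennreal (X x + V x) + ennreal \<bar>X x\<bar>" .
    qed
    also have "\<dots> = (\<integral>\<^sup>+x. ennreal (X x + V x) \<partial>M) + (\<integral>\<^sup>+x. ennreal \<bar>X x\<bar> \<partial>M)"
      by (rule nn_integral_add) auto
    finally have pos: "(\<integral>\<^sup>+x. ennreal (X x + V x) \<partial>M) = \<infinity>"
      using Vinf Xfin by (auto simp: top_unique)
    have "(\<integral>\<^sup>+x. ennreal (- (X x + V x)) \<partial>M) \<le> (\<integral>\<^sup>+x. ennreal \<bar>X x\<bar> \<partial>M)"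
      using nn by (intro nn_integral_mono ennreal_leI) (smt (verit))
    then have neg: "(\<integral>\<^sup>+x. ennreal (- (X x + V x)) \<partial>M) < \<infinity>" using Xfin by (rule le_less_trans)
    show ?thesis unfolding ereal_expectation_def pos Vinf using neg
      by (cases "\<integral>\<^sup>+x. ennreal (- (X x + V x)) \<partial>M") auto
  qed
qed

text \<open>Stated for arbitrary functions because it is applied to the stochastic exponentials,
  whose measurability is not established on its own; the integrals defining the two densities agree
  on every set.\<close>

lemma density_AE_cong:
  assumes "AE x in M. f x = g x"
  shows "density M f = density M g"
  unfolding density_def
  by (intro arg_cong[where f="measure_of (space M) (sets M)"] ext nn_integral_cong_AE)
     (use assms in eventually_elim, simp)

context wiener_poisson
begin

section \<open>Entropy of an exponential density\<close>

definition entropy_rate :: "(nat \<Rightarrow> real \<Rightarrow> 'a \<Rightarrow> real) \<Rightarrow> real \<Rightarrow> 'a \<Rightarrow> real" where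
  "entropy_rate \<beta> t \<omega> = (\<beta> 1 t \<omega>)\<^sup>2 / 2 + (\<beta> 2 t \<omega>)\<^sup>2 / 2 +
     lam 1 t * jump_cost (\<beta> 3 t \<omega>) + lam 2 t * jump_cost (\<beta> 4 t \<omega>)"

lemma LBINT_horizon: "(LBINT s:{0..T}. f s :: real) = (\<integral>s. f s \<partial>horizon)"
  unfolding set_lebesgue_integral_def by (rule integral_restrict_space[symmetric]) simp

lemma Gamma_predictable: "\<beta> \<in> Gamma P F T lam \<Longrightarrow> i \<in> {1..4} \<Longrightarrow> predictable P F T (\<beta> i)"
  by (simp add: Gamma_def)

lemma Gamma_measurable:
  assumes "\<beta> \<in> Gamma P F T lam" "i \<in> {1..4}"
  shows "(\<lambda>z. \<beta> i (fst z) (snd z)) \<in> borel_measurable (time_space P T)"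
  using predictable_measurable[OF Gamma_predictable[OF assms]] by (simp add: case_prod_beta')

lemma Gamma_square_integrable:
  assumes \<beta>: "\<beta> \<in> Gamma P F T lam" and i: "i \<in> {1, 2}"
  shows "(\<integral>\<^sup>+z. ennreal ((\<beta> i (fst z) (snd z))\<^sup>2) \<partial>time_space P T) < \<infinity>"
    and "(\<integral>\<^sup>+z. ennreal ((\<beta> (i + 2) (fst z) (snd z))\<^sup>2 * lam i (fst z)) \<partial>time_space P T) < \<infinity>"
proof -
  define b where "b = \<beta> (i + 2)"
  have [measurable]: "(\<lambda>z. \<beta> i (fst z) (snd z)) \<in> borel_measurable (time_space P T)"
    "(\<lambda>z. b (fst z) (snd z)) \<in> borel_measurable (time_space P T)"
    "lam i \<in> borel_measurable horizon"
    using i unfolding b_def by (auto intro!: Gamma_measurable[OF \<beta>] lam_horizon_measurable)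
  have "(\<Sum>i\<in>{1, 2}. \<integral>\<^sup>+\<omega>. (\<integral>\<^sup>+s\<in>{0..T}. ennreal ((\<beta> i s \<omega>)\<^sup>2) \<partial>lborel) \<partial>P) +
      (\<Sum>i\<in>{1, 2}. \<integral>\<^sup>+\<omega>. (\<integral>\<^sup>+s\<in>{0..T}. ennreal ((\<beta> (i + 2) s \<omega>)\<^sup>2 * lam i s) \<partial>lborel) \<partial>P) < \<infinity>"
    using \<beta> T_pos by (auto simp: Gamma_def)
  then have fin: "(\<integral>\<^sup>+\<omega>. (\<integral>\<^sup>+s. ennreal ((\<beta> i s \<omega>)\<^sup>2) \<partial>horizon) \<partial>P) < \<infinity>"
    "(\<integral>\<^sup>+\<omega>. (\<integral>\<^sup>+s. ennreal ((b s \<omega>)\<^sup>2 * lam i s) \<partial>horizon) \<partial>P) < \<infinity>"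
    using i by (auto simp: set_nn_integral_horizon b_def)
  show "(\<integral>\<^sup>+z. ennreal ((\<beta> i (fst z) (snd z))\<^sup>2) \<partial>time_space P T) < \<infinity>"
    using fin(1) by (subst (asm) nn_integral_time_space) (simp_all add: case_prod_beta')
  show "(\<integral>\<^sup>+z. ennreal ((\<beta> (i + 2) (fst z) (snd z))\<^sup>2 * lam i (fst z)) \<partial>time_space P T) < \<infinity>"
    unfolding b_def[symmetric]
    using fin(2) by (subst (asm) nn_integral_time_space) (simp_all add: case_prod_beta')
qed

lemma compensator_one_finite:
  assumes i: "i \<in> {1, 2}"
  shows "(\<integral>\<^sup>+z. ennreal (lam i (fst z)) \<partial>time_space P T) < \<infinity>"
proof -
  have "(\<integral>\<^sup>+z. ennreal (lam i (fst z)) \<partial>time_space P T) = compensator i (indicator ({0..T} \<times> space P))"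
    unfolding compensator_def
    by (intro nn_integral_cong) (auto simp: space_time_space indicator_def)
  then show ?thesis using compensates_space(2)[OF i] by simp
qed

text \<open>\<open>Gamma\<close> bounds the integral of \<beta>^2 \<lambda>. Since the total
  intensity is finite, |b| <= 1 + b^2 yields the integrability that \<open>M_integral_mean\<close>
  asks for.\<close>

lemma Gamma_M_integral_mean:
  assumes \<beta>: "\<beta> \<in> Gamma P F T lam" and i: "i \<in> {1, 2}"
  shows "has_bochner_integral P (M_integral (lam i) (N i) (\<beta> (i + 2)) T) 0"
proof (rule M_integral_mean[OF i])
  show "predictable P F T (\<beta> (i + 2))" using i by (intro Gamma_predictable[OF \<beta>]) auto
  define b where "b z = \<beta> (i + 2) (fst z) (snd z)" for z
  let ?l = "\<lambda>z. lam i (fst z)"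
  have [measurable]: "b \<in> borel_measurable (time_space P T)" "lam i \<in> borel_measurable horizon"
    using i unfolding b_def[abs_def] by (auto intro!: Gamma_measurable[OF \<beta>] lam_horizon_measurable)
  have "(\<integral>\<^sup>+z. ennreal \<bar>b z\<bar> * ennreal (?l z) \<partial>time_space P T) \<le>
      (\<integral>\<^sup>+z. ennreal (?l z) + ennreal ((b z)\<^sup>2 * ?l z) \<partial>time_space P T)"
  proof (rule nn_integral_mono)
    fix z assume "z \<in> space (time_space P T)"
    then have l: "0 \<le> ?l z" using lam_nonneg[OF i] by (auto simp: space_time_space)
    have "0 \<le> (\<bar>b z\<bar> - 1)\<^sup>2" by simp
    then have "\<bar>b z\<bar> \<le> 1 + (b z)\<^sup>2"
      using zero_le_power2[of "b z"] unfolding power2_diff by (simp add: field_simps)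
    then have "\<bar>b z\<bar> * ?l z \<le> ?l z + (b z)\<^sup>2 * ?l z"
      using mult_right_mono[OF _ l] by (fastforce simp: algebra_simps)
    then show "ennreal \<bar>b z\<bar> * ennreal (?l z) \<le> ennreal (?l z) + ennreal ((b z)\<^sup>2 * ?l z)"
      using l by (simp add: ennreal_mult'[symmetric] ennreal_plus[symmetric] ennreal_leI del: ennreal_plus)
  qed
  also have "\<dots> = (\<integral>\<^sup>+z. ennreal (?l z) \<partial>time_space P T) + (\<integral>\<^sup>+z. ennreal ((b z)\<^sup>2 * ?l z) \<partial>time_space P T)"
    by (rule nn_integral_add) auto
  also have "\<dots> < \<infinity>" using compensator_one_finite[OF i] Gamma_square_integrable(2)[OF \<beta> i]
    unfolding b_def by simp
  finally show "(\<integral>\<^sup>+z. ennreal \<bar>\<beta> (i + 2) (fst z) (snd z)\<bar> * ennreal (?l z) \<partial>time_space P T) < \<infinity>"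
    unfolding b_def .
qed

text \<open>\<open>LBINT\<close> has the default value 0 on paths that are not square integrable.
  Membership in \<open>Gamma\<close> makes these paths a null event, so the pathwise integral has
  the right mean.\<close>

lemma quadratic_variation:
  assumes \<beta>: "\<beta> \<in> Gamma P F T lam" and i: "i \<in> {1, 2}"
  shows "(\<lambda>\<omega>. LBINT s:{0..T}. (\<beta> i s \<omega>)\<^sup>2) \<in> borel_measurable P"
    and "(\<integral>\<^sup>+\<omega>. ennreal (LBINT s:{0..T}. (\<beta> i s \<omega>)\<^sup>2) \<partial>P) =
      (\<integral>\<^sup>+z. ennreal ((\<beta> i (fst z) (snd z))\<^sup>2) \<partial>time_space P T)"
proof -
  have [measurable]: "(\<lambda>z. \<beta> i (fst z) (snd z)) \<in> borel_measurable (time_space P T)"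
    using i by (intro Gamma_measurable[OF \<beta>]) auto
  have int: "integrable (time_space P T) (\<lambda>z. (\<beta> i (fst z) (snd z))\<^sup>2)"
    using Gamma_square_integrable(1)[OF \<beta> i] by (intro integrableI_nonneg) auto
  then have int': "integrable (time_space P T) (\<lambda>(s, \<omega>). (\<beta> i s \<omega>)\<^sup>2)" by (simp add: case_prod_beta')
  have I: "integrable P (\<lambda>\<omega>. \<integral>s. (\<beta> i s \<omega>)\<^sup>2 \<partial>horizon)"
    "(\<integral>\<omega>. (\<integral>s. (\<beta> i s \<omega>)\<^sup>2 \<partial>horizon) \<partial>P) = (\<integral>z. (\<beta> i (fst z) (snd z))\<^sup>2 \<partial>time_space P T)"
    using TP.integrable_snd[OF int'] TP.integral_snd[OF int'] by (simp_all add: case_prod_beta')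
  show "(\<lambda>\<omega>. LBINT s:{0..T}. (\<beta> i s \<omega>)\<^sup>2) \<in> borel_measurable P"
    using I(1) by (simp add: LBINT_horizon)
  show "(\<integral>\<^sup>+\<omega>. ennreal (LBINT s:{0..T}. (\<beta> i s \<omega>)\<^sup>2) \<partial>P) =
      (\<integral>\<^sup>+z. ennreal ((\<beta> i (fst z) (snd z))\<^sup>2) \<partial>time_space P T)"
    using nn_integral_eq_integral[OF I(1)] nn_integral_eq_integral[OF int] I(2)
    by (simp add: LBINT_horizon)
qed

text \<open>For a jump of size 1 the factor is (1 + b) exp (-b) = exp (-h(b)). The weight
  \<open>jump (N i) s \<omega>\<close>, here equal to 1, is kept so that the sum has the shape
  treated by the compensation formula.\<close>

lemma doleans_dade_M_eq:
  assumes i: "i \<in> {1, 2}" and \<omega>: "\<omega> \<in> space P" and one: "\<forall>u\<in>jump_times (N i) T \<omega>. jump (N i) u \<omega> = 1"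
    and b: "\<And>t. t \<in> {0..T} \<Longrightarrow> -1 < b t \<omega>"
  shows "doleans_dade_M (lam i) (N i) b T \<omega> = exp (M_integral (lam i) (N i) b T \<omega> -
    (\<Sum>s\<in>jump_times (N i) T \<omega>. jump_cost (b s \<omega>) * jump (N i) s \<omega>))"
proof -
  have "(\<Prod>s\<in>jump_times (N i) T \<omega>. (1 + b s \<omega> * jump (N i) s \<omega>) * exp (- (b s \<omega> * jump (N i) s \<omega>))) =
      (\<Prod>s\<in>jump_times (N i) T \<omega>. exp (- (jump_cost (b s \<omega>) * jump (N i) s \<omega>)))"
  proof (rule prod.cong)
    fix s assume s: "s \<in> jump_times (N i) T \<omega>"
    then have "-1 < b s \<omega>" using b by (auto simp: jump_times_def)
    then have "(1 + b s \<omega>) * exp (- b s \<omega>) = exp (- jump_cost (b s \<omega>))"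
      by (simp add: jump_cost_eq exp_diff exp_minus field_simps)
    then show "(1 + b s \<omega> * jump (N i) s \<omega>) * exp (- (b s \<omega> * jump (N i) s \<omega>)) =
        exp (- (jump_cost (b s \<omega>) * jump (N i) s \<omega>))"
      using one s by simp
  qed simp
  also have "\<dots> = exp (- (\<Sum>s\<in>jump_times (N i) T \<omega>. jump_cost (b s \<omega>) * jump (N i) s \<omega>))"
    unfolding sum_negf[symmetric] by (rule exp_sum[OF finite_jump_times[OF i \<omega>], symmetric])
  finally show ?thesis by (simp add: doleans_dade_M_def exp_diff exp_minus field_simps)
qed

text \<open>Up to a centered random variable, \<open>- ln (dQ / dP)\<close> is half the quadratic variation of the
  continuous part plus the sum of the costs of the jumps.\<close>

lemma relative_entropy_exponential:
  assumes \<beta>: "\<beta> \<in> Gamma P F T lam"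
    and b: "\<And>t \<omega>. t \<in> {0..T} \<Longrightarrow> \<omega> \<in> space P \<Longrightarrow> -1 < \<beta> 3 t \<omega> \<and> -1 < \<beta> 4 t \<omega>"
    and Q: "has_exponential_density P F T W N lam \<beta> Q"
  shows "relative_entropy P Q =
    enn2ereal (\<integral>\<^sup>+z. ennreal (entropy_rate \<beta> (fst z) (snd z)) \<partial>time_space P T)"
proof -
  obtain J where J: "\<And>i. i \<in> {1, 2} \<Longrightarrow> has_ito_integral_L2 P F T (W i) (\<beta> i) (J i)"
    and Q_eq: "Q = density P (\<lambda>\<omega>. ennreal (\<Prod>i\<in>{1, 2}. doleans_dade_W (\<beta> i) (J i) T \<omega> *
                       doleans_dade_M (lam i) (N i) (\<beta> (i + 2)) T \<omega>))"
    using Q unfolding has_exponential_density_def by blast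
  define q where "q i \<omega> = (LBINT s:{0..T}. (\<beta> i s \<omega>)\<^sup>2)" for i \<omega>
  define c where "c i \<omega> = (\<Sum>s\<in>jump_times (N i) T \<omega>. jump_cost (\<beta> (i + 2) s \<omega>) * jump (N i) s \<omega>)" for i \<omega>
  define m where "m i \<omega> = J i T \<omega> + M_integral (lam i) (N i) (\<beta> (i + 2)) T \<omega>" for i \<omega>
  define X where "X \<omega> = - (m 1 \<omega> + m 2 \<omega>)" for \<omega>
  define V where "V \<omega> = q 1 \<omega> / 2 + q 2 \<omega> / 2 + c 1 \<omega> + c 2 \<omega>" for \<omega>
  have pred: "predictable P F T (\<beta> (i + 2))" if "i \<in> {1, 2}" for i
    using that by (intro Gamma_predictable[OF \<beta>]) auto
  have qm: "q i \<in> borel_measurable P" if "i \<in> {1, 2}" for i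
    using quadratic_variation(1)[OF \<beta> that] unfolding q_def[abs_def] .
  have cm: "c i \<in> borel_measurable P" if "i \<in> {1, 2}" for i
    unfolding c_def[abs_def]
    by (rule jump_sum_nonneg_process(1)[OF that pred[OF that] jump_cost_measurable jump_cost_nonneg])
  have [measurable]: "q 1 \<in> borel_measurable P" "q 2 \<in> borel_measurable P"
    "c 1 \<in> borel_measurable P" "c 2 \<in> borel_measurable P" using qm cm by auto
  have qn: "0 \<le> q i \<omega>" for i \<omega>
    unfolding q_def LBINT_horizon by (intro integral_nonneg_AE AE_I2) auto
  have cn: "0 \<le> c i \<omega>" if "i \<in> {1, 2}" "\<omega> \<in> space P" for i \<omega>
    using jump_nonneg[OF that] jump_cost_nonneg unfolding c_def
    by (intro sum_nonneg mult_nonneg_nonneg) (auto simp: jump_times_def)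
  have mean: "has_bochner_integral P (m i) 0" if "i \<in> {1, 2}" for i
    using has_bochner_integral_add[OF ito_integral_mean[OF that J[OF that]] Gamma_M_integral_mean[OF \<beta> that]]
    unfolding m_def[abs_def] by simp
  have X: "has_bochner_integral P X 0"
    using has_bochner_integral_minus[OF has_bochner_integral_add[OF mean[of 1] mean[of 2]]]
    unfolding X_def[abs_def] by simp
  have Vm: "V \<in> borel_measurable P" unfolding V_def[abs_def] by measurable
  have Xm: "X \<in> borel_measurable P" using X by (auto simp: has_bochner_integral_iff)
  have factor: "AE \<omega> in P. doleans_dade_W (\<beta> i) (J i) T \<omega> * doleans_dade_M (lam i) (N i) (\<beta> (i + 2)) T \<omega> =
      exp (m i \<omega> - q i \<omega> / 2 - c i \<omega>)" if i: "i \<in> {1, 2}" for i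
    using AE_jumps_eq_1[OF i] AE_space
  proof eventually_elim
    case (elim \<omega>)
    have "-1 < \<beta> (i + 2) t \<omega>" if "t \<in> {0..T}" for t
    proof -
      have "i + 2 = 3 \<or> i + 2 = 4" using i by auto
      then show ?thesis using b[OF that elim(2)] by (auto simp only:)
    qed
    from doleans_dade_M_eq[where b="\<beta> (i + 2)", OF i elim(2,1) this] show ?case
      by (simp add: doleans_dade_W_def m_def q_def c_def flip: exp_add)
  qed
  have Q_eq': "Q = density P (\<lambda>\<omega>. ennreal (exp (- (X \<omega> + V \<omega>))))"
    unfolding Q_eq
  proof (rule density_AE_cong)
    show "AE \<omega> in P. ennreal (\<Prod>i\<in>{1, 2}. doleans_dade_W (\<beta> i) (J i) T \<omega> *
        doleans_dade_M (lam i) (N i) (\<beta> (i + 2)) T \<omega>) = ennreal (exp (- (X \<omega> + V \<omega>)))"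
      using factor[of 1, simplified] factor[of 2, simplified]
      by eventually_elim (simp add: X_def V_def algebra_simps flip: exp_add)
  qed
  have "(\<lambda>\<omega>. exp (- (X \<omega> + V \<omega>))) \<in> borel_measurable P" using Xm Vm by simp
  then have "relative_entropy P Q = ereal_expectation P (\<lambda>\<omega>. - ln (exp (- (X \<omega> + V \<omega>))))"
    unfolding Q_eq' by (rule relative_entropy_density[OF prob_space_axioms]) simp
  also have "\<dots> = ereal_expectation P (\<lambda>\<omega>. X \<omega> + V \<omega>)" by (simp add: add.commute)
  also have "\<dots> = enn2ereal (\<integral>\<^sup>+\<omega>. ennreal (V \<omega>) \<partial>P)"
    using qn cn by (intro ereal_expectation_add_centered X Vm) (auto simp: V_def)
  also have "(\<integral>\<^sup>+\<omega>. ennreal (V \<omega>) \<partial>P) =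
      (\<integral>\<^sup>+z. ennreal (entropy_rate \<beta> (fst z) (snd z)) \<partial>time_space P T)"
  proof -
    \<comment> \<open>Folding the constant 1/2 keeps each term in the form constant times function,
      to which linearity of the integral is applied.\<close>
    define h where "h = ennreal (1/2)"
    have half: "h * ennreal x = ennreal (x / 2)" for x
      unfolding h_def by (subst ennreal_mult'[symmetric]) simp_all
    let ?b = "\<lambda>i z. \<beta> i (fst z) (snd z)"
    have [measurable]: "?b 1 \<in> borel_measurable (time_space P T)" "?b 2 \<in> borel_measurable (time_space P T)"
      "?b 3 \<in> borel_measurable (time_space P T)" "?b 4 \<in> borel_measurable (time_space P T)"
      by (auto intro!: Gamma_measurable[OF \<beta>])
    have [measurable]: "lam 1 \<in> borel_measurable horizon" "lam 2 \<in> borel_measurable horizon"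
      by (auto intro!: lam_horizon_measurable)
    have q_eq: "(\<integral>\<^sup>+\<omega>. ennreal (q i \<omega>) \<partial>P) = (\<integral>\<^sup>+z. ennreal ((?b i z)\<^sup>2) \<partial>time_space P T)"
      if "i \<in> {1, 2}" for i unfolding q_def by (rule quadratic_variation(2)[OF \<beta> that])
    have c_eq: "(\<integral>\<^sup>+\<omega>. ennreal (c 1 \<omega>) \<partial>P) =
        (\<integral>\<^sup>+z. ennreal (jump_cost (?b 3 z)) * ennreal (lam 1 (fst z)) \<partial>time_space P T)"
      "(\<integral>\<^sup>+\<omega>. ennreal (c 2 \<omega>) \<partial>P) =
        (\<integral>\<^sup>+z. ennreal (jump_cost (?b 4 z)) * ennreal (lam 2 (fst z)) \<partial>time_space P T)"
    proof -
      have three: "1 + 2 = (3::nat)" and four: "2 + 2 = (4::nat)" by simp_all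
      show "(\<integral>\<^sup>+\<omega>. ennreal (c 1 \<omega>) \<partial>P) =
          (\<integral>\<^sup>+z. ennreal (jump_cost (?b 3 z)) * ennreal (lam 1 (fst z)) \<partial>time_space P T)"
        using jump_sum_nonneg_process(2)[OF _ pred jump_cost_measurable jump_cost_nonneg, of 1 1]
        unfolding c_def three by simp
      show "(\<integral>\<^sup>+\<omega>. ennreal (c 2 \<omega>) \<partial>P) =
          (\<integral>\<^sup>+z. ennreal (jump_cost (?b 4 z)) * ennreal (lam 2 (fst z)) \<partial>time_space P T)"
        using jump_sum_nonneg_process(2)[OF _ pred jump_cost_measurable jump_cost_nonneg, of 2 2]
        unfolding c_def four by simp
    qed
    have "(\<integral>\<^sup>+\<omega>. ennreal (V \<omega>) \<partial>P) = (\<integral>\<^sup>+\<omega>. h * ennreal (q 1 \<omega>) +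
        h * ennreal (q 2 \<omega>) + ennreal (c 1 \<omega>) + ennreal (c 2 \<omega>) \<partial>P)"
      using qn cn unfolding half by (intro nn_integral_cong) (simp add: V_def)
    also have "\<dots> = h * (\<integral>\<^sup>+\<omega>. ennreal (q 1 \<omega>) \<partial>P) + h * (\<integral>\<^sup>+\<omega>. ennreal (q 2 \<omega>) \<partial>P) +
        (\<integral>\<^sup>+\<omega>. ennreal (c 1 \<omega>) \<partial>P) + (\<integral>\<^sup>+\<omega>. ennreal (c 2 \<omega>) \<partial>P)"
      by (simp add: nn_integral_add nn_integral_cmult del: One_nat_def)
    also have "\<dots> = h * (\<integral>\<^sup>+z. ennreal ((?b 1 z)\<^sup>2) \<partial>time_space P T) +
        h * (\<integral>\<^sup>+z. ennreal ((?b 2 z)\<^sup>2) \<partial>time_space P T) +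
        (\<integral>\<^sup>+z. ennreal (jump_cost (?b 3 z)) * ennreal (lam 1 (fst z)) \<partial>time_space P T) +
        (\<integral>\<^sup>+z. ennreal (jump_cost (?b 4 z)) * ennreal (lam 2 (fst z)) \<partial>time_space P T)"
      using q_eq[of 1] q_eq[of 2] unfolding c_eq by simp
    also have "\<dots> = (\<integral>\<^sup>+z. h * ennreal ((?b 1 z)\<^sup>2) + h * ennreal ((?b 2 z)\<^sup>2) +
        ennreal (jump_cost (?b 3 z)) * ennreal (lam 1 (fst z)) +
        ennreal (jump_cost (?b 4 z)) * ennreal (lam 2 (fst z)) \<partial>time_space P T)"
      by (simp add: nn_integral_add nn_integral_cmult del: One_nat_def)
    also have "\<dots> = (\<integral>\<^sup>+z. ennreal (entropy_rate \<beta> (fst z) (snd z)) \<partial>time_space P T)"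
    proof (rule nn_integral_cong)
      fix z assume "z \<in> space (time_space P T)"
      then have l: "0 \<le> lam 1 (fst z)" "0 \<le> lam 2 (fst z)" using lam_nonneg by (auto simp: space_time_space)
      then show "h * ennreal ((?b 1 z)\<^sup>2) + h * ennreal ((?b 2 z)\<^sup>2) +
        ennreal (jump_cost (?b 3 z)) * ennreal (lam 1 (fst z)) +
        ennreal (jump_cost (?b 4 z)) * ennreal (lam 2 (fst z)) = ennreal (entropy_rate \<beta> (fst z) (snd z))"
        using jump_cost_nonneg unfolding half
        by (simp add: entropy_rate_def ennreal_mult'[symmetric] ennreal_plus[symmetric] mult.commute del: ennreal_plus)
    qed
    finally show ?thesis .
  qed
  finally show ?thesis .
qed

text \<open>The product puts time first, so its null sets are sectioned at fixed times;
  measurability of both functions allows the exchange to sections along paths.\<close>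

lemma AE_time_space_swap:
  assumes [measurable]: "(\<lambda>z. f (fst z) (snd z) :: real) \<in> borel_measurable (time_space P T)"
      "(\<lambda>z. g (fst z) (snd z)) \<in> borel_measurable (time_space P T)"
    and eq: "AE z in time_space P T. f (fst z) (snd z) = g (fst z) (snd z)"
  shows "AE \<omega> in P. AE s in horizon. f s \<omega> = g s \<omega>"
proof -
  have "AE s in horizon. AE \<omega> in P. f s \<omega> = g s \<omega>" using TP.AE_pair[OF eq] by simp
  then show ?thesis by (subst TP.AE_commute[symmetric]) simp_all
qed

lemma measurable_section:
  assumes "(\<lambda>z. f (fst z) (snd z)) \<in> borel_measurable (time_space P T)" "\<omega> \<in> space P"
  shows "(\<lambda>s. f s \<omega>) \<in> borel_measurable horizon"
  using measurable_compose[OF measurable_Pair2'[OF assms(2)] assms(1)] by simp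

text \<open>Agreement of \<open>G\<close> and \<open>H\<close> almost everywhere says nothing about
  the jump times of a single path. Predictability helps: the expected sum of |G - H| over the jumps
  equals its integral against \<lambda> dt, which is 0, so almost surely \<open>G\<close> and
  \<open>H\<close> agree at every jump time.\<close>

lemma doleans_dade_M_cong:
  assumes i: "i \<in> {1, 2}" and G: "predictable P F T G" and H: "predictable P F T H"
    and eq: "AE z in time_space P T. lam i (fst z) * G (fst z) (snd z) = lam i (fst z) * H (fst z) (snd z)"
  shows "AE \<omega> in P. doleans_dade_M (lam i) (N i) G T \<omega> = doleans_dade_M (lam i) (N i) H T \<omega>"
proof -
  have [measurable]: "(\<lambda>z. G (fst z) (snd z)) \<in> borel_measurable (time_space P T)"
    "(\<lambda>z. H (fst z) (snd z)) \<in> borel_measurable (time_space P T)" "lam i \<in> borel_measurable horizon"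
    using predictable_measurable[OF G] predictable_measurable[OF H] lam_horizon_measurable[OF i]
    by (simp_all add: case_prod_beta')
  have "AE \<omega> in P. AE s in horizon. lam i s * G s \<omega> = lam i s * H s \<omega>"
    by (rule AE_time_space_swap[OF _ _ eq]) measurable
  then have drift: "AE \<omega> in P. (LBINT s:{0..T}. G s \<omega> * lam i s) = (LBINT s:{0..T}. H s \<omega> * lam i s)"
    using AE_space
  proof eventually_elim
    case (elim \<omega>)
    note [measurable] = measurable_section[of G, OF _ elim(2)] measurable_section[of H, OF _ elim(2)]
    show ?case unfolding LBINT_horizon
      by (rule integral_cong_AE) (use elim(1) in \<open>auto simp: mult.commute\<close>)
  qed
  let ?D = "\<lambda>s \<omega>. G s \<omega> - H s \<omega>"
  have D: "predictable P F T ?D"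
    using borel_measurable_diff[OF G[unfolded predictable_def] H[unfolded predictable_def]]
    by (simp add: predictable_def case_prod_beta')
  have "(\<integral>\<^sup>+\<omega>. ennreal (\<Sum>s\<in>jump_times (N i) T \<omega>. \<bar>?D s \<omega>\<bar> * jump (N i) s \<omega>) \<partial>P) =
      (\<integral>\<^sup>+z. ennreal \<bar>?D (fst z) (snd z)\<bar> * ennreal (lam i (fst z)) \<partial>time_space P T)"
    by (rule jump_sum_nonneg_process(2)[OF i D]) auto
  also have "\<dots> = (\<integral>\<^sup>+z. 0 \<partial>time_space P T)"
    by (intro nn_integral_cong_AE, use eq in eventually_elim) auto
  also have "\<dots> = 0" by simp
  finally have zero: "(\<integral>\<^sup>+\<omega>. ennreal (\<Sum>s\<in>jump_times (N i) T \<omega>. \<bar>?D s \<omega>\<bar> * jump (N i) s \<omega>) \<partial>P) = 0" .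
  have [measurable]: "(\<lambda>\<omega>. \<Sum>s\<in>jump_times (N i) T \<omega>. \<bar>?D s \<omega>\<bar> * jump (N i) s \<omega>) \<in> borel_measurable P"
    by (rule jump_sum_nonneg_process(1)[OF i D]) auto
  have "AE \<omega> in P. ennreal (\<Sum>s\<in>jump_times (N i) T \<omega>. \<bar>?D s \<omega>\<bar> * jump (N i) s \<omega>) = 0"
    using zero by (subst (asm) nn_integral_0_iff_AE) auto
  then have jumps: "AE \<omega> in P. \<forall>s\<in>jump_times (N i) T \<omega>. G s \<omega> = H s \<omega>"
    using AE_space
  proof eventually_elim
    case (elim \<omega>)
    have nn: "0 < jump (N i) s \<omega>" if "s \<in> jump_times (N i) T \<omega>" for s
      using jump_nonneg[OF i elim(2), of s] that by (auto simp: jump_times_def)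
    have le: "(\<Sum>s\<in>jump_times (N i) T \<omega>. \<bar>?D s \<omega>\<bar> * jump (N i) s \<omega>) \<le> 0"
      using elim(1) by (simp only: ennreal_eq_0_iff)
    have nn': "0 \<le> \<bar>?D s \<omega>\<bar> * jump (N i) s \<omega>" if "s \<in> jump_times (N i) T \<omega>" for s
      using nn[OF that] by simp
    have "(\<Sum>s\<in>jump_times (N i) T \<omega>. \<bar>?D s \<omega>\<bar> * jump (N i) s \<omega>) = 0"
      using le sum_nonneg[OF nn'] by (rule antisym)
    then have z: "\<forall>s\<in>jump_times (N i) T \<omega>. \<bar>?D s \<omega>\<bar> * jump (N i) s \<omega> = 0"
      by (rule sum_nonneg_eq_0_iff[THEN iffD1, rotated 2]) (rule finite_jump_times[OF i elim(2)], rule nn')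
    show ?case
    proof
      fix s assume "s \<in> jump_times (N i) T \<omega>"
      then show "G s \<omega> = H s \<omega>" using bspec[OF z, of s] nn[of s] by simp
    qed
  qed
  show ?thesis
    using drift jumps by eventually_elim (simp add: doleans_dade_M_def M_integral_def cong: prod.cong sum.cong)
qed

text \<open>This also covers the choice of versions: \<open>Q\<close> and \<open>R\<close> may be
  built from different Ito integrals \<open>J\<close> and \<open>K\<close>. The jump integrands are
  compared only through their products with the intensity, in the form provided by
  \<open>cost_minimal\<close>.\<close>

lemma exponential_density_unique:
  assumes \<beta>: "\<beta> \<in> Gamma P F T lam" and \<gamma>: "\<gamma> \<in> Gamma P F T lam"
    and Q: "has_exponential_density P F T W N lam \<beta> Q" and R: "has_exponential_density P F T W N lam \<gamma> R"
    and eqW: "\<And>i. i \<in> {1, 2} \<Longrightarrow> AE z in time_space P T. \<beta> i (fst z) (snd z) = \<gamma> i (fst z) (snd z)"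
    and eqM: "\<And>i. i \<in> {1, 2} \<Longrightarrow> AE z in time_space P T.
      lam i (fst z) * \<beta> (i + 2) (fst z) (snd z) = lam i (fst z) * \<gamma> (i + 2) (fst z) (snd z)"
  shows "Q = R"
proof -
  obtain J where J: "\<And>i. i \<in> {1, 2} \<Longrightarrow> has_ito_integral_L2 P F T (W i) (\<beta> i) (J i)"
    and Q_eq: "Q = density P (\<lambda>\<omega>. ennreal (\<Prod>i\<in>{1, 2}. doleans_dade_W (\<beta> i) (J i) T \<omega> *
                       doleans_dade_M (lam i) (N i) (\<beta> (i + 2)) T \<omega>))"
    using Q unfolding has_exponential_density_def by blast
  obtain K where K: "\<And>i. i \<in> {1, 2} \<Longrightarrow> has_ito_integral_L2 P F T (W i) (\<gamma> i) (K i)"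
    and R_eq: "R = density P (\<lambda>\<omega>. ennreal (\<Prod>i\<in>{1, 2}. doleans_dade_W (\<gamma> i) (K i) T \<omega> *
                       doleans_dade_M (lam i) (N i) (\<gamma> (i + 2)) T \<omega>))"
    using R unfolding has_exponential_density_def by blast
  have W: "AE \<omega> in P. doleans_dade_W (\<beta> i) (J i) T \<omega> = doleans_dade_W (\<gamma> i) (K i) T \<omega>" if i: "i \<in> {1, 2}" for i
  proof -
    have i4: "i \<in> {1..4}" using i by auto
    note [measurable] = Gamma_measurable[OF \<beta> i4] Gamma_measurable[OF \<gamma> i4]
    have "AE \<omega> in P. J i T \<omega> = K i T \<omega>"
      by (rule ito_integral_unique[OF i J[OF i] K[OF i]]) (use eqW[OF i] in \<open>simp add: case_prod_beta'\<close>)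
    moreover have "AE \<omega> in P. AE s in horizon. \<beta> i s \<omega> = \<gamma> i s \<omega>"
      by (rule AE_time_space_swap[OF _ _ eqW[OF i]]) measurable
    then have "AE \<omega> in P. (LBINT s:{0..T}. (\<beta> i s \<omega>)\<^sup>2) = (LBINT s:{0..T}. (\<gamma> i s \<omega>)\<^sup>2)"
      using AE_space
    proof eventually_elim
      case (elim \<omega>)
      note [measurable] = measurable_section[of "\<beta> i", OF _ elim(2)] measurable_section[of "\<gamma> i", OF _ elim(2)]
      show ?case unfolding LBINT_horizon
        by (rule integral_cong_AE) (use elim(1) in \<open>auto elim!: eventually_mono\<close>)
    qed
    ultimately show ?thesis by eventually_elim (simp add: doleans_dade_W_def)
  qed
  have M: "AE \<omega> in P. doleans_dade_M (lam i) (N i) (\<beta> (i + 2)) T \<omega> = doleans_dade_M (lam i) (N i) (\<gamma> (i + 2)) T \<omega>"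
    if i: "i \<in> {1, 2}" for i
    using i by (intro doleans_dade_M_cong[OF i _ _ eqM[OF i]] Gamma_predictable[OF \<beta>] Gamma_predictable[OF \<gamma>]) auto
  show ?thesis unfolding Q_eq R_eq
  proof (rule density_AE_cong)
    have "AE \<omega> in P. \<forall>i\<in>{1, 2}. doleans_dade_W (\<beta> i) (J i) T \<omega> * doleans_dade_M (lam i) (N i) (\<beta> (i + 2)) T \<omega> =
        doleans_dade_W (\<gamma> i) (K i) T \<omega> * doleans_dade_M (lam i) (N i) (\<gamma> (i + 2)) T \<omega>"
    proof (rule AE_finite_allI)
      show "AE \<omega> in P. doleans_dade_W (\<beta> i) (J i) T \<omega> * doleans_dade_M (lam i) (N i) (\<beta> (i + 2)) T \<omega> =
        doleans_dade_W (\<gamma> i) (K i) T \<omega> * doleans_dade_M (lam i) (N i) (\<gamma> (i + 2)) T \<omega>" if "i \<in> {1, 2}" for i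
        using W[OF that] M[OF that] by eventually_elim (simp only:)
    qed simp
    then show "AE \<omega> in P. ennreal (\<Prod>i\<in>{1, 2}. doleans_dade_W (\<beta> i) (J i) T \<omega> * doleans_dade_M (lam i) (N i) (\<beta> (i + 2)) T \<omega>) =
        ennreal (\<Prod>i\<in>{1, 2}. doleans_dade_W (\<gamma> i) (K i) T \<omega> * doleans_dade_M (lam i) (N i) (\<gamma> (i + 2)) T \<omega>)"
      by eventually_elim (intro arg_cong[where f=ennreal] prod.cong, auto)
  qed
qed

lemma entropy_rate_measurable:
  assumes \<beta>: "\<beta> \<in> Gamma P F T lam"
  shows "(\<lambda>z. entropy_rate \<beta> (fst z) (snd z)) \<in> borel_measurable (time_space P T)"
proof -
  have [measurable]: "(\<lambda>z. \<beta> 1 (fst z) (snd z)) \<in> borel_measurable (time_space P T)"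
    "(\<lambda>z. \<beta> 2 (fst z) (snd z)) \<in> borel_measurable (time_space P T)"
    "(\<lambda>z. \<beta> 3 (fst z) (snd z)) \<in> borel_measurable (time_space P T)"
    "(\<lambda>z. \<beta> 4 (fst z) (snd z)) \<in> borel_measurable (time_space P T)"
    "lam 1 \<in> borel_measurable horizon" "lam 2 \<in> borel_measurable horizon"
    by (auto intro!: Gamma_measurable[OF \<beta>] lam_horizon_measurable)
  show ?thesis unfolding entropy_rate_def by measurable
qed

end

text \<open>The difference g - f is nonnegative and integrates to 0; finiteness of the integral of
  \<open>f\<close> makes the subtraction legitimate.\<close>

lemma nn_integral_eq_imp_AE_eq:
  fixes f g :: "'b \<Rightarrow> real"
  assumes [measurable]: "f \<in> borel_measurable M" "g \<in> borel_measurable M"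
    and le: "AE x in M. 0 \<le> f x \<and> f x \<le> g x"
    and eq: "(\<integral>\<^sup>+x. ennreal (g x) \<partial>M) = (\<integral>\<^sup>+x. ennreal (f x) \<partial>M)"
    and fin: "(\<integral>\<^sup>+x. ennreal (f x) \<partial>M) < \<infinity>"
  shows "AE x in M. g x = f x"
proof -
  have "(\<integral>\<^sup>+x. ennreal (g x) - ennreal (f x) \<partial>M) = (\<integral>\<^sup>+x. ennreal (g x) \<partial>M) - (\<integral>\<^sup>+x. ennreal (f x) \<partial>M)"
    using fin le by (intro nn_integral_diff) (auto intro: ennreal_leI)
  also have "\<dots> = 0" using fin by (simp add: eq)
  finally have "AE x in M. ennreal (g x) - ennreal (f x) = 0"
    by (subst (asm) nn_integral_0_iff_AE) auto
  then show ?thesis using le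
    by eventually_elim (auto simp: ennreal_minus ennreal_eq_0_iff)
qed

theorem proposition4p1:
  fixes P :: "'a measure"
    and T x y :: real
    and W :: "nat \<Rightarrow> real \<Rightarrow> 'a \<Rightarrow> real"
    and N :: "nat \<Rightarrow> real \<Rightarrow> 'a \<Rightarrow> nat"
    and lam a :: "nat \<Rightarrow> real \<Rightarrow> real"
    and F :: "real \<Rightarrow> 'a measure"
    and r A :: "real \<Rightarrow> real"
    and mu muY S Y :: "real \<Rightarrow> 'a \<Rightarrow> real"
    and sigY beta_hat :: "nat \<Rightarrow> real \<Rightarrow> 'a \<Rightarrow> real"
    and sig :: "real \<Rightarrow> real \<Rightarrow> real"
    and Q_hat :: "'a measure"
  assumes market: "market P T W N lam F r A mu muY sigY sig a x y S Y"
    and beta_hat: "beta_hat \<in> Gamma_H P F T lam r mu sig a Y"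
    and beta_hat_24: "AE (t, \<omega>) in time_space P T. beta_hat 2 t \<omega> = 0 \<and> beta_hat 4 t \<omega> = 0"
    and beta_hat_1: "AE (t, \<omega>) in time_space P T.
      beta_hat 1 t \<omega> =
        (if a 1 t \<noteq> 0
         then (r t - mu t \<omega> - lam 1 t * a 3 t * sig t (Y t \<omega>) * beta_hat 3 t \<omega>)
                / (sig t (Y t \<omega>) * a 1 t)
         else 0)"
    and beta_hat_3: "AE (t, \<omega>) in time_space P T. \<forall>z.
      z > -1 \<and>
        lam 1 t * sig t (Y t \<omega>) * (a 3 t)\<^sup>2 * z
          + (a 1 t)\<^sup>2 * sig t (Y t \<omega>) * (z / (1 + z)) - a 3 t * (r t - mu t \<omega>) = 0
      \<longleftrightarrow> z = beta_hat 3 t \<omega>"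
    and Q_hat: "has_exponential_density P F T W N lam beta_hat Q_hat"
    and Q_hat_EMM: "Q_hat \<in> EMM P F T r S"
  shows "Q_hat \<in> EMM P F T r S \<and>
         (\<forall>\<beta>\<in>Gamma_H P F T lam r mu sig a Y. \<forall>Q.
            has_exponential_density P F T W N lam \<beta> Q \<longrightarrow>
              relative_entropy P Q_hat \<le> relative_entropy P Q \<and>
              (relative_entropy P Q_hat < \<infinity> \<longrightarrow> relative_entropy P Q = relative_entropy P Q_hat
                 \<longrightarrow> Q = Q_hat))"
proof (intro conjI Q_hat_EMM ballI allI impI)
  interpret market P T W N lam F r A mu muY sigY sig a x y S Y by (rule market)
  let ?c = "\<lambda>i z. beta_hat i (fst z) (snd z)"
  have cG: "beta_hat \<in> Gamma P F T lam" and c34: "\<And>t \<omega>. t \<in> {0..T} \<Longrightarrow> \<omega> \<in> space P \<Longrightarrow>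
      -1 < beta_hat 3 t \<omega> \<and> -1 < beta_hat 4 t \<omega>"
    and c_drift: "AE (t, \<omega>) in time_space P T. mu t \<omega> - r t + beta_hat 1 t \<omega> * a 1 t * sig t (Y t \<omega>)
             + lam 1 t * beta_hat 3 t \<omega> * a 3 t * sig t (Y t \<omega>) = 0"
    using beta_hat by (auto simp: Gamma_H_def)
  have c_entropy: "relative_entropy P Q_hat =
      enn2ereal (\<integral>\<^sup>+z. ennreal (entropy_rate beta_hat (fst z) (snd z)) \<partial>time_space P T)"
    by (rule relative_entropy_exponential[OF cG _ Q_hat]) (rule c34)
  fix \<beta> Q
  assume "\<beta> \<in> Gamma_H P F T lam r mu sig a Y" and Q: "has_exponential_density P F T W N lam \<beta> Q"
  then have bG: "\<beta> \<in> Gamma P F T lam" and b34: "\<And>t \<omega>. t \<in> {0..T} \<Longrightarrow> \<omega> \<in> space P \<Longrightarrow>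
      -1 < \<beta> 3 t \<omega> \<and> -1 < \<beta> 4 t \<omega>"
    and b_drift: "AE (t, \<omega>) in time_space P T. mu t \<omega> - r t + \<beta> 1 t \<omega> * a 1 t * sig t (Y t \<omega>)
             + lam 1 t * \<beta> 3 t \<omega> * a 3 t * sig t (Y t \<omega>) = 0"
    by (auto simp: Gamma_H_def)
  have b_entropy: "relative_entropy P Q =
      enn2ereal (\<integral>\<^sup>+z. ennreal (entropy_rate \<beta> (fst z) (snd z)) \<partial>time_space P T)"
    by (rule relative_entropy_exponential[OF bG _ Q]) (rule b34)
  let ?b = "\<lambda>i z. \<beta> i (fst z) (snd z)"
  let ?eb = "\<lambda>z. entropy_rate \<beta> (fst z) (snd z)" and ?ec = "\<lambda>z. entropy_rate beta_hat (fst z) (snd z)"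
  \<comment> \<open>The pointwise minimization, at almost every (t, \<omega>). The equality case is
    recorded as an implication, to be used once the two entropies are known to coincide.\<close>
  have main: "AE z in time_space P T. ?c 2 z = 0 \<and> ?c 4 z = 0 \<and> 0 \<le> ?ec z \<and> ?ec z \<le> ?eb z \<and>
      (?eb z = ?ec z \<longrightarrow> ?b 1 z = ?c 1 z \<and> ?b 2 z = 0 \<and>
        lam 1 (fst z) * ?b 3 z = lam 1 (fst z) * ?c 3 z \<and> lam 2 (fst z) * ?b 4 z = 0)"
    using beta_hat_24 beta_hat_1 beta_hat_3 c_drift b_drift AE_space
  proof eventually_elim
    case (elim z)
    obtain t \<omega> where z: "z = (t, \<omega>)" by (cases z)
    have t: "t \<in> {0..T}" and \<omega>: "\<omega> \<in> space P" using elim(6) by (auto simp: z space_time_space)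
    have l: "0 \<le> lam 1 t" "0 \<le> lam 2 t" using lam_nonneg t by auto
    note e = elim(1-5)[unfolded z prod.case]
    \<comment> \<open>Both drift conditions are brought to the form of \<open>cost_minimal\<close>
      with the common constant d = r - mu.\<close>
    have b: "- (r t - mu t \<omega>) + \<beta> 1 t \<omega> * a 1 t * sig t (Y t \<omega>) + lam 1 t * \<beta> 3 t \<omega> * a 3 t * sig t (Y t \<omega>) = 0"
      and c: "- (r t - mu t \<omega>) + beta_hat 1 t \<omega> * a 1 t * sig t (Y t \<omega>) + lam 1 t * beta_hat 3 t \<omega> * a 3 t * sig t (Y t \<omega>) = 0"
      using e(4,5) by simp_all
    note minimal = cost_minimal[OF sig_nonzero[OF t] b c e(2) e(3)[THEN spec] l
      conjunct1[OF b34[OF t \<omega>]] conjunct2[OF b34[OF t \<omega>]], of "\<beta> 2 t \<omega>"]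
    have ec: "entropy_rate beta_hat t \<omega> = (beta_hat 1 t \<omega>)\<^sup>2 / 2 + lam 1 t * jump_cost (beta_hat 3 t \<omega>)"
      using e(1) by (simp add: entropy_rate_def jump_cost_eq)
    moreover have "0 \<le> entropy_rate beta_hat t \<omega>"
      unfolding ec using l jump_cost_nonneg by simp
    ultimately show ?case
      using e(1) minimal unfolding z fst_conv snd_conv entropy_rate_def[of \<beta>] by simp
  qed
  have le: "(\<integral>\<^sup>+z. ennreal (?ec z) \<partial>time_space P T) \<le> (\<integral>\<^sup>+z. ennreal (?eb z) \<partial>time_space P T)"
    by (intro nn_integral_mono_AE, use main in eventually_elim) (simp add: ennreal_leI)
  then show "relative_entropy P Q_hat \<le> relative_entropy P Q"
    unfolding c_entropy b_entropy by (simp add: less_eq_ennreal.rep_eq)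
  assume fin: "relative_entropy P Q_hat < \<infinity>" and eq: "relative_entropy P Q = relative_entropy P Q_hat"
  have eq': "(\<integral>\<^sup>+z. ennreal (?eb z) \<partial>time_space P T) = (\<integral>\<^sup>+z. ennreal (?ec z) \<partial>time_space P T)"
    using eq unfolding c_entropy b_entropy by (simp add: enn2ereal_inject)
  have fin': "(\<integral>\<^sup>+z. ennreal (?ec z) \<partial>time_space P T) < \<infinity>"
    using fin unfolding c_entropy by (simp add: less_ennreal.rep_eq)
  \<comment> \<open>Ordered integrands with equal finite integrals coincide almost everywhere;
    finiteness of the minimal entropy enters here. The equality case of \<open>main\<close> then
    identifies the integrands of the two exponentials.\<close>
  have "AE z in time_space P T. ?eb z = ?ec z"
    by (rule nn_integral_eq_imp_AE_eq[OF entropy_rate_measurable[OF cG] entropy_rate_measurable[OF bG] _ eq' fin'])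
       (use main in eventually_elim, simp)
  with main have same: "AE z in time_space P T. ?b 1 z = ?c 1 z \<and> ?b 2 z = ?c 2 z \<and>
      lam 1 (fst z) * ?b 3 z = lam 1 (fst z) * ?c 3 z \<and> lam 2 (fst z) * ?b 4 z = lam 2 (fst z) * ?c 4 z"
    by eventually_elim simp
  show "Q = Q_hat"
  proof (rule exponential_density_unique[OF bG cG Q Q_hat])
    show "AE z in time_space P T. ?b i z = ?c i z" if "i \<in> {1, 2}" for i
      using same by eventually_elim (use that in auto)
    show "AE z in time_space P T. lam i (fst z) * ?b (i + 2) z = lam i (fst z) * ?c (i + 2) z"
      if "i \<in> {1, 2}" for i
    proof -
      have "i = 1 \<and> i + 2 = 3 \<or> i = 2 \<and> i + 2 = 4" using that by auto
      then show ?thesis by (elim disjE conjE; use same in eventually_elim) (simp_all only:)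
    qed
  qed
qed

end
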